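(* Let $X$ and $Y$ be $\mathrm{CAT}(0)$ cube complexes with no extremal vertices, neither of which is isomorphic to $\mathbb{R}$. Let $f\colon\partial X\to\partial Y$ be a cross-ratio preserving (i.e. Möbius) bijection between their Roller boundaries. Then $f$ uniquely extends to a cubical isomorphism $F\colon X\to Y$; that is, there exists a unique cubical isomorphism $F\colon X\to Y$ whose induced map $\overline F\colon\overline X\to\overline Y$ on Roller compactifications satisfies $\overline F|_{\partial X}=f$.
   Context: A $\mathrm{CAT}(0)$ cube complex is a (nonempty) simply connected cube complex all of whose vertex links are flag simplicial complexes; no finite-dimensionality or local finiteness is assumed. "Points" of $X$ are always vertices ($X$ is identified with its $0$-skeleton), and $d$ is the combinatorial metric: $d(v,w)$ is the minimal length of an edge path from $v$ to $w$ in the $1$-skeleton. A cubical isomorphism is an isomorphism of cube complexes (a cellular isometry). $\mathbb{R}$ is viewed as a cube complex with vertex set $\mathbb{Z}$. A vertex $v\in X$ is extremal if there exists an edge $e$ incident to $v$ such that every other edge incident to $v$ spans a square with $e$. $\mathscr{W}(X)$ and $\mathscr{H}(X)$ are the sets of hyperplanes and halfspaces of $X$; $\mathfrak{h}^*$ is the complement of the halfspace $\mathfrak{h}$, and $\mathfrak{h},\mathfrak{h}^*$ are the two sides of a hyperplane. An ultrafilter is a subset $\sigma\subseteq\mathscr{H}(X)$ such that any two elements of $\sigma$ intersect and, for every hyperplane, a side of it lies in $\sigma$. The Roller compactification $\overline X$ is the set of all ultrafilters; $X$ is embedded in it by $v\mapsto\sigma_v=\{\mathfrak{h}\mid v\in\mathfrak{h}\}$.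 The Roller boundary is $\partial X=\overline X\setminus X$. For $x\in\overline X$ represented by the ultrafilter $\sigma_x$, we say $x$ lies in the halfspace $\mathfrak{h}$ iff $\mathfrak{h}\in\sigma_x$. A cubical isomorphism $F\colon X\to Y$ induces a bijection of halfspaces, hence of ultrafilters, giving $\overline F\colon\overline X\to\overline Y$. For $A,B\subseteq\overline X$, $\mathscr{W}(A|B)$ is the set of hyperplanes having a side $\mathfrak{h}$ with $B\subseteq\mathfrak{h}$ and $A\subseteq\mathfrak{h}^*$. For $v\in X$ and $x,y\in\overline X$, the Gromov product is $(x\cdot y)_v=\#\mathscr{W}(v|x,y)\in\mathbb{N}\cup\{+\infty\}$ (all infinite cardinalities are denoted $+\infty$). $\mathscr{A}(X)\subseteq(\overline X)^4$ is the set of $(x,y,z,w)$ such that at most one of the three values $(x\cdot y)_v+(z\cdot w)_v$, $(x\cdot z)_v+(y\cdot w)_v$, $(x\cdot w)_v+(y\cdot z)_v$ is infinite. On $\mathscr{A}(X)$ the cross ratio with values in $\mathbb{Z}\cup\{\pm\infty\}$ is $$\mathrm{cr}(x,y,z,w)=(x\cdot z)_v+(y\cdot w)_v-(x\cdot w)_v-(y\cdot z)_v.$$ Both $\mathscr{A}(X)$ and $\mathrm{cr}$ are independent of the vertex $v$. A map $f\colon\partial X\to\partial Y$ is Möbius (cross-ratio preserving) if, for all $x,y,z,w\in\partial X$ with $(x,y,z,w)\in\mathscr{A}(X)$, we have $(f(x),f(y),f(z),f(w))\in\mathscr{A}(Y)$ and $\mathrm{cr}(f(x),f(y),f(z),f(w))=\mathrm{cr}(x,y,z,w)$.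 *)

theory Defs
  imports "HOL-Analysis.Analysis"
begin

section \<open>Cube complexes\<close>

text \<open>
  A cube complex is encoded by the family \<open>X\<close> of the vertex sets of its cubes. The standard
  \<open>n\<close>-cube has vertex set \<open>Pow {..<n}\<close> (a vertex of \<open>[0,1]^n\<close> is the set of coordinates at
  which it equals 1), and its nonempty faces are the intervals \<open>{S. A \<subseteq> S \<and> S \<subseteq> B}\<close>.
\<close>

definition cube_faces :: "nat \<Rightarrow> nat set set set" where
  "cube_faces n = {{S. A \<subseteq> S \<and> S \<subseteq> B} | A B. A \<subseteq> B \<and> B \<subseteq> {..<n}}"

definition cube_chart :: "'a set set \<Rightarrow> nat \<Rightarrow> (nat set \<Rightarrow> 'a) \<Rightarrow> 'a set \<Rightarrow> bool" where
  "cube_chart X n \<phi> Q \<longleftrightarrow>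
     bij_betw \<phi> (Pow {..<n}) Q \<and> {R \<in> X. R \<subseteq> Q} = (\<lambda>T. \<phi> ` T) ` cube_faces n"

definition verts :: "'a set set \<Rightarrow> 'a set" where
  "verts X = \<Union>X"

text \<open>
  This is the notion of cubed complex of Bridson and Haefliger (Definition I.7.32), in every
  dimension: the cubes embed, and two cubes that meet do so in a common face. Hence a cube is
  determined by its vertex set, and the faces of a cube \<open>Q\<close> are exactly the cubes contained
  in \<open>Q\<close>.
\<close>

definition cube_complex :: "'a set set \<Rightarrow> bool" where
  "cube_complex X \<longleftrightarrow>
     (\<forall>Q\<in>X. \<exists>n \<phi>. cube_chart X n \<phi> Q) \<and>
     (\<forall>Q\<in>X. \<forall>R\<in>X. Q \<inter> R \<noteq> {} \<longrightarrow> Q \<inter> R \<in> X)"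

definition edges :: "'a set set \<Rightarrow> 'a set set" where
  "edges X = {e \<in> X. card e = 2}"

definition squares :: "'a set set \<Rightarrow> 'a set set" where
  "squares X = {Q \<in> X. card Q = 4}"

text \<open>An isomorphism of cube complexes is recorded by its effect on vertices.\<close>

definition cubical_iso :: "'a set set \<Rightarrow> 'b set set \<Rightarrow> ('a \<Rightarrow> 'b) \<Rightarrow> bool" where
  "cubical_iso X Y F \<longleftrightarrow> bij_betw F (verts X) (verts Y) \<and> (\<lambda>Q. F ` Q) ` X = Y"

definition isomorphic_complexes :: "'a set set \<Rightarrow> 'b set set \<Rightarrow> bool" where
  "isomorphic_complexes X Y \<longleftrightarrow> (\<exists>F. cubical_iso X Y F)"

definition real_line_complex :: "int set set" where
  "real_line_complex = range (\<lambda>n. {n}) \<union> range (\<lambda>n. {n, n + 1})"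


section \<open>Geometric realization and simple connectivity\<close>

text \<open>
  A point of a cube is represented by its multilinear coordinates: the point \<open>t \<in> [0,1]^n\<close> is
  sent to the function on vertices whose value at the vertex \<open>S\<close> is
  \<open>(\<Prod>i\<in>S. t i) * (\<Prod>i\<in>{..<n} - S. 1 - t i)\<close>. This does not depend on the chart and is
  compatible with passing to faces, so the realizations of the cubes are glued along their
  common faces. The realization carries the weak topology determined by its closed cubes.
\<close>

definition cube_point :: "nat \<Rightarrow> (nat set \<Rightarrow> 'a) \<Rightarrow> (nat \<Rightarrow> real) \<Rightarrow> 'a \<Rightarrow> real" where
  "cube_point n \<phi> t v =
     (if v \<in> \<phi> ` Pow {..<n}
      then \<Prod>i<n. if i \<in> inv_into (Pow {..<n}) \<phi> v then t i else 1 - t i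
      else 0)"

definition closed_cell :: "'a set set \<Rightarrow> 'a set \<Rightarrow> ('a \<Rightarrow> real) set" where
  "closed_cell X Q =
     {cube_point n \<phi> t | n \<phi> t. cube_chart X n \<phi> Q \<and> (\<forall>i<n. t i \<in> {0..1})}"

definition realization :: "'a set set \<Rightarrow> ('a \<Rightarrow> real) topology" where
  "realization X = topology (\<lambda>U. U \<subseteq> (\<Union>Q\<in>X. closed_cell X Q) \<and>
     (\<forall>Q\<in>X. openin (top_of_set (closed_cell X Q)) (U \<inter> closed_cell X Q)))"

lemma openin_realization:
  "openin (realization X) U \<longleftrightarrow> U \<subseteq> (\<Union>Q\<in>X. closed_cell X Q) \<and>
     (\<forall>Q\<in>X. openin (top_of_set (closed_cell X Q)) (U \<inter> closed_cell X Q))"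
proof -
  define P where "P = (\<lambda>U. U \<subseteq> (\<Union>Q\<in>X. closed_cell X Q) \<and>
     (\<forall>Q\<in>X. openin (top_of_set (closed_cell X Q)) (U \<inter> closed_cell X Q)))"
  have Int: "P (S \<inter> T)" if S: "P S" and T: "P T" for S T
    unfolding P_def
  proof (intro conjI ballI)
    show "S \<inter> T \<subseteq> (\<Union>Q\<in>X. closed_cell X Q)"
      using S unfolding P_def by (meson le_infI1)
  next
    fix Q assume "Q \<in> X"
    then have "openin (top_of_set (closed_cell X Q))
        ((S \<inter> closed_cell X Q) \<inter> (T \<inter> closed_cell X Q))"
      using S T unfolding P_def by (meson openin_Int)
    moreover have "(S \<inter> closed_cell X Q) \<inter> (T \<inter> closed_cell X Q) = S \<inter> T \<inter> closed_cell X Q"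
      by blast
    ultimately show "openin (top_of_set (closed_cell X Q)) (S \<inter> T \<inter> closed_cell X Q)"
      by (rule back_subst)
  qed
  have Un: "P (\<Union>K)" if K: "\<forall>S\<in>K. P S" for K
    unfolding P_def
  proof (intro conjI ballI)
    show "\<Union>K \<subseteq> (\<Union>Q\<in>X. closed_cell X Q)"
      using K unfolding P_def by (meson Sup_least)
  next
    fix Q assume "Q \<in> X"
    then have "openin (top_of_set (closed_cell X Q)) (S \<inter> closed_cell X Q)" if "S \<in> K" for S
      using K that unfolding P_def by meson
    then have "openin (top_of_set (closed_cell X Q)) (\<Union>S\<in>K. S \<inter> closed_cell X Q)"
      by (metis (no_types, lifting) imageE openin_Union)
    moreover have "(\<Union>S\<in>K. S \<inter> closed_cell X Q) = \<Union>K \<inter> closed_cell X Q"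
      by blast
    ultimately show "openin (top_of_set (closed_cell X Q)) (\<Union>K \<inter> closed_cell X Q)"
      by (rule back_subst)
  qed
  have "istopology P"
    unfolding istopology_def using Int Un by (intro conjI allI impI)
  moreover have "realization X = topology P"
    by (simp only: realization_def P_def)
  ultimately have "openin (realization X) U \<longleftrightarrow> P U"
    by (simp only: topology_inverse')
  then show ?thesis
    by (simp only: P_def)
qed

lemma topspace_realization: "topspace (realization X) = (\<Union>Q\<in>X. closed_cell X Q)"
proof
  show "topspace (realization X) \<subseteq> (\<Union>Q\<in>X. closed_cell X Q)"
    using openin_topspace [of "realization X"] by (simp only: openin_realization)
  have "openin (realization X) (\<Union>Q\<in>X. closed_cell X Q)"
    unfolding openin_realization
  proof (intro conjI ballI subset_refl)
    fix Q assume "Q \<in> X"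
    then have "(\<Union>Q\<in>X. closed_cell X Q) \<inter> closed_cell X Q = closed_cell X Q" by blast
    then show "openin (top_of_set (closed_cell X Q)) ((\<Union>Q\<in>X. closed_cell X Q) \<inter> closed_cell X Q)"
      by simp
  qed
  then show "(\<Union>Q\<in>X. closed_cell X Q) \<subseteq> topspace (realization X)"
    by (rule openin_subset)
qed

definition simply_connected_space :: "'a topology \<Rightarrow> bool" where
  "simply_connected_space T \<longleftrightarrow>
     path_connected_space T \<and>
     (\<forall>p. pathin T p \<and> p 1 = p 0 \<longrightarrow>
        (\<exists>c. homotopic_with (\<lambda>r. r 1 = r 0) (top_of_set {0..1}) T p (\<lambda>_. c)))"


section \<open>CAT(0) cube complexes\<close>

text \<open>
  The vertices of the link of \<open>v\<close> are the edges at \<open>v\<close>, recorded by their other endpoints;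
  every cube of positive dimension containing \<open>v\<close> contributes one simplex.
\<close>

definition link :: "'a set set \<Rightarrow> 'a \<Rightarrow> 'a set set" where
  "link X v = {{w \<in> Q. {v, w} \<in> edges X} | Q. Q \<in> X \<and> v \<in> Q \<and> Q \<noteq> {v}}"

definition abstract_simplicial_complex :: "'a set set \<Rightarrow> bool" where
  "abstract_simplicial_complex K \<longleftrightarrow>
     (\<forall>S\<in>K. finite S \<and> S \<noteq> {} \<and> (\<forall>T. T \<subseteq> S \<and> T \<noteq> {} \<longrightarrow> T \<in> K))"

definition flag_complex :: "'a set set \<Rightarrow> bool" where
  "flag_complex K \<longleftrightarrow>
     abstract_simplicial_complex K \<and>
     (\<forall>S. finite S \<and> S \<noteq> {} \<and> S \<subseteq> \<Union>K \<and> (\<forall>a\<in>S. \<forall>b\<in>S. a \<noteq> b \<longrightarrow> {a, b} \<in> K) \<longrightarrow> S \<in> K)"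

definition cat0_cube_complex :: "'a set set \<Rightarrow> bool" where
  "cat0_cube_complex X \<longleftrightarrow>
     cube_complex X \<and> verts X \<noteq> {} \<and>
     simply_connected_space (realization X) \<and>
     (\<forall>v\<in>verts X. flag_complex (link X v))"

definition extremal_vertex :: "'a set set \<Rightarrow> 'a \<Rightarrow> bool" where
  "extremal_vertex X v \<longleftrightarrow>
     v \<in> verts X \<and>
     (\<exists>e\<in>edges X. v \<in> e \<and>
        (\<forall>e'\<in>edges X. v \<in> e' \<and> e' \<noteq> e \<longrightarrow> (\<exists>Q\<in>squares X. e \<union> e' \<subseteq> Q)))"


section \<open>Hyperplanes and halfspaces\<close>

text \<open>
  A hyperplane is encoded as the set of edges it crosses: a class of the equivalence relation
  generated by being opposite edges of a square.
\<close>

definition opposite_edges :: "'a set set \<Rightarrow> ('a set \<times> 'a set) set" where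
  "opposite_edges X =
     {(e, e'). e \<in> edges X \<and> e' \<in> edges X \<and> e \<inter> e' = {} \<and> e \<union> e' \<in> squares X}"

definition hyperplanes :: "'a set set \<Rightarrow> 'a set set set" where
  "hyperplanes X = edges X // (opposite_edges X)\<^sup>*"

text \<open>
  The two sides of a hyperplane are the vertex sets of the connected components of what
  remains of the 1-skeleton after removing the edges crossed by the hyperplane.
\<close>

definition sides :: "'a set set \<Rightarrow> 'a set set \<Rightarrow> 'a set set" where
  "sides X W = {{u. (v, u) \<in> {(a, b). {a, b} \<in> edges X - W}\<^sup>*} | v. v \<in> verts X}"

definition halfspaces :: "'a set set \<Rightarrow> 'a set set" where
  "halfspaces X = (\<Union>W\<in>hyperplanes X. sides X W)"


section \<open>Roller compactification\<close>

definition ultrafilter :: "'a set set \<Rightarrow> 'a set set \<Rightarrow> bool" where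
  "ultrafilter X \<sigma> \<longleftrightarrow>
     \<sigma> \<subseteq> halfspaces X \<and>
     (\<forall>h\<in>\<sigma>. \<forall>k\<in>\<sigma>. h \<inter> k \<noteq> {}) \<and>
     (\<forall>W\<in>hyperplanes X. \<exists>h\<in>sides X W. h \<in> \<sigma>)"

definition roller_compactification :: "'a set set \<Rightarrow> 'a set set set" where
  "roller_compactification X = {\<sigma>. ultrafilter X \<sigma>}"

definition vertex_ultrafilter :: "'a set set \<Rightarrow> 'a \<Rightarrow> 'a set set" where
  "vertex_ultrafilter X v = {h \<in> halfspaces X. v \<in> h}"

definition roller_boundary :: "'a set set \<Rightarrow> 'a set set set" where
  "roller_boundary X = roller_compactification X - vertex_ultrafilter X ` verts X"

definition induced_map :: "('a \<Rightarrow> 'b) \<Rightarrow> 'a set set \<Rightarrow> 'b set set" where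
  "induced_map F \<sigma> = (\<lambda>h. F ` h) ` \<sigma>"


section \<open>Cross ratio\<close>

text \<open>
  The hyperplanes in \<open>\<W>(A|B)\<close>: a point \<open>x\<close> lies in the halfspace \<open>h\<close> iff \<open>h \<in> x\<close>.
\<close>

definition separating :: "'a set set \<Rightarrow> 'a set set set \<Rightarrow> 'a set set set \<Rightarrow> 'a set set set" where
  "separating X A B =
     {W \<in> hyperplanes X. \<exists>h\<in>sides X W. (\<forall>x\<in>B. h \<in> x) \<and> (\<forall>x\<in>A. verts X - h \<in> x)}"

definition ecard :: "'a set \<Rightarrow> enat" where
  "ecard S = (if finite S then enat (card S) else \<infinity>)"

definition gromov_product :: "'a set set \<Rightarrow> 'a \<Rightarrow> 'a set set \<Rightarrow> 'a set set \<Rightarrow> enat" where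
  "gromov_product X v x y = ecard (separating X {vertex_ultrafilter X v} {x, y})"

definition admissible_at ::
  "'a set set \<Rightarrow> 'a \<Rightarrow> ('a set set \<times> 'a set set \<times> 'a set set \<times> 'a set set) set" where
  "admissible_at X v = {(x, y, z, w).
     {x, y, z, w} \<subseteq> roller_compactification X \<and>
     (let a = gromov_product X v x y + gromov_product X v z w;
          b = gromov_product X v x z + gromov_product X v y w;
          c = gromov_product X v x w + gromov_product X v y z
      in \<not> (a = \<infinity> \<and> b = \<infinity>) \<and> \<not> (a = \<infinity> \<and> c = \<infinity>) \<and> \<not> (b = \<infinity> \<and> c = \<infinity>))}"

definition cross_ratio_at ::
  "'a set set \<Rightarrow> 'a \<Rightarrow> 'a set set \<Rightarrow> 'a set set \<Rightarrow> 'a set set \<Rightarrow> 'a set set \<Rightarrow> ereal" where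
  "cross_ratio_at X v x y z w =
     ereal_of_enat (gromov_product X v x z) + ereal_of_enat (gromov_product X v y w)
     - ereal_of_enat (gromov_product X v x w) - ereal_of_enat (gromov_product X v y z)"

text \<open>
  For a CAT(0) cube complex, neither the admissible quadruples nor the cross ratio depend on
  the vertex at which they are computed, so an arbitrary vertex is chosen.
\<close>

definition base_vertex :: "'a set set \<Rightarrow> 'a" where
  "base_vertex X = (SOME v. v \<in> verts X)"

definition admissible ::
  "'a set set \<Rightarrow> ('a set set \<times> 'a set set \<times> 'a set set \<times> 'a set set) set" where
  "admissible X = admissible_at X (base_vertex X)"

definition cross_ratio ::
  "'a set set \<Rightarrow> 'a set set \<Rightarrow> 'a set set \<Rightarrow> 'a set set \<Rightarrow> 'a set set \<Rightarrow> ereal" where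
  "cross_ratio X = cross_ratio_at X (base_vertex X)"

definition moebius_map :: "'a set set \<Rightarrow> 'b set set \<Rightarrow> ('a set set \<Rightarrow> 'b set set) \<Rightarrow> bool" where
  "moebius_map X Y f \<longleftrightarrow>
     f \<in> roller_boundary X \<rightarrow> roller_boundary Y \<and>
     (\<forall>x\<in>roller_boundary X. \<forall>y\<in>roller_boundary X.
      \<forall>z\<in>roller_boundary X. \<forall>w\<in>roller_boundary X.
        (x, y, z, w) \<in> admissible X \<longrightarrow>
        (f x, f y, f z, f w) \<in> admissible Y \<and>
        cross_ratio Y (f x) (f y) (f z) (f w) = cross_ratio X x y z w)"

end

theory Submission
  imports Defs
begin

text \<open>
  Foundations. By flagness, two edge paths related by swaps across squares that end in different
  edges at \<open>u\<close> can be swapped so that these edges lie in one square at \<open>u\<close>. Simple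
  connectivity, used through a fine grid on a homotopy whose cells lie in open stars of vertices,
  makes reduced paths with given ends unique up to swaps. Hence the neighbours of \<open>u\<close> that are
  closer to a base vertex pairwise span squares, so each hyperplane has the two sides
  \<open>{x. d x a < d x b}\<close> and \<open>{x. d x b < d x a}\<close>, where \<open>{a, b}\<close> is any edge that it
  crosses, and two edges at a vertex span a square as soon as the halfspaces behind them meet.

  The theorem. Without extremal vertices every edge lies on a line no two consecutive edges of
  which span a square; the hyperplanes separating its ends \<open>x, y\<close> form a chain, and therefore
  \<open>(x\<cdot>y) + (u\<cdot>w) \<ge> min ((x\<cdot>u) + (y\<cdot>w)) ((x\<cdot>w) + (y\<cdot>u))\<close> for all \<open>u, w\<close>. If instead
  the interval between \<open>x\<close> and \<open>y\<close> branches at some vertex, rays leaving a square at opposite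
  corners violate this inequality. So a Moebius bijection matches the lines of the two complexes,
  together with the positions of all boundary points along them. As only admissibility of the
  source is assumed to be transferred, one has to show that \<open>f\<close> also reflects the finiteness of
  enough Gromov products; where this fails, \<open>X\<close> splits off a line and the rays in its direction
  give a contradiction. Matching the halfspaces along lines is independent of the line, because
  the halfspaces with a given set of boundary points are consecutive on every line through one
  of them and do not exhaust it. The result preserves disjointness of halfspaces, and thus comes
  from a unique isomorphism.
\<close>

section \<open>Cube complexes in coordinates\<close>

text \<open>Two obstacles shape the argument. First, simple connectivity concerns homotopies in the
  realization, while all the rest concerns vertices and edges. The two are linked by a local system
  whose fibre over \<open>v\<close> consists of the swap classes of reduced paths to
  \<open>v\<close>; triviality of its monodromy yields uniqueness of these classes. Second, a
  boundary bijection sees a halfspace only through the boundary points in it, and distinct nested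
  halfspaces may contain the same ones. Lines supply the missing integer: differences of positions
  along a line are cross ratios, and a mismatch between two lines would translate a set of indices
  that is bounded on one side. Finite Gromov products stay finite because a quadruple may repeat its
  points. That an infinite one stays infinite needs two auxiliary points having finite products with
  both given points and with each other; in an exceptional pair no two ends of rays can
  serve.\<close>

definition flip :: "nat \<Rightarrow> nat set \<Rightarrow> nat set" where
  "flip i A = (if i \<in> A then A - {i} else insert i A)"

lemma flip_iff: "k \<in> flip i A \<longleftrightarrow> (if k = i then k \<notin> A else k \<in> A)"
  by (auto simp: flip_def)

lemma flip_flip [simp]: "flip i (flip i A) = A"
  by (rule set_eqI) (simp add: flip_iff)

lemma flip_neq [simp]: "flip i A \<noteq> A" "A \<noteq> flip i A"
  using flip_iff[of i i A] by auto

lemma flip_eq_iff [simp]: "flip i A = flip j A \<longleftrightarrow> i = j"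
  using flip_iff[of i i A] flip_iff[of i j A] by (cases "i = j") auto

lemma flip_commute: "flip i (flip j A) = flip j (flip i A)"
  by (rule set_eqI) (simp add: flip_iff)

lemma flip_subset: "A \<subseteq> {..<n} \<Longrightarrow> i < n \<Longrightarrow> flip i A \<subseteq> {..<n}"
  by (auto simp: flip_def)

lemma flip_flip_neq: "i \<noteq> j \<Longrightarrow> flip j (flip i A) \<noteq> A"
  using flip_iff[of i j "flip i A"] flip_iff[of i i A] by auto

lemma two_power_inject: "(2::nat) ^ m = 2 ^ n \<Longrightarrow> m = n"
  by (rule power_inject_exp[THEN iffD1]) auto

lemma interval_card_power:
  fixes A B :: "nat set"
  assumes "A \<subseteq> B" "finite B"
  shows "card {S. A \<subseteq> S \<and> S \<subseteq> B} = 2 ^ card (B - A)"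
proof -
  have "bij_betw (\<lambda>S. A \<union> S) (Pow (B - A)) {S. A \<subseteq> S \<and> S \<subseteq> B}"
    by (rule bij_betw_byWitness[where f' = "\<lambda>S. S - A"]) (use assms in auto)
  then show ?thesis
    using assms by (metis bij_betw_same_card card_Pow finite_Diff)
qed

lemma interval_two: "{S. A - {i} \<subseteq> S \<and> S \<subseteq> insert i A} = {A, flip i A}"
proof -
  have "S = A \<or> S = flip i A" if "A - {i} \<subseteq> S" "S \<subseteq> insert i A" for S
  proof (cases "i \<in> S \<longleftrightarrow> i \<in> A")
    case True then have "S = A" using that by blast
    then show ?thesis ..
  next
    case False
    then have "S = flip i A" using that by (intro set_eqI) (auto simp: flip_iff)
    then show ?thesis ..
  qed
  then show ?thesis by (auto simp: flip_iff split: if_splits)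
qed

lemma interval_four:
  "{S. A - {i, j} \<subseteq> S \<and> S \<subseteq> A \<union> {i, j}} = {A, flip i A, flip j (flip i A), flip j A}" if "i \<noteq> j"
proof -
  have "S = A \<or> S = flip i A \<or> S = flip j (flip i A) \<or> S = flip j A"
    if S: "A - {i, j} \<subseteq> S" "S \<subseteq> A \<union> {i, j}" for S
  proof -
    have *: "k \<in> S \<longleftrightarrow> k \<in> A" if "k \<noteq> i" "k \<noteq> j" for k using S that by blast
    show ?thesis
    proof (cases "i \<in> S \<longleftrightarrow> i \<in> A"; cases "j \<in> S \<longleftrightarrow> j \<in> A")
      assume "i \<in> S \<longleftrightarrow> i \<in> A" "j \<in> S \<longleftrightarrow> j \<in> A"
      then have "S = A" using * by (intro set_eqI) metis
      then show ?thesis by simp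
    next
      assume "i \<in> S \<longleftrightarrow> i \<in> A" "\<not> (j \<in> S \<longleftrightarrow> j \<in> A)"
      then have "S = flip j A" using * by (intro set_eqI) (metis flip_iff)
      then show ?thesis by simp
    next
      assume "\<not> (i \<in> S \<longleftrightarrow> i \<in> A)" "j \<in> S \<longleftrightarrow> j \<in> A"
      then have "S = flip i A" using * by (intro set_eqI) (metis flip_iff)
      then show ?thesis by simp
    next
      assume "\<not> (i \<in> S \<longleftrightarrow> i \<in> A)" "\<not> (j \<in> S \<longleftrightarrow> j \<in> A)"
      then have "S = flip j (flip i A)" using * \<open>i \<noteq> j\<close> by (intro set_eqI) (metis flip_iff)
      then show ?thesis by simp
    qed
  qed
  moreover have "A - {i, j} \<subseteq> S \<and> S \<subseteq> A \<union> {i, j}"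
    if "S \<in> {A, flip i A, flip j (flip i A), flip j A}" for S
    using that by (elim insertE emptyE) (auto simp: flip_iff subset_iff)
  ultimately show ?thesis
    by (intro equalityI subsetI CollectI) (simp_all only: mem_Collect_eq insert_iff empty_iff simp_thms)
qed

locale cubes =
  fixes X :: "'a set set"
  assumes complex: "cube_complex X"
begin

definition V :: "'a set" where "V = verts X"

definition adj :: "'a \<Rightarrow> 'a \<Rightarrow> bool" where
  "adj u w \<longleftrightarrow> {u, w} \<in> edges X"

text \<open>The corners are listed in cyclic order, so \<open>u\<close>, \<open>c\<close> and
  \<open>a\<close>, \<open>b\<close> are the diagonals; a member of \<open>squares X\<close> is only
  a vertex set and does not record this order.\<close>

definition sq :: "'a \<Rightarrow> 'a \<Rightarrow> 'a \<Rightarrow> 'a \<Rightarrow> bool" where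
  "sq u a c b \<longleftrightarrow> {u, a, c, b} \<in> squares X \<and> adj u a \<and> adj a c \<and> adj c b \<and> adj b u \<and> a \<noteq> b \<and> u \<noteq> c"

lemma adj_sym: "adj u w \<Longrightarrow> adj w u"
  by (simp add: adj_def insert_commute)

lemma adj_neq: "adj u w \<Longrightarrow> u \<noteq> w"
  by (auto simp: adj_def edges_def)

lemma adj_V: "adj u w \<Longrightarrow> u \<in> V" "adj u w \<Longrightarrow> w \<in> V"
  by (auto simp: adj_def edges_def V_def verts_def)

lemma sq_rot: "sq u a c b \<Longrightarrow> sq a c b u"
  by (auto simp: sq_def insert_commute)

lemma sq_flip: "sq u a c b \<Longrightarrow> sq u b c a"
  by (auto simp: sq_def insert_commute adj_sym)

lemma sq_adj: assumes "sq u a c b" shows "adj u a" "adj a c" "adj c b" "adj b u" "adj a u" "adj c a" "adj b c" "adj u b"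
  using assms by (auto simp: sq_def adj_sym)

lemma sq_neq: assumes "sq u a c b" shows "a \<noteq> b" "u \<noteq> c" "u \<noteq> a" "u \<noteq> b" "a \<noteq> c" "b \<noteq> c"
  using assms by (auto simp: sq_def dest: adj_neq)

lemma edge_cases:
  assumes "e \<in> edges X" obtains a b where "e = {a, b}" "adj a b"
  using assms unfolding edges_def adj_def by (auto simp: card_2_iff)

lemma cube_cases:
  assumes "Q \<in> X" obtains n \<phi> where "cube_chart X n \<phi> Q"
  using assms complex unfolding cube_complex_def by blast

lemma cube_Int: "Q \<in> X \<Longrightarrow> R \<in> X \<Longrightarrow> Q \<inter> R \<noteq> {} \<Longrightarrow> Q \<inter> R \<in> X"
  using complex unfolding cube_complex_def by blast

lemma chart_inj: "cube_chart X n \<phi> Q \<Longrightarrow> inj_on \<phi> (Pow {..<n})"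
  and chart_image: "cube_chart X n \<phi> Q \<Longrightarrow> \<phi> ` Pow {..<n} = Q"
  by (auto simp: cube_chart_def bij_betw_def)

lemma chart_eq:
  "cube_chart X n \<phi> Q \<Longrightarrow> A \<subseteq> {..<n} \<Longrightarrow> B \<subseteq> {..<n} \<Longrightarrow> \<phi> A = \<phi> B \<longleftrightarrow> A = B"
  using chart_inj by (metis PowI inj_on_eq_iff)

lemma chart_mem: "cube_chart X n \<phi> Q \<Longrightarrow> A \<subseteq> {..<n} \<Longrightarrow> \<phi> A \<in> Q"
  using chart_image by blast

lemma chart_ex:
  assumes "cube_chart X n \<phi> Q" "v \<in> Q" obtains A where "A \<subseteq> {..<n}" "v = \<phi> A"
  using assms chart_image by blast

lemma chart_card: "cube_chart X n \<phi> Q \<Longrightarrow> card Q = 2 ^ n \<and> finite Q"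
  using bij_betw_same_card[of \<phi> "Pow {..<n}" Q] bij_betw_finite[of \<phi> "Pow {..<n}" Q]
  by (simp add: cube_chart_def card_Pow)

lemma cube_finite: "Q \<in> X \<Longrightarrow> finite Q"
  by (meson chart_card cube_cases)

lemma cube_nonempty: "Q \<in> X \<Longrightarrow> Q \<noteq> {}"
  by (metis chart_mem cube_cases empty_iff empty_subsetI)

lemma cube_subset_V: "Q \<in> X \<Longrightarrow> Q \<subseteq> V"
  by (auto simp: V_def verts_def)

lemma chart_face:
  assumes "cube_chart X n \<phi> Q" "A \<subseteq> B" "B \<subseteq> {..<n}"
  shows "\<phi> ` {S. A \<subseteq> S \<and> S \<subseteq> B} \<in> X"
proof -
  have "\<phi> ` {S. A \<subseteq> S \<and> S \<subseteq> B} \<in> (\<lambda>T. \<phi> ` T) ` cube_faces n"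
    using assms by (auto simp: cube_faces_def)
  then show ?thesis using assms(1) by (auto simp: cube_chart_def)
qed

lemma face_chart:
  assumes "cube_chart X n \<phi> Q" "R \<in> X" "R \<subseteq> Q"
  obtains A B where "A \<subseteq> B" "B \<subseteq> {..<n}" "R = \<phi> ` {S. A \<subseteq> S \<and> S \<subseteq> B}" "card R = 2 ^ card (B - A)"
proof -
  have "R \<in> (\<lambda>T. \<phi> ` T) ` cube_faces n"
    using assms by (auto simp: cube_chart_def)
  then obtain A B where *: "A \<subseteq> B" "B \<subseteq> {..<n}" "R = \<phi> ` {S. A \<subseteq> S \<and> S \<subseteq> B}"
    by (auto simp: cube_faces_def)
  have "inj_on \<phi> {S. A \<subseteq> S \<and> S \<subseteq> B}"
    by (rule inj_on_subset[OF chart_inj[OF assms(1)]]) (use * in auto)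
  then have "card R = 2 ^ card (B - A)"
    using *(1) interval_card_power[OF *(1) finite_subset[OF *(2) finite_lessThan]] by (simp add: *(3) card_image)
  with * that show ?thesis by blast
qed

lemma adj_chart_flip:
  assumes "cube_chart X n \<phi> Q" "A \<subseteq> {..<n}" "i < n"
  shows "adj (\<phi> A) (\<phi> (flip i A))"
proof -
  have "\<phi> ` {S. A - {i} \<subseteq> S \<and> S \<subseteq> insert i A} \<in> X"
    using assms by (intro chart_face) auto
  moreover have "\<phi> A \<noteq> \<phi> (flip i A)"
    using chart_eq[OF assms(1,2) flip_subset[OF assms(2,3)]] by simp
  ultimately show ?thesis
    by (simp add: adj_def edges_def interval_two)
qed

text \<open>An edge contained in \<open>Q\<close> is a face of \<open>Q\<close>; counting vertices,
  its interval of coordinate sets has exactly one free coordinate.\<close>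

lemma chart_adj_flip:
  assumes "cube_chart X n \<phi> Q" "A \<subseteq> {..<n}" "B \<subseteq> {..<n}" "adj (\<phi> A) (\<phi> B)"
  obtains i where "i < n" "B = flip i A"
proof -
  have inX: "{\<phi> A, \<phi> B} \<in> X" and card2: "card {\<phi> A, \<phi> B} = 2"
    using assms(4) by (auto simp: adj_def edges_def)
  have sub: "{\<phi> A, \<phi> B} \<subseteq> Q" using assms chart_mem by auto
  obtain C D where CD: "C \<subseteq> D" "D \<subseteq> {..<n}" "{\<phi> A, \<phi> B} = \<phi> ` {S. C \<subseteq> S \<and> S \<subseteq> D}"
      "card {\<phi> A, \<phi> B} = 2 ^ card (D - C)"
    by (rule face_chart[OF assms(1) inX sub])
  then have "(2::nat) ^ card (D - C) = 2 ^ 1" using card2 by simp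
  then have "card (D - C) = 1" by (rule two_power_inject)
  then obtain i where i: "D - C = {i}" by (auto simp: card_1_singleton_iff)
  have mem: "E \<in> {S. C \<subseteq> S \<and> S \<subseteq> D}" if "\<phi> E \<in> {\<phi> A, \<phi> B}" "E \<subseteq> {..<n}" for E
  proof (rule inj_on_image_mem_iff[OF chart_inj[OF assms(1)], THEN iffD1])
    show "\<phi> E \<in> \<phi> ` {S. C \<subseteq> S \<and> S \<subseteq> D}" using that(1) by (simp only: CD(3)[symmetric])
  qed (use CD that in auto)
  have "A \<in> {S. C \<subseteq> S \<and> S \<subseteq> D}" "B \<in> {S. C \<subseteq> S \<and> S \<subseteq> D}"
    using mem assms(2,3) by simp_all
  moreover have "A \<noteq> B" using adj_neq[OF assms(4)] by auto
  ultimately have "B = flip i A" using i by (auto simp: flip_def)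
  moreover have "i < n" using i CD by auto
  ultimately show ?thesis using that by blast
qed

lemma sq_chart_flip:
  assumes "cube_chart X n \<phi> Q" "A \<subseteq> {..<n}" "i < n" "j < n" "i \<noteq> j"
  shows "sq (\<phi> A) (\<phi> (flip i A)) (\<phi> (flip j (flip i A))) (\<phi> (flip j A))"
proof -
  have "\<phi> ` {S. A - {i, j} \<subseteq> S \<and> S \<subseteq> A \<union> {i, j}} \<in> X"
    using assms by (intro chart_face) auto
  then have in_X: "{\<phi> A, \<phi> (flip i A), \<phi> (flip j (flip i A)), \<phi> (flip j A)} \<in> X"
    by (simp only: interval_four[OF assms(5)] image_insert image_empty)
  have sub: "flip i A \<subseteq> {..<n}" "flip j A \<subseteq> {..<n}" "flip j (flip i A) \<subseteq> {..<n}"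
    using assms by (simp_all add: flip_subset)
  have ne: "flip j (flip i A) \<noteq> A" "flip j (flip i A) \<noteq> flip i A" "flip j (flip i A) \<noteq> flip j A" "flip i A \<noteq> flip j A"
    using flip_flip_neq[OF assms(5)] flip_neq(1)[of j "flip i A"] flip_neq(1)[of i "flip j A"] assms(5)
    by (simp_all add: flip_commute[of j i])
  have d: "\<phi> A \<noteq> \<phi> (flip i A)" "\<phi> A \<noteq> \<phi> (flip j A)" "\<phi> A \<noteq> \<phi> (flip j (flip i A))"
    "\<phi> (flip i A) \<noteq> \<phi> (flip j A)" "\<phi> (flip i A) \<noteq> \<phi> (flip j (flip i A))"
    "\<phi> (flip j (flip i A)) \<noteq> \<phi> (flip j A)"
    using ne ne[symmetric] flip_neq(2)[of A] by (simp_all add: chart_eq[OF assms(1)] sub assms(2) del: flip_neq)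
  have "adj (\<phi> (flip i A)) (\<phi> (flip j (flip i A)))" "adj (\<phi> (flip j A)) (\<phi> (flip i (flip j A)))"
    using adj_chart_flip[OF assms(1)] assms sub by auto
  then show ?thesis
    using in_X d adj_chart_flip[OF assms(1,2,3)] adj_chart_flip[OF assms(1,2,4)]
    by (auto simp: sq_def squares_def adj_sym flip_commute[of j i])
qed

lemma vertex_cube:
  assumes "v \<in> V" shows "{v} \<in> X"
proof -
  obtain Q where "Q \<in> X" "v \<in> Q" using assms by (auto simp: V_def verts_def)
  then obtain n \<phi> A where "cube_chart X n \<phi> Q" "A \<subseteq> {..<n}" "v = \<phi> A"
    by (metis cube_cases chart_ex)
  moreover have "{S. A \<subseteq> S \<and> S \<subseteq> A} = {A}" by auto
  ultimately show ?thesis using chart_face[of n \<phi> Q A A] by simp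
qed

text \<open>Two such squares meet in a cube with at least three vertices; as the size of a cube is a
  power of two, the intersection is all of both.\<close>

lemma sq_unique:
  assumes "sq u a c b" "sq u a c' b" shows "c = c'"
proof -
  let ?Q = "{u, a, c, b}" and ?R = "{u, a, c', b}"
  have Q: "?Q \<in> X" "card ?Q = 4" and R: "?R \<in> X" "card ?R = 4"
    using assms by (auto simp: sq_def squares_def)
  have I: "?Q \<inter> ?R \<in> X" using Q R by (intro cube_Int) auto
  have sub: "{u, a, b} \<subseteq> ?Q \<inter> ?R" by auto
  have "card {u, a, b} = 3" using sq_neq[OF assms(1)] by auto
  then have c3: "card (?Q \<inter> ?R) \<ge> 3" using card_mono[OF _ sub] by simp
  obtain n \<phi> where "cube_chart X n \<phi> (?Q \<inter> ?R)" using I by (rule cube_cases)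
  then have "card (?Q \<inter> ?R) = 2 ^ n" using chart_card by blast
  moreover have "card (?Q \<inter> ?R) \<le> card ?Q" by (rule card_mono) auto
  then have "card (?Q \<inter> ?R) \<le> 4" using Q(2) by (simp only:)
  moreover have "n = 0 \<or> n = 1 \<or> (2::nat)^n \<ge> 4"
  proof (cases n)
    case (Suc m) then show ?thesis by (cases m) auto
  qed simp
  ultimately have "card (?Q \<inter> ?R) = 4" using \<open>card (?Q \<inter> ?R) \<le> 4\<close> c3 by auto
  then have "?Q \<inter> ?R = ?Q" "?Q \<inter> ?R = ?R"
    using Q(2) R(2) by (intro card_subset_eq; simp only: finite.intros Int_lower1 Int_lower2)+
  then have "?Q = ?R" by (simp only:)
  then have "c \<in> ?R" by blast
  then show ?thesis using sq_neq[OF assms(1)] by blast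
qed

text \<open>The simplex of a square at \<open>u\<close> consists of all neighbours of
  \<open>u\<close> in it, so the diagonal \<open>{u, c}\<close> must not be an edge: in a chart
  \<open>u\<close> has only two neighbours, and these are \<open>a\<close> and
  \<open>b\<close>.\<close>

lemma sq_edge_link:
  assumes "sq u a c b" shows "{a, b} \<in> link X u"
proof -
  let ?Q = "{u, a, c, b}"
  have Q: "?Q \<in> X" "card ?Q = 4" using assms by (auto simp: sq_def squares_def)
  have "\<not> adj u c"
  proof
    assume "adj u c"
    obtain n \<phi> where ch: "cube_chart X n \<phi> ?Q" using Q(1) by (rule cube_cases)
    have "(2::nat) ^ n = 2 ^ 2" using chart_card[OF ch] Q(2) by simp
    then have n: "n = 2" by (rule two_power_inject)
    obtain A where A: "A \<subseteq> {..<n}" "u = \<phi> A" using chart_ex[OF ch] by blast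
    have *: "\<exists>i<n. x = \<phi> (flip i A)" if "x \<in> ?Q" "adj u x" for x
      using that chart_ex[OF ch that(1)] chart_adj_flip[OF ch A(1)] A(2) by metis
    obtain i j k where "i < 2" "j < 2" "k < 2" "a = \<phi> (flip i A)" "b = \<phi> (flip j A)" "c = \<phi> (flip k A)"
      using *[of a] *[of b] *[of c] sq_adj[OF assms] \<open>adj u c\<close> n by auto
    then show False using sq_neq[OF assms] by (metis less_2_cases)
  qed
  then have "{w \<in> ?Q. {u, w} \<in> edges X} = {a, b}"
    using sq_adj[OF assms] adj_neq by (auto simp: adj_def)
  moreover have "?Q \<noteq> {u}" using sq_neq[OF assms] by auto
  ultimately show ?thesis using Q unfolding link_def by blast
qed

lemma adj_link: "adj u a \<Longrightarrow> a \<in> \<Union>(link X u)"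
proof -
  assume "adj u a"
  then have "{u, a} \<in> X" "a \<in> {w \<in> {u, a}. {u, w} \<in> edges X}" "{u, a} \<noteq> {u}"
    using adj_neq by (auto simp: adj_def edges_def)
  then show ?thesis unfolding link_def by blast
qed

lemma opposite_edgesE:
  assumes "(e, e') \<in> opposite_edges X"
  obtains a b b' a' where "e = {a, b}" "e' = {a', b'}" "sq a b b' a'"
proof -
  have e: "e \<in> edges X" "e' \<in> edges X" "e \<inter> e' = {}" "e \<union> e' \<in> X" "card (e \<union> e') = 4"
    using assms by (auto simp: opposite_edges_def squares_def)
  obtain a b where ab: "e = {a, b}" "adj a b" using e(1) by (rule edge_cases)
  obtain p q where pq: "e' = {p, q}" "adj p q" using e(2) by (rule edge_cases)
  obtain n \<phi> where ch: "cube_chart X n \<phi> (e \<union> e')" using e(4) by (rule cube_cases)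
  have "(2::nat) ^ n = 2 ^ 2" using chart_card[OF ch] e(5) by simp
  then have n: "n = 2" by (rule two_power_inject)
  obtain A B where A: "A \<subseteq> {..<n}" "a = \<phi> A" "B \<subseteq> {..<n}" "b = \<phi> B"
    using chart_ex[OF ch] ab by (metis UnI1 insertI1 insertI2)
  then obtain i where i: "i < n" "B = flip i A"
    using chart_adj_flip[OF ch] ab(2) by metis
  \<comment> \<open>The square has the coordinates 0 and 1, so this is the direction transverse to
    the edge.\<close>
  define j where "j = 1 - i"
  have j: "j < n" "j \<noteq> i" using n i(1) unfolding j_def by arith+
  let ?a' = "\<phi> (flip j A)" and ?b' = "\<phi> (flip j (flip i A))"
  have s: "sq a b ?b' ?a'" using sq_chart_flip[OF ch A(1) i(1) j(1)] j A i by auto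
  have "?a' \<in> e \<union> e'" "?b' \<in> e \<union> e'"
    using A(1) i j by (intro chart_mem[OF ch] flip_subset; simp)+
  then have "{?a', ?b'} \<subseteq> e'" using sq_neq[OF s] ab(1) by auto
  then have "{?a', ?b'} = e'" using pq sq_neq[OF s] by auto
  with s ab that show ?thesis by blast
qed

lemma sq_opposite:
  assumes "sq a b b' a'" shows "({a, b}, {a', b'}) \<in> opposite_edges X"
proof -
  have "{a, b} \<union> {a', b'} = {a, b, b', a'}" by blast
  moreover have "{a, b} \<inter> {a', b'} = {}" using sq_neq[OF assms] by blast
  moreover have "{a, b} \<in> edges X" "{a', b'} \<in> edges X"
    using sq_adj[OF assms] by (simp_all add: adj_def insert_commute)
  moreover have "{a, b, b', a'} \<in> squares X" using assms by (simp add: sq_def)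
  ultimately show ?thesis unfolding opposite_edges_def by (simp only: mem_Collect_eq prod.case simp_thms)
qed

end

section \<open>Edge paths up to swaps\<close>

locale cat0 =
  fixes X :: "'a set set"
  assumes cat0: "cat0_cube_complex X"
begin

sublocale cubes X
  using cat0 by unfold_locales (simp add: cat0_cube_complex_def)

lemma flag: "v \<in> V \<Longrightarrow> flag_complex (link X v)"
  using cat0 by (simp add: cat0_cube_complex_def V_def)

lemma link_spanned:
  assumes "v \<in> V" "finite N" "N \<noteq> {}" "\<And>a. a \<in> N \<Longrightarrow> adj v a"
    and "\<And>a b. a \<in> N \<Longrightarrow> b \<in> N \<Longrightarrow> a \<noteq> b \<Longrightarrow> \<exists>c. sq v a c b"
  obtains Q where "Q \<in> X" "v \<in> Q" "{w \<in> Q. adj v w} = N"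
proof -
  have "N \<subseteq> \<Union>(link X v)" using assms(4) adj_link by blast
  moreover have "\<forall>a\<in>N. \<forall>b\<in>N. a \<noteq> b \<longrightarrow> {a, b} \<in> link X v"
    using assms(5) sq_edge_link by blast
  ultimately have "N \<in> link X v"
    using flag[OF assms(1)] assms(2,3) unfolding flag_complex_def by blast
  then obtain Q where "N = {w \<in> Q. {v, w} \<in> edges X}" "Q \<in> X" "v \<in> Q"
    unfolding link_def by blast
  with that show ?thesis by (simp add: adj_def)
qed

text \<open>Flagness at \<open>w\<close> provides a cube containing \<open>c1\<close>,
  \<open>c2\<close>, \<open>u\<close>; uniqueness of squares identifies \<open>g\<close>,
  \<open>p\<close>, \<open>q\<close> in its chart, and \<open>t\<close> is the corner opposite to
  \<open>w\<close>.\<close>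

lemma three_cube:
  assumes "sq w c1 g c2" "sq w c1 p u" "sq w c2 q u"
  obtains t where "sq u p t q" "sq c1 g t p" "sq c2 g t q"
proof -
  have ne: "c1 \<noteq> c2" "c1 \<noteq> u" "c2 \<noteq> u" using assms sq_neq by blast+
  obtain Q where Q: "Q \<in> X" "w \<in> Q" "{x \<in> Q. adj w x} = {c1, c2, u}"
  proof (rule link_spanned[of w "{c1, c2, u}"])
    show "w \<in> V" by (rule adj_V(1)[OF sq_adj(1)[OF assms(1)]])
    show "\<exists>c. sq w a c b" if "a \<in> {c1, c2, u}" "b \<in> {c1, c2, u}" "a \<noteq> b" for a b
      using that assms sq_flip by blast
    show "adj w a" if "a \<in> {c1, c2, u}" for a
      using that sq_adj[OF assms(1)] sq_adj[OF assms(2)] by blast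
  qed auto
  obtain n \<phi> where ch: "cube_chart X n \<phi> Q" using Q(1) by (rule cube_cases)
  obtain A where A: "A \<subseteq> {..<n}" "w = \<phi> A" using chart_ex[OF ch Q(2)] by blast
  have nb: "\<exists>i<n. x = \<phi> (flip i A)" if "x \<in> {c1, c2, u}" for x
  proof -
    have x: "x \<in> Q" "adj w x" using that Q(3) by blast+
    then obtain B where "B \<subseteq> {..<n}" "x = \<phi> B" using chart_ex[OF ch] by metis
    with x A show ?thesis using chart_adj_flip[OF ch A(1)] by metis
  qed
  obtain i j k where ijk: "i < n" "c1 = \<phi> (flip i A)" "j < n" "c2 = \<phi> (flip j A)"
      "k < n" "u = \<phi> (flip k A)"
    using nb[of c1] nb[of c2] nb[of u] by auto
  have d: "i \<noteq> j" "i \<noteq> k" "j \<noteq> k" using ne ijk by auto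
  have sub: "flip i A \<subseteq> {..<n}" "flip j A \<subseteq> {..<n}" "flip k A \<subseteq> {..<n}"
    using A ijk by (simp_all add: flip_subset)
  have g: "g = \<phi> (flip j (flip i A))"
    using sq_unique[OF assms(1)] sq_chart_flip[OF ch A(1) ijk(1,3) d(1)] ijk A by simp
  have p: "p = \<phi> (flip k (flip i A))"
    using sq_unique[OF assms(2)] sq_chart_flip[OF ch A(1) ijk(1,5) d(2)] ijk A by simp
  have q: "q = \<phi> (flip k (flip j A))"
    using sq_unique[OF assms(3)] sq_chart_flip[OF ch A(1) ijk(3,5) d(3)] ijk A by simp
  let ?t = "\<phi> (flip k (flip j (flip i A)))"
  have fc: "flip j (flip i (flip k A)) = flip k (flip j (flip i A))" "flip i (flip k A) = flip k (flip i A)"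
      "flip j (flip k A) = flip k (flip j A)" "flip i (flip j A) = flip j (flip i A)"
      "flip j (flip k (flip i A)) = flip k (flip j (flip i A))" "flip i (flip k (flip j A)) = flip k (flip j (flip i A))"
    by (rule set_eqI; simp add: flip_iff)+
  have "sq u p ?t q"
    using sq_chart_flip[OF ch sub(3) ijk(1,3) d(1)] unfolding fc ijk(6) p q .
  moreover have "sq c1 g ?t p"
    using sq_chart_flip[OF ch sub(1) ijk(3,5) d(3)] unfolding ijk(2) p g .
  moreover have "sq c2 g ?t q"
    using sq_chart_flip[OF ch sub(2) ijk(1,5) d(2)] unfolding fc ijk(4) q g .
  ultimately show ?thesis using that by blast
qed

text \<open>Edge paths are lists of vertices with the terminal vertex at the head.\<close>

inductive eqv :: "'a list \<Rightarrow> 'a list \<Rightarrow> bool" where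
  eqv_refl: "eqv p p"
| eqv_swap: "sq u a c b \<Longrightarrow> eqv (u # a # c # p) (u # b # c # p)"
| eqv_Cons: "eqv p q \<Longrightarrow> eqv (x # p) (x # q)"
| eqv_trans: "eqv p q \<Longrightarrow> eqv q r \<Longrightarrow> eqv p r"

lemma eqv_sym: "eqv p q \<Longrightarrow> eqv q p"
  by (induction rule: eqv.induct) (auto intro: eqv.intros sq_flip)

lemma eqv_length: "eqv p q \<Longrightarrow> length p = length q"
  by (induction rule: eqv.induct) auto

lemma eqv_hd: "eqv p q \<Longrightarrow> p \<noteq> [] \<Longrightarrow> q \<noteq> [] \<and> hd p = hd q"
  by (induction rule: eqv.induct) auto

lemma eqv_Cons_hd: "eqv (x # p) (y # q) \<Longrightarrow> x = y"
  using eqv_hd by fastforce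

lemma eqv_last: "eqv p q \<Longrightarrow> p \<noteq> [] \<Longrightarrow> last p = last q"
  by (induction rule: eqv.induct) (auto dest: eqv_length eqv_hd)

text \<open>The second alternative: the last edges of the two paths \<open>u # p\<close> and \<open>u # q\<close> lie in a square
  whose far corner \<open>c\<close> can be made the predecessor on both sides.\<close>

definition split_eqv :: "'a \<Rightarrow> 'a list \<Rightarrow> 'a list \<Rightarrow> bool" where
  "split_eqv u p q \<longleftrightarrow> eqv p q \<or>
     (\<exists>w w' c B. sq u w c w' \<and> eqv p (w # c # B) \<and> eqv q (w' # c # B))"

text \<open>The middle path \<open>q\<close> can be continued from \<open>w1\<close> through
  \<open>c1\<close> or through \<open>c2\<close>. If these differ, the claim for a shorter path, at
  \<open>w1\<close>, puts them into a square with far corner \<open>g\<close>. The three squares at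
  \<open>w1\<close> are then faces of a 3-cube whose opposite faces give the square at
  \<open>u\<close> and the swaps leading to it.\<close>

lemma split_eqv_trans:
  assumes IH: "\<And>u p q. length (u # p) < n \<Longrightarrow> eqv (u # p) (u # q) \<Longrightarrow> split_eqv u p q"
    and len: "length p < n" and pq: "split_eqv u p q" and qr: "split_eqv u q r"
  shows "split_eqv u p r"
proof -
  consider "eqv p q" | "eqv q r" | w0 w1 c1 B1 w1' w2 c2 B2 where
    "sq u w0 c1 w1" "eqv p (w0 # c1 # B1)" "eqv q (w1 # c1 # B1)"
    "sq u w1' c2 w2" "eqv q (w1' # c2 # B2)" "eqv r (w2 # c2 # B2)"
    using pq qr unfolding split_eqv_def by blast
  then show ?thesis
  proof cases
    case 1 then show ?thesis using qr unfolding split_eqv_def by (meson eqv_trans)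
  next
    case 2 then show ?thesis using pq unfolding split_eqv_def by (meson eqv_trans eqv_sym)
  next
    case 3
    have e: "eqv (w1 # c1 # B1) (w1' # c2 # B2)" using 3 by (meson eqv_trans eqv_sym)
    then have w: "w1' = w1" using eqv_hd by fastforce
    have l: "length (w1 # c1 # B1) < n" using 3 len eqv_length[of p] by simp
    have sp: "split_eqv w1 (c1 # B1) (c2 # B2)" using IH[OF l] e w by simp
    have s1: "sq w1 c1 w0 u" using sq_rot[OF sq_rot[OF sq_rot[OF sq_flip[OF 3(1)]]]] sq_flip sq_rot 3(1) by blast
    have s2: "sq w1 c2 w2 u" using 3(4) sq_flip sq_rot w by blast
    show ?thesis
    proof (cases "c1 = c2")
      case True
      have "w0 = w2" using sq_unique[OF s1] s2 sq_unique True by blast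
      moreover have "eqv (c1 # B1) (c2 # B2)"
        using sp unfolding split_eqv_def
      proof
        assume "\<exists>w w' c B. sq w1 w c w' \<and> eqv (c1 # B1) (w # c # B) \<and> eqv (c2 # B2) (w' # c # B)"
        then obtain w w' c B where *: "sq w1 w c w'" "eqv (c1 # B1) (w # c # B)" "eqv (c2 # B2) (w' # c # B)"
          by blast
        then have "w = w'" using True by (metis eqv_Cons_hd)
        then show ?thesis using sq_neq[OF *(1)] by blast
      qed
      ultimately have "eqv p r" using 3 by (meson eqv_Cons eqv_trans eqv_sym)
      then show ?thesis by (simp add: split_eqv_def)
    next
      case False
      then have "\<not> eqv (c1 # B1) (c2 # B2)" using eqv_hd by fastforce
      then obtain w w' g B where g0: "sq w1 w g w'" "eqv (c1 # B1) (w # g # B)" "eqv (c2 # B2) (w' # g # B)"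
        using sp unfolding split_eqv_def by blast
      then have ww: "w = c1" "w' = c2" using eqv_hd by fastforce+
      note g = g0[unfolded ww]
      obtain t where t: "sq u w0 t w2" "sq c1 g t w0" "sq c2 g t w2"
        using three_cube[OF g(1) s1 s2] by blast
      have "eqv p (w0 # t # g # B)"
      proof -
        have "eqv (w0 # c1 # g # B) (w0 # t # g # B)" using t(2) sq_rot by (blast intro: eqv_swap)
        then show ?thesis using 3(2) g(2) by (meson eqv_Cons eqv_trans)
      qed
      moreover have "eqv r (w2 # t # g # B)"
      proof -
        have "eqv (w2 # c2 # g # B) (w2 # t # g # B)" using t(3) sq_rot by (blast intro: eqv_swap)
        then show ?thesis using 3(6) g(3) by (meson eqv_Cons eqv_trans)
      qed
      ultimately show ?thesis using t(1) unfolding split_eqv_def by blast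
    qed
  qed
qed

text \<open>Induction on the length: composing two swap sequences uses the claim only for paths one
  vertex shorter.\<close>

lemma eqv_Cons_split: "eqv (u # p) (u # q) \<Longrightarrow> split_eqv u p q"
proof (induction "length (u # p)" arbitrary: u p q rule: less_induct)
  case (less u p q)
  have IH: "split_eqv u' p' q'" if "length (u' # p') < Suc (length p)" "eqv (u' # p') (u' # q')" for u' p' q'
    using less.hyps[of u' p' q'] that by simp
  have "P = u' # p' \<Longrightarrow> Q = u' # q' \<Longrightarrow> length p' = length p \<Longrightarrow> split_eqv u' p' q'"
    if "eqv P Q" for P Q u' p' q'
    using that
  proof (induction arbitrary: u' p' q' rule: eqv.induct)
    case (eqv_refl p) then show ?case by (auto simp: split_eqv_def intro: eqv.intros)
  next
    case (eqv_swap u a c b p)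
    then show ?case unfolding split_eqv_def using eqv.eqv_refl by blast
  next
    case (eqv_Cons p q x) then show ?case by (auto simp: split_eqv_def)
  next
    case (eqv_trans P Q R)
    have "Q \<noteq> [] \<and> hd Q = u'" using eqv_hd[OF eqv_trans.hyps(1)] eqv_trans.prems by simp
    then obtain m where m: "Q = u' # m" by (cases Q) auto
    have "length m = length p" using eqv_length[OF eqv_trans.hyps(1)] eqv_trans.prems m by simp
    then show ?case
      using split_eqv_trans[of "Suc (length p)" p' u' m q', OF IH] eqv_trans.IH eqv_trans.prems m by simp
  qed
  then show ?case using less.prems by blast
qed

section \<open>Reduced edge paths\<close>

definition backtrack :: "'a list \<Rightarrow> bool" where
  "backtrack p \<longleftrightarrow> (\<exists>l x y r. p = l @ x # y # x # r)"

definition reduced :: "'a list \<Rightarrow> bool" where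
  "reduced p \<longleftrightarrow> (\<forall>q. eqv p q \<longrightarrow> \<not> backtrack q)"

lemma backtrack_Cons: "backtrack p \<Longrightarrow> backtrack (x # p)"
  unfolding backtrack_def by (metis append_Cons)

lemma backtrack_ConsE:
  assumes "backtrack (x # p)"
  obtains "backtrack p" | y r where "p = y # x # r"
  using assms unfolding backtrack_def by (metis append_eq_Cons_conv list.inject)

lemma backtrack_top: "backtrack (x # y # x # r)"
  unfolding backtrack_def by (metis append_Nil)

lemma reduced_ConsD: "reduced (x # p) \<Longrightarrow> reduced p"
  unfolding reduced_def by (meson backtrack_Cons eqv_Cons)

lemma reduced_eqv: "reduced p \<Longrightarrow> eqv p q \<Longrightarrow> reduced q"
  unfolding reduced_def by (meson eqv_trans)

text \<open>Suppose a swap of \<open>u' # u # p\<close> backtracks. Either its first edge still runs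
  to \<open>u\<close>, or it was swapped across a square at \<open>u'\<close> with far corner
  \<open>c\<close>. In the latter case the path through the fourth corner \<open>x\<close> is
  reduced by induction, so the backtrack is at the very head. Splitting once more at
  \<open>x\<close> gives, by uniqueness of squares, a path from \<open>u\<close> through
  \<open>c\<close> back to \<open>u\<close>, contrary to reducedness.\<close>

lemma reduced_extend:
  assumes "reduced (u # p)" "adj u u'" "\<nexists>q. eqv (u # p) (u # u' # q)"
  shows "reduced (u' # u # p)"
  using assms
proof (induction "length p" arbitrary: u p u' rule: less_induct)
  case (less p u u')
  show ?case unfolding reduced_def
  proof (intro allI impI notI)
    fix Q assume Q: "eqv (u' # u # p) Q" and bt: "backtrack Q"
    obtain q0 where q0: "Q = u' # q0" using eqv_hd[OF Q] by (cases Q) auto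
    have "split_eqv u' (u # p) q0" using eqv_Cons_split Q q0 by blast
    then consider "eqv (u # p) q0" | w x c B where "sq u' w c x" "eqv (u # p) (w # c # B)" "eqv q0 (x # c # B)"
      unfolding split_eqv_def by blast
    then show False
    proof cases
      case 1
      have "\<not> backtrack q0" using less.prems(1) 1 unfolding reduced_def by blast
      then obtain y r where y: "q0 = y # u' # r" using bt q0 backtrack_ConsE by metis
      then have "y = u" using eqv_hd[OF 1] by simp
      then show False using 1 y less.prems(3) by blast
    next
      case 2
      have w: "w = u" using eqv_hd[OF 2(2)] by simp
      have rd: "reduced (c # B)" using reduced_ConsD reduced_eqv less.prems(1) 2(2) by blast
      have len: "length B < length p" using eqv_length[OF 2(2)] by simp
      have "\<nexists>q. eqv (c # B) (c # x # q)"
      proof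
        assume "\<exists>q. eqv (c # B) (c # x # q)"
        then obtain q where "eqv (c # B) (c # x # q)" ..
        then have "eqv (u # p) (u # c # x # q)" using 2(2) w by (meson eqv_Cons eqv_trans)
        moreover have "eqv (u # c # x # q) (u # u' # x # q)"
          using 2(1) w sq_rot sq_flip by (blast intro: eqv_swap)
        ultimately show False using less.prems(3) eqv_trans by blast
      qed
      then have "reduced (x # c # B)"
        using less.hyps[OF len rd, of x] sq_adj[OF 2(1)] by blast
      then have rq: "reduced q0" using 2(3) reduced_eqv eqv_sym by blast
      then have "\<not> backtrack q0" unfolding reduced_def using eqv_refl by blast
      then obtain y r where y: "q0 = y # u' # r" using bt q0 backtrack_ConsE by metis
      have yx: "y = x" using eqv_hd[OF 2(3)] y by simp
      have "split_eqv x (c # B) (u' # r)" using eqv_Cons_split 2(3) y yx eqv_sym by blast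
      moreover have "\<not> eqv (c # B) (u' # r)" using eqv_hd sq_neq[OF 2(1)] by fastforce
      ultimately obtain w1 w2 s B' where s0: "sq x w1 s w2" "eqv (c # B) (w1 # s # B')" "eqv (u' # r) (w2 # s # B')"
        unfolding split_eqv_def by blast
      then have "w1 = c" "w2 = u'" using eqv_hd by fastforce+
      with s0 have s: "sq x c s u'" "eqv (c # B) (c # s # B')" by simp_all
      have "sq x c u u'" using 2(1) w sq_rot sq_flip by blast
      then have "s = u" using s(1) sq_unique by blast
      then have "eqv (u # p) (u # c # u # B')" using 2(2) s(2) w by (meson eqv_Cons eqv_trans)
      then show False using less.prems(1) backtrack_top unfolding reduced_def by blast
    qed
  qed
qed

end

section \<open>Local sections and monodromy\<close>

text \<open>A local system on the 1-skeleton: fibres \<open>S v\<close> with invertible transport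
  along edges that is trivial around squares. \<open>T\<close> is given only the target vertex; the
  source is understood from the fibre containing the argument.\<close>

locale transport = cubes X for X :: "'a set set" +
  fixes S :: "'a \<Rightarrow> 's set" and T :: "'a \<Rightarrow> 's \<Rightarrow> 's"
  assumes T_in: "adj u u' \<Longrightarrow> s \<in> S u \<Longrightarrow> T u' s \<in> S u'"
    and T_inv: "adj u u' \<Longrightarrow> s \<in> S u \<Longrightarrow> T u (T u' s) = s"
    and T_sq: "sq u a c b \<Longrightarrow> s \<in> S u \<Longrightarrow> T c (T a s) = T c (T b s)"
begin

definition sect :: "'a set \<Rightarrow> ('a \<Rightarrow> 's) \<Rightarrow> bool" where
  "sect Q g \<longleftrightarrow> (\<forall>v\<in>Q. g v \<in> S v) \<and> (\<forall>v\<in>Q. \<forall>w\<in>Q. adj v w \<longrightarrow> g w = T w (g v))"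

lemma sect_subset: "sect Q g \<Longrightarrow> R \<subseteq> Q \<Longrightarrow> sect R g"
  unfolding sect_def by blast

lemma sect_mem: "sect Q g \<Longrightarrow> v \<in> Q \<Longrightarrow> g v \<in> S v"
  unfolding sect_def by blast

lemma sect_adj: "sect Q g \<Longrightarrow> v \<in> Q \<Longrightarrow> w \<in> Q \<Longrightarrow> adj v w \<Longrightarrow> g w = T w (g v)"
  unfolding sect_def by blast

lemma adj_chart_insert:
  assumes "cube_chart X n \<phi> Q" "insert i A \<subseteq> {..<n}" "i \<notin> A"
  shows "adj (\<phi> A) (\<phi> (insert i A))"
  using adj_chart_flip[OF assms(1), of A i] assms by (simp add: flip_def)

text \<open>Coordinates are added one at a time: transport in the new direction is done last, and
  \<open>T_sq\<close> makes it commute with the earlier directions.\<close>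

lemma chart_section:
  assumes ch: "cube_chart X n \<phi> Q" and s: "s \<in> S (\<phi> {})"
  obtains g where "sect Q g" "g (\<phi> {}) = s"
proof -
  have "k \<le> n \<Longrightarrow> \<exists>G. G {} = s \<and> (\<forall>A \<subseteq> {..<k}. G A \<in> S (\<phi> A)) \<and>
      (\<forall>A i. insert i A \<subseteq> {..<k} \<and> i \<notin> A \<longrightarrow> G (insert i A) = T (\<phi> (insert i A)) (G A))" for k
  proof (induction k)
    case 0 show ?case by (rule exI[of _ "\<lambda>_. s"]) (use s in auto)
  next
    case (Suc k)
    then obtain G where G: "G {} = s" "\<And>A. A \<subseteq> {..<k} \<Longrightarrow> G A \<in> S (\<phi> A)"
      "\<And>A i. insert i A \<subseteq> {..<k} \<Longrightarrow> i \<notin> A \<Longrightarrow> G (insert i A) = T (\<phi> (insert i A)) (G A)"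
      by auto
    define G' where "G' A = (if k \<in> A then T (\<phi> A) (G (A - {k})) else G A)" for A
    have sub: "A - {k} \<subseteq> {..<k}" if "A \<subseteq> {..<Suc k}" for A using that by (auto simp: less_Suc_eq)
    have sub': "A \<subseteq> {..<k}" if "A \<subseteq> {..<Suc k}" "k \<notin> A" for A using sub[OF that(1)] that(2) by simp
    have step: "adj (\<phi> (A - {k})) (\<phi> A)" if "A \<subseteq> {..<Suc k}" "k \<in> A" for A
    proof -
      have "insert k (A - {k}) = A" "A \<subseteq> {..<n}" using that Suc.prems by auto
      then show ?thesis using adj_chart_insert[OF ch, of k "A - {k}"] by simp
    qed
    have in_S: "G' A \<in> S (\<phi> A)" if A: "A \<subseteq> {..<Suc k}" for A
      using T_in[OF step[OF A]] G(2)[OF sub[OF A]] G(2)[of A] sub'[OF A] by (simp add: G'_def)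
    have trans: "G' (insert i A) = T (\<phi> (insert i A)) (G' A)" if A: "insert i A \<subseteq> {..<Suc k}" "i \<notin> A" for A i
    proof -
      consider "i = k" | "i \<noteq> k" "k \<notin> A" | "i \<noteq> k" "k \<in> A" by blast
      then show ?thesis
      proof cases
        case 1 then show ?thesis using A by (simp add: G'_def)
      next
        case 2
        then have "insert i A \<subseteq> {..<k}" using A by (intro sub') auto
        then show ?thesis using 2 G(3) A by (simp add: G'_def)
      next
        case 3
        define B where "B = A - {k}"
        have B: "A = insert k B" "k \<notin> B" "i \<notin> B" "insert i B \<subseteq> {..<k}" "i < n" "k < n" "B \<subseteq> {..<n}"
          using 3 A Suc.prems by (auto simp: B_def less_Suc_eq)
        have q: "sq (\<phi> B) (\<phi> (insert i B)) (\<phi> (insert k (insert i B))) (\<phi> (insert k B))"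
          using sq_chart_flip[OF ch B(7,5,6)] 3 B by (simp add: flip_def)
        have BS: "G B \<in> S (\<phi> B)" using B G(2) by simp
        have e: "insert i A - {k} = insert i B" "A - {k} = B" "insert i A = insert k (insert i B)"
          using B 3 by auto
        have "G' (insert i A) = T (\<phi> (insert i A)) (G (insert i B))"
          using 3 e by (simp add: G'_def)
        also have "G (insert i B) = T (\<phi> (insert i B)) (G B)" using G(3) B by simp
        also have "T (\<phi> (insert i A)) (T (\<phi> (insert i B)) (G B)) = T (\<phi> (insert i A)) (T (\<phi> A) (G B))"
          using T_sq[OF q BS] e B(1) by simp
        also have "T (\<phi> A) (G B) = G' A" using 3 e by (simp add: G'_def)
        finally show ?thesis .
      qed
    qed
    have "G' {} = s" by (simp add: G'_def G(1))
    then show ?case using in_S trans by (intro exI[of _ G']) simp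
  qed
  from this[OF order_refl] obtain G where G: "G {} = s" "\<And>A. A \<subseteq> {..<n} \<Longrightarrow> G A \<in> S (\<phi> A)"
      "\<And>A i. insert i A \<subseteq> {..<n} \<Longrightarrow> i \<notin> A \<Longrightarrow> G (insert i A) = T (\<phi> (insert i A)) (G A)"
    by auto
  define g where "g v = G (inv_into (Pow {..<n}) \<phi> v)" for v
  have g: "g (\<phi> A) = G A" if "A \<subseteq> {..<n}" for A
    using that chart_inj[OF ch] by (simp add: g_def inv_into_f_f)
  have "sect Q g"
    unfolding sect_def
  proof (intro conjI ballI impI)
    fix v assume "v \<in> Q" then show "g v \<in> S v" using chart_ex[OF ch] g G(2) by metis
  next
    fix v w assume vw: "v \<in> Q" "w \<in> Q" "adj v w"
    obtain A where A: "A \<subseteq> {..<n}" "v = \<phi> A" using chart_ex[OF ch vw(1)] .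
    obtain B where B: "B \<subseteq> {..<n}" "w = \<phi> B" using chart_ex[OF ch vw(2)] .
    obtain i where i: "i < n" "B = flip i A"
      using chart_adj_flip[OF ch A(1) B(1)] vw(3) A B by blast
    show "g w = T w (g v)"
    proof (cases "i \<in> A")
      case False
      then show ?thesis using G(3)[of i A] i A B by (simp add: g flip_def)
    next
      case True
      then have Ai: "insert i B = A" "i \<notin> B" using i by (auto simp: flip_def)
      then have GA: "G A = T (\<phi> A) (G B)" using G(3)[of i B] A by simp
      then have "T w (g v) = T (\<phi> B) (T (\<phi> A) (G B))" using A B by (simp add: g)
      also have "\<dots> = G B" using T_inv[of "\<phi> B" "\<phi> A"] vw A B G(2) adj_sym by blast
      finally show ?thesis using B by (simp add: g)
    qed
  qed
  moreover have "g (\<phi> {}) = s" using g G by simp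
  ultimately show ?thesis using that by blast
qed

lemma sect_chart_agree:
  assumes ch: "cube_chart X n \<phi> Q" and "sect Q g" "sect Q h" "A \<subseteq> {..<n}"
  shows "g (\<phi> A) = h (\<phi> A) \<longleftrightarrow> g (\<phi> {}) = h (\<phi> {})"
proof -
  have "finite A" using assms(4) finite_subset by blast
  then show ?thesis using assms(4)
  proof (induction A rule: finite_induct)
    case (insert i A)
    have a: "adj (\<phi> A) (\<phi> (insert i A))" using adj_chart_insert[OF ch insert.prems] insert by blast
    have m: "\<phi> A \<in> Q" "\<phi> (insert i A) \<in> Q" using insert.prems by (intro chart_mem[OF ch]; simp)+
    have "g (\<phi> A) = h (\<phi> A) \<longleftrightarrow> g (\<phi> (insert i A)) = h (\<phi> (insert i A))"
      using sect_adj[OF assms(2)] sect_adj[OF assms(3)] m a adj_sym by metis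
    then show ?case using insert by simp
  qed simp
qed

lemma sect_unique:
  assumes "Q \<in> X" "sect Q g" "sect Q h" "v \<in> Q" "g v = h v" "w \<in> Q"
  shows "g w = h w"
proof -
  obtain n \<phi> where ch: "cube_chart X n \<phi> Q" using assms(1) by (rule cube_cases)
  show ?thesis
    using sect_chart_agree[OF ch assms(2,3)] chart_ex[OF ch assms(4)] chart_ex[OF ch assms(6)] assms(5)
    by metis
qed

text \<open>\<open>chart_section\<close> starts at the corner \<open>\<phi> {}\<close>; a value
  prescribed elsewhere is first moved down to that corner, one coordinate at a time.\<close>

lemma section_ex:
  assumes "Q \<in> X" "v \<in> Q" "s \<in> S v"
  obtains g where "sect Q g" "g v = s"
proof -
  obtain n \<phi> where ch: "cube_chart X n \<phi> Q" using assms(1) by (rule cube_cases)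
  obtain A where A: "A \<subseteq> {..<n}" "v = \<phi> A" using chart_ex[OF ch assms(2)] .
  have "finite A" using A(1) finite_subset by blast
  then have "\<forall>s \<in> S (\<phi> A). \<exists>g. sect Q g \<and> g (\<phi> A) = s" using A(1)
  proof (induction A rule: finite_induct)
    case empty then show ?case using chart_section[OF ch] by metis
  next
    case (insert i A)
    have a: "adj (\<phi> A) (\<phi> (insert i A))" using adj_chart_insert[OF ch insert.prems] insert by blast
    have m: "\<phi> A \<in> Q" "\<phi> (insert i A) \<in> Q" using insert.prems by (intro chart_mem[OF ch]; simp)+
    show ?case
    proof
      fix s assume s: "s \<in> S (\<phi> (insert i A))"
      then have "T (\<phi> A) s \<in> S (\<phi> A)" using T_in a adj_sym by blast
      then obtain g where g: "sect Q g" "g (\<phi> A) = T (\<phi> A) s" using insert by auto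
      then have "g (\<phi> (insert i A)) = s" using sect_adj[OF g(1) m a] T_inv[of "\<phi> (insert i A)" "\<phi> A"] a s adj_sym by auto
      with g show "\<exists>g. sect Q g \<and> g (\<phi> (insert i A)) = s" by blast
    qed
  qed
  then show ?thesis using that assms(3) A(2) by blast
qed

text \<open>Transport between any two vertices of a common cube, without choosing an edge path in
  it.\<close>

definition rel :: "'a \<Rightarrow> 's \<Rightarrow> 'a \<Rightarrow> 's \<Rightarrow> bool" where
  "rel v s w s' \<longleftrightarrow> (\<exists>Q\<in>X. v \<in> Q \<and> w \<in> Q \<and> (\<exists>g. sect Q g \<and> g v = s \<and> g w = s'))"

lemma rel_ex: assumes "Q \<in> X" "v \<in> Q" "w \<in> Q" "s \<in> S v" shows "\<exists>s'. rel v s w s'"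
  using section_ex[OF assms(1,2,4)] assms unfolding rel_def by metis

lemma rel_sym: "rel v s w s' \<Longrightarrow> rel w s' v s"
  unfolding rel_def by blast

lemma rel_mem: "rel v s w s' \<Longrightarrow> s \<in> S v \<and> s' \<in> S w"
  unfolding rel_def using sect_mem by blast

text \<open>Two cubes through \<open>v\<close> and \<open>w\<close> meet in a cube, on which
  sections agreeing at \<open>v\<close> agree at \<open>w\<close>; hence \<open>rel\<close> does not
  depend on the cube.\<close>

lemma rel_sect:
  assumes "Q \<in> X" "sect Q g" "v \<in> Q" "w \<in> Q" "rel v (g v) w s'" shows "s' = g w"
proof -
  obtain R h where R: "R \<in> X" "v \<in> R" "w \<in> R" "sect R h" "h v = g v" "h w = s'"
    using assms(5) unfolding rel_def by blast
  have "Q \<inter> R \<in> X" using assms R by (intro cube_Int) auto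
  moreover have "sect (Q \<inter> R) g" "sect (Q \<inter> R) h" using assms R sect_subset by blast+
  ultimately have "g w = h w" using sect_unique[of "Q \<inter> R" g h v w] assms R by simp
  then show ?thesis using R by simp
qed

lemma rel_unique: "rel v s w a \<Longrightarrow> rel v s w b \<Longrightarrow> a = b"
proof -
  assume "rel v s w a" "rel v s w b"
  then obtain Q g where "Q \<in> X" "v \<in> Q" "w \<in> Q" "sect Q g" "g v = s" "g w = a"
    unfolding rel_def by blast
  with \<open>rel v s w b\<close> show "a = b" using rel_sect[of Q g v w b] by simp
qed

lemma rel_adj: assumes "adj v w" "s \<in> S v" shows "rel v s w (T w s)"
proof -
  have Q: "{v, w} \<in> X" using assms by (simp add: adj_def edges_def)
  obtain g where g: "sect {v, w} g" "g v = s" using section_ex[OF Q _ assms(2)] by blast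
  then have "g w = T w s" using sect_adj[OF g(1), of v w] assms by simp
  then show ?thesis using g Q unfolding rel_def by (intro bexI[of _ "{v, w}"]) auto
qed

lemma rel_refl: assumes "v \<in> V" "s \<in> S v" shows "rel v s v s"
proof -
  obtain g where "sect {v} g" "g v = s"
    using section_ex[OF vertex_cube[OF assms(1)] _ assms(2)] by blast
  then show ?thesis using vertex_cube[OF assms(1)] unfolding rel_def by (intro bexI[of _ "{v}"]) auto
qed

text \<open>A lift of the bottom row of a grid of cubes whose top row lies in a single cube is closed:
  the lift is pushed upwards one row at a time.\<close>

lemma grid_monodromy:
  assumes "\<And>i j. i < m \<Longrightarrow> j < N \<Longrightarrow> \<exists>Q\<in>X. {w i j, w i (Suc j), w (Suc i) j, w (Suc i) (Suc j)} \<subseteq> Q"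
    and "\<And>i. i \<le> m \<Longrightarrow> w i N = w i 0"
    and "\<exists>Q\<in>X. \<forall>j\<le>N. w m j \<in> Q"
    and "\<And>j. j < N \<Longrightarrow> rel (w 0 j) (s j) (w 0 (Suc j)) (s (Suc j))"
    and "N > 0"
  shows "s N = s 0"
  using assms
proof (induction m arbitrary: w s)
  case (0 w s)
  then obtain Q where Q: "Q \<in> X" "\<And>j. j \<le> N \<Longrightarrow> w 0 j \<in> Q" by blast
  have "s 0 \<in> S (w 0 0)" using rel_mem[OF "0.prems"(4)[OF 0(5)]] by blast
  then obtain g where g: "sect Q g" "g (w 0 0) = s 0" using section_ex[OF Q(1) Q(2)[of 0]] by blast
  have "j \<le> N \<Longrightarrow> s j = g (w 0 j)" for j
  proof (induction j)
    case (Suc j)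
    then have "rel (w 0 j) (g (w 0 j)) (w 0 (Suc j)) (s (Suc j))" using "0.prems"(4)[of j] by simp
    then show ?case using rel_sect[OF Q(1) g(1) Q(2)[of j] Q(2)[of "Suc j"]] Suc.prems by simp
  qed (simp add: g)
  then show ?case using "0.prems"(2)[of 0] g by simp
next
  case (Suc m w s)
  define s' where "s' j = (SOME t. rel (w 0 j) (s j) (w 1 j) t)" for j
  have cell: "\<exists>Q\<in>X. {w 0 j, w 0 (Suc j), w 1 j, w 1 (Suc j)} \<subseteq> Q" if "j < N" for j
    using Suc.prems(1)[of 0 j] that by simp
  have mem: "s j \<in> S (w 0 j)" if "j \<le> N" for j
    using rel_mem[OF Suc.prems(4), of j] rel_mem[OF Suc.prems(4), of "j - 1"] that Suc.prems(5)
    by (cases "j = N") auto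
  have up: "rel (w 0 j) (s j) (w 1 j) (s' j)" if "j \<le> N" for j
  proof -
    have "\<exists>Q\<in>X. w 0 j \<in> Q \<and> w 1 j \<in> Q"
      using cell[of j] cell[of "j - 1"] that Suc.prems(5) by (cases "j = N") auto
    then have "\<exists>t. rel (w 0 j) (s j) (w 1 j) t" using rel_ex mem[OF that] by blast
    then show ?thesis unfolding s'_def by (rule someI_ex)
  qed
  have "s' N = s' 0"
  proof (rule Suc.IH[of "\<lambda>i. w (Suc i)" s'])
    show "rel (w (Suc 0) j) (s' j) (w (Suc 0) (Suc j)) (s' (Suc j))" if j: "j < N" for j
    proof -
      obtain Q where Q: "Q \<in> X" "w 0 j \<in> Q" "w 0 (Suc j) \<in> Q" "w 1 j \<in> Q" "w 1 (Suc j) \<in> Q"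
        using cell[OF j] by blast
      obtain g where g: "sect Q g" "g (w 0 j) = s j" using section_ex[OF Q(1,2) mem[of j]] j by auto
      have "s (Suc j) = g (w 0 (Suc j))" using rel_sect[OF Q(1) g(1) Q(2,3)] Suc.prems(4)[OF j] g by simp
      then have "s' (Suc j) = g (w 1 (Suc j))" using rel_sect[OF Q(1) g(1) Q(3,5)] up[of "Suc j"] j by simp
      moreover have "s' j = g (w 1 j)" using rel_sect[OF Q(1) g(1) Q(2,4)] up[of j] j g by simp
      ultimately show ?thesis using Q g unfolding rel_def by auto
    qed
  qed (use Suc.prems in auto)
  moreover have "w 0 N = w 0 0" "w 1 N = w 1 0" using Suc.prems(2)[of 0] Suc.prems(2)[of 1] by auto
  ultimately have "rel (w 1 0) (s' 0) (w 0 0) (s N)" "rel (w 1 0) (s' 0) (w 0 0) (s 0)"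
    using up[of N] up[of 0] rel_sym by auto
  then show ?case by (rule rel_unique)
qed

text \<open>Forward walks are lists of vertices with the initial vertex at the head.\<close>

lemma fold_T_mem: "successively adj (v # xs) \<Longrightarrow> s \<in> S v \<Longrightarrow> fold T xs s \<in> S (last (v # xs))"
  by (induction xs arbitrary: v s) (auto simp: successively_Cons T_in)

lemma fold_T_rev:
  "successively adj (v # xs) \<Longrightarrow> s \<in> S v \<Longrightarrow> fold T (tl (rev (v # xs))) (fold T xs s) = s"
proof (induction xs arbitrary: v s)
  case (Cons x xs)
  have a: "adj v x" "successively adj (x # xs)" using Cons.prems by (auto simp: successively_Cons)
  have "T x s \<in> S x" using T_in a Cons.prems by blast
  then have "fold T (tl (rev (x # xs))) (fold T xs (T x s)) = T x s" using Cons.IH a by blast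
  moreover have "tl (rev (v # x # xs)) = tl (rev (x # xs)) @ [v]" by (cases "rev xs") auto
  ultimately show ?case using T_inv a Cons.prems by simp
qed simp

text \<open>Transport along arbitrarily chosen walks from \<open>b\<close> gives a value at each
  vertex; triviality on loops makes the values at the two ends of an edge compatible.\<close>

lemma global_section:
  assumes conn: "\<And>v. v \<in> V \<Longrightarrow> \<exists>xs. successively adj (b # xs) \<and> last (b # xs) = v"
    and loops: "\<And>xs s. xs \<noteq> [] \<Longrightarrow> successively adj (b # xs) \<Longrightarrow> last xs = b \<Longrightarrow> s \<in> S b \<Longrightarrow> fold T xs s = s"
    and s0: "s0 \<in> S b"
  obtains g where "g b = s0" "\<And>u u'. adj u u' \<Longrightarrow> g u \<in> S u \<and> g u' = T u' (g u)"
proof -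
  define p where "p v = (SOME xs. successively adj (b # xs) \<and> last (b # xs) = v)" for v
  have p: "successively adj (b # p v)" "last (b # p v) = v" if "v \<in> V" for v
    using someI_ex[OF conn[OF that]] unfolding p_def by blast+
  define g where "g v = (if v = b then s0 else fold T (p v) s0)" for v
  have g: "g v = fold T (p v) s0" if "v \<in> V" for v
    using p[OF that] loops[of "p v"] s0 by (cases "p v") (auto simp: g_def)
  have "g u \<in> S u \<and> g u' = T u' (g u)" if a: "adj u u'" for u u'
  proof
    have V: "u \<in> V" "u' \<in> V" using a adj_V by blast+
    show gu: "g u \<in> S u" using fold_T_mem[OF p(1)[OF V(1)] s0] p(2)[OF V(1)] g V by simp
    let ?r = "tl (rev (b # p u'))"
    have rev: "rev (b # p u') = u' # ?r" using p(2)[OF V(2)] by (metis hd_rev list.collapse rev_is_Nil_conv list.distinct(1))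
    have sr: "successively adj (u' # ?r)"
    proof -
      have "successively (\<lambda>x y. adj y x) (b # p u')"
        using p(1)[OF V(2)] adj_sym by (metis successively_mono)
      then show ?thesis using rev successively_rev by metis
    qed
    \<comment> \<open>The loop goes out along the walk to \<open>u\<close>, across the edge, and
      back along the walk to \<open>u'\<close>.\<close>
    have sfull: "successively adj (b # (p u @ u' # ?r))"
      using p(1,2)[OF V(1)] a sr successively_append_iff[of adj "b # p u" "u' # ?r"] by simp
    have lst: "last (p u @ u' # ?r) = b"
      using rev by (metis last_append last_rev list.distinct(1) list.sel(1))
    have "fold T (p u @ u' # ?r) s0 = s0" by (rule loops[OF _ sfull lst s0]) simp
    then have 1: "fold T ?r (T u' (g u)) = s0" using g V by simp
    have "T u' (g u) \<in> S u'" using T_in a gu by blast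
    then have "fold T (tl (rev (u' # ?r))) (fold T ?r (T u' (g u))) = T u' (g u)"
      using fold_T_rev sr by blast
    moreover have "tl (rev (u' # ?r)) = p u'" using rev by (metis list.sel(3) rev_rev_ident)
    ultimately show "g u' = T u' (g u)" using 1 g V by simp
  qed
  moreover have "g b = s0" by (simp add: g_def)
  ultimately show ?thesis using that by blast
qed

end

context cat0
begin

section \<open>The local system of reduced path classes\<close>

definition cls :: "'a list \<Rightarrow> 'a list set" where "cls p = {q. eqv p q}"

lemma cls_eq: "cls p = cls q \<longleftrightarrow> eqv p q"
  unfolding cls_def using eqv_refl eqv_sym eqv_trans by blast

definition St :: "'a \<Rightarrow> 'a \<Rightarrow> 'a list set set" where
  "St b v = {cls p | p. reduced p \<and> successively adj p \<and> p \<noteq> [] \<and> hd p = v \<and> last p = b}"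

text \<open>Prolongation to \<open>v\<close> with cancellation: if the class contains a path whose
  last edge comes from \<open>v\<close>, that edge is removed; otherwise the edge to
  \<open>v\<close> is appended.\<close>

definition Tr :: "'a \<Rightarrow> 'a list set \<Rightarrow> 'a list set" where
  "Tr v C = (if \<exists>u q. u # v # q \<in> C then {q. q \<noteq> [] \<and> hd q = v \<and> (\<exists>u. u # q \<in> C)}
             else {q. \<exists>p\<in>C. eqv (v # p) q})"

text \<open>In the second alternative of \<open>split_eqv\<close>, two distinct corners of a square
  would both equal \<open>v\<close>.\<close>

lemma eqv_cancel: assumes "eqv (u # v # p) (u # v # q)" shows "eqv (v # p) (v # q)"
proof -
  have "split_eqv u (v # p) (v # q)" using eqv_Cons_split assms by blast
  then consider "eqv (v # p) (v # q)" | w w' c B where "sq u w c w'" "eqv (v # p) (w # c # B)" "eqv (v # q) (w' # c # B)"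
    unfolding split_eqv_def by blast
  then show ?thesis
  proof cases
    case 2
    then have "w = w'" by (metis eqv_Cons_hd)
    then show ?thesis using sq_neq[OF 2(1)] by blast
  qed
qed

lemma Tr_down: assumes "eqv p (u # v # q)" shows "Tr v (cls p) = cls (v # q)"
proof -
  have "u # v # q \<in> cls p" using assms by (simp add: cls_def)
  then have "Tr v (cls p) = {q. q \<noteq> [] \<and> hd q = v \<and> (\<exists>u. u # q \<in> cls p)}"
    unfolding Tr_def by auto
  also have "\<dots> = cls (v # q)"
  proof (intro set_eqI iffI)
    fix r assume "r \<in> {q. q \<noteq> [] \<and> hd q = v \<and> (\<exists>u. u # q \<in> cls p)}"
    then obtain u' r' where r: "r = v # r'" "eqv p (u' # v # r')" by (cases r) (auto simp: cls_def)
    then have "eqv (u # v # q) (u' # v # r')" using assms eqv_sym eqv_trans by blast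
    moreover have "u' = u" using calculation by (metis eqv_Cons_hd)
    ultimately show "r \<in> cls (v # q)" using eqv_cancel r(1) by (simp add: cls_def)
  next
    fix r assume "r \<in> cls (v # q)"
    then have r: "eqv (v # q) r" by (simp add: cls_def)
    then have "r \<noteq> []" "hd r = v" using eqv_hd by fastforce+
    moreover have "eqv p (u # r)" using assms r by (meson eqv_Cons eqv_trans)
    ultimately show "r \<in> {q. q \<noteq> [] \<and> hd q = v \<and> (\<exists>u. u # q \<in> cls p)}" by (auto simp: cls_def)
  qed
  finally show ?thesis .
qed

lemma Tr_up: assumes "\<nexists>u q. eqv p (u # v # q)" shows "Tr v (cls p) = cls (v # p)"
proof -
  have "{q. \<exists>r\<in>cls p. eqv (v # r) q} = cls (v # p)"
    unfolding cls_def using eqv_refl eqv_Cons eqv_trans by blast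
  then show ?thesis using assms by (simp add: Tr_def cls_def)
qed

lemma eqv_successively: "eqv p q \<Longrightarrow> successively adj p \<Longrightarrow> successively adj q"
proof (induction rule: eqv.induct)
  case (eqv_swap u a c b p)
  then show ?case using sq_adj[OF eqv_swap(1)] by (auto simp: successively_Cons)
next
  case (eqv_Cons p q x)
  then show ?case using eqv_hd[OF eqv_Cons(1)] eqv_length[OF eqv_Cons(1)]
    by (cases "p = []") (auto simp: successively_Cons)
qed simp_all

lemma not_backtrack_reduced: "reduced p \<Longrightarrow> eqv p (x # y # x # r) \<Longrightarrow> False"
  unfolding reduced_def using backtrack_top by blast

lemma Tr_eqv_head: "eqv (u # p) (u' # v # q) \<Longrightarrow> u' = u"
  by (metis eqv_Cons_hd)

lemma St_cases:
  assumes "C \<in> St b u"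
  obtains p where "C = cls (u # p)" "reduced (u # p)" "successively adj (u # p)" "last (u # p) = b"
proof -
  obtain P where P: "C = cls P" "reduced P" "successively adj P" "P \<noteq> []" "hd P = u" "last P = b"
    using assms unfolding St_def by blast
  obtain p where p: "P = u # p" using P by (cases P) auto
  show ?thesis by (rule that[of p]) (use P p in simp_all)
qed

lemma St_I:
  "reduced (u # p) \<Longrightarrow> successively adj (u # p) \<Longrightarrow> last (u # p) = b \<Longrightarrow> cls (u # p) \<in> St b u"
  unfolding St_def by force

lemma Tr_in: assumes "adj u v" "C \<in> St b u" shows "Tr v C \<in> St b v"
proof -
  obtain p where p: "C = cls (u # p)" "reduced (u # p)" "successively adj (u # p)" "last (u # p) = b"
    using assms(2) by (rule St_cases)
  show ?thesis
  proof (cases "\<exists>q. eqv (u # p) (u # v # q)")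
    case True
    then obtain q where q: "eqv (u # p) (u # v # q)" ..
    have "reduced (u # v # q)" "successively adj (u # v # q)" "last (u # v # q) = b"
      using q p reduced_eqv eqv_successively eqv_last[OF q] by (blast, blast, simp)
    then show ?thesis using Tr_down[OF q] p reduced_ConsD by (auto intro!: St_I)
  next
    case False
    then have "\<nexists>u' q. eqv (u # p) (u' # v # q)" using Tr_eqv_head by metis
    then have "Tr v C = cls (v # u # p)" using Tr_up p by blast
    moreover have "reduced (v # u # p)" using reduced_extend[OF p(2) assms(1) False] .
    ultimately show ?thesis using p assms(1) adj_sym by (auto intro!: St_I simp: successively_Cons)
  qed
qed

lemma Tr_inv: assumes "adj u v" "C \<in> St b u" shows "Tr u (Tr v C) = C"
proof -
  obtain p where p: "C = cls (u # p)" "reduced (u # p)"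
    using assms(2) by (rule St_cases)
  show ?thesis
  proof (cases "\<exists>q. eqv (u # p) (u # v # q)")
    case True
    then obtain q where q: "eqv (u # p) (u # v # q)" ..
    have "\<nexists>u' r. eqv (v # q) (u' # u # r)"
    proof
      assume "\<exists>u' r. eqv (v # q) (u' # u # r)"
      then obtain r where "eqv (v # q) (v # u # r)" using Tr_eqv_head by metis
      then have "eqv (u # p) (u # v # u # r)" using q by (meson eqv_Cons eqv_trans)
      then show False using p not_backtrack_reduced by blast
    qed
    then have "Tr u (cls (v # q)) = cls (u # v # q)" by (rule Tr_up)
    then show ?thesis using Tr_down[OF q] p q cls_eq by metis
  next
    case False
    then have "\<nexists>u' q. eqv (u # p) (u' # v # q)" using Tr_eqv_head by metis
    then have "Tr v C = cls (v # u # p)" using Tr_up p by blast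
    then show ?thesis using Tr_down[OF eqv_refl] p by simp
  qed
qed

text \<open>One route shortens the path and then lengthens it, the other does so in reverse order; a
  swap of the last two edges identifies the results.\<close>

lemma Tr_sq_mixed:
  assumes s: "sq u a c b" and p: "reduced (u # p)" and a: "eqv (u # p) (u # a # q)"
    and b: "\<nexists>r. eqv (u # p) (u # b # r)"
  shows "Tr c (Tr a (cls (u # p))) = Tr c (Tr b (cls (u # p)))"
proof -
  have b': "\<nexists>u' r. eqv (u # p) (u' # b # r)" using b Tr_eqv_head by metis
  have Ta: "Tr a (cls (u # p)) = cls (a # q)" using Tr_down[OF a] .
  have Tb: "Tr b (cls (u # p)) = cls (b # u # p)" using Tr_up[OF b'] .
  have "\<nexists>u' r. eqv (a # q) (u' # c # r)"
  proof
    assume "\<exists>u' r. eqv (a # q) (u' # c # r)"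
    then obtain r where "eqv (a # q) (a # c # r)" using Tr_eqv_head by metis
    then have "eqv (u # p) (u # a # c # r)" using a by (meson eqv_Cons eqv_trans)
    then have "eqv (u # p) (u # b # c # r)" using eqv_swap[OF s] eqv_trans by blast
    then show False using b by blast
  qed
  then have Tc: "Tr c (cls (a # q)) = cls (c # a # q)" by (rule Tr_up)
  have "eqv (b # u # p) (b # u # a # q)" using a by (rule eqv_Cons)
  moreover have "eqv (b # u # a # q) (b # c # a # q)" using s sq_rot sq_flip by (blast intro: eqv_swap)
  ultimately have "eqv (b # u # p) (b # c # a # q)" by (rule eqv_trans)
  then have "Tr c (cls (b # u # p)) = cls (c # a # q)" by (rule Tr_down)
  then show ?thesis using Ta Tb Tc by simp
qed

text \<open>The cases say towards which of \<open>a\<close> and \<open>b\<close> the class can be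
  shortened. If towards both, splitting produces a square at \<open>u\<close>, which can only be the
  given one. If towards neither, a shortening in the second step would, by the same uniqueness,
  imply one at \<open>u\<close> towards the other neighbour.\<close>

lemma Tr_sq: assumes s: "sq u a c b" and C: "C \<in> St d u" shows "Tr c (Tr a C) = Tr c (Tr b C)"
proof -
  obtain p where p: "C = cls (u # p)" "reduced (u # p)"
    using C by (rule St_cases)
  consider q r where "eqv (u # p) (u # a # q)" "eqv (u # p) (u # b # r)"
    | q where "eqv (u # p) (u # a # q)" "\<nexists>r. eqv (u # p) (u # b # r)"
    | r where "\<nexists>q. eqv (u # p) (u # a # q)" "eqv (u # p) (u # b # r)"
    | "\<nexists>q. eqv (u # p) (u # a # q)" "\<nexists>r. eqv (u # p) (u # b # r)" by blast
  then show ?thesis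
  proof cases
    case 1
    have "split_eqv u (a # q) (b # r)" using 1 eqv_Cons_split eqv_sym eqv_trans by blast
    moreover have "\<not> eqv (a # q) (b # r)" using eqv_Cons_hd sq_neq[OF s] by blast
    ultimately obtain w w' c' B where w: "sq u w c' w'" "eqv (a # q) (w # c' # B)" "eqv (b # r) (w' # c' # B)"
      unfolding split_eqv_def by blast
    have "w = a" "w' = b" using w eqv_Cons_hd by blast+
    then have "c' = c" using w(1) s sq_unique by blast
    then have "Tr c (cls (a # q)) = cls (c # B)" "Tr c (cls (b # r)) = cls (c # B)"
      using w Tr_down by blast+
    then show ?thesis using Tr_down[OF 1(1)] Tr_down[OF 1(2)] p by simp
  next
    case 2 then show ?thesis using Tr_sq_mixed[OF s p(2)] p by blast
  next
    case 3 then show ?thesis using Tr_sq_mixed[OF sq_flip[OF s] p(2)] p by metis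
  next
    case 4
    have *: "Tr y (Tr x C) = cls (y # x # u # p)"
      if q: "sq u x y z" and x: "\<nexists>q. eqv (u # p) (u # x # q)" and z: "\<nexists>q. eqv (u # p) (u # z # q)" for x y z
    proof -
      have "\<nexists>u' q. eqv (u # p) (u' # x # q)" using x Tr_eqv_head by metis
      then have Tx: "Tr x C = cls (x # u # p)" using Tr_up p by blast
      have "\<nexists>u' r. eqv (x # u # p) (u' # y # r)"
      proof
        assume "\<exists>u' r. eqv (x # u # p) (u' # y # r)"
        then obtain r where "eqv (x # u # p) (x # y # r)" using Tr_eqv_head by metis
        then have "split_eqv x (u # p) (y # r)" by (rule eqv_Cons_split)
        moreover have "\<not> eqv (u # p) (y # r)" using eqv_Cons_hd sq_neq[OF q] by blast
        ultimately obtain w w' c' B where w: "sq x w c' w'" "eqv (u # p) (w # c' # B)" "eqv (y # r) (w' # c' # B)"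
          unfolding split_eqv_def by blast
        have "w = u" "w' = y" using w eqv_Cons_hd by blast+
        moreover have "sq x u z y" using q sq_rot sq_flip by blast
        ultimately have "c' = z" using w(1) sq_unique by blast
        then show False using w(2) \<open>w = u\<close> z by blast
      qed
      then show ?thesis using Tr_up Tx by simp
    qed
    have "eqv (c # a # u # p) (c # b # u # p)" using s sq_rot sq_flip by (blast intro: eqv_swap)
    then show ?thesis using *[OF s 4] *[OF sq_flip[OF s] 4(2,1)] cls_eq by simp
  qed
qed

sublocale paths: transport X "St b" Tr for b
proof
  show "Tr u' C \<in> St b u'" if "adj u u'" "C \<in> St b u" for u u' C using that by (rule Tr_in)
  show "Tr u (Tr u' C) = C" if "adj u u'" "C \<in> St b u" for u u' C using that by (rule Tr_inv)
  show "Tr c (Tr a C) = Tr c (Tr d C)" if "sq u a c d" "C \<in> St b u" for u a c d C using that by (rule Tr_sq)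
qed

text \<open>Along a reduced path no transport can cancel an edge, so the section picks up the path
  itself. As the section does not depend on the path, this is the source of uniqueness.\<close>

lemma section_reduced:
  assumes g: "g b = cls [b]" "\<And>u u'. adj u u' \<Longrightarrow> g u \<in> St b u \<and> g u' = Tr u' (g u)"
    and p: "reduced (v # p)" "successively adj (v # p)" "last (v # p) = b"
  shows "g v = cls (v # p)"
  using p
proof (induction p arbitrary: v)
  case Nil then show ?case using g by simp
next
  case (Cons u p)
  have r: "reduced (u # p)" using Cons.prems(1) reduced_ConsD by blast
  then have gu: "g u = cls (u # p)" using Cons by (auto simp: successively_Cons)
  have "\<nexists>u' q. eqv (u # p) (u' # v # q)"
  proof
    assume "\<exists>u' q. eqv (u # p) (u' # v # q)"
    then obtain q where "eqv (u # p) (u # v # q)" using Tr_eqv_head by metis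
    then have "eqv (v # u # p) (v # u # v # q)" by (rule eqv_Cons)
    then show False using Cons.prems not_backtrack_reduced by blast
  qed
  then have "Tr v (g u) = cls (v # u # p)" using gu Tr_up by simp
  moreover have "adj u v" using Cons.prems(2) adj_sym by (auto simp: successively_Cons)
  ultimately show ?case using g(2) by simp
qed

end

section \<open>Simple connectivity of the realization\<close>

context cubes
begin

abbreviation R :: "('a \<Rightarrow> real) topology" where "R \<equiv> realization X"

text \<open>A point has a positive multilinear coordinate at \<open>v\<close> exactly if the open
  cell containing it has \<open>v\<close> as a vertex, so this is the open star of
  \<open>v\<close>.\<close>

definition star :: "'a \<Rightarrow> ('a \<Rightarrow> real) set" where
  "star v = {q \<in> topspace R. q v > 0}"

lemma closed_cell_support: "q \<in> closed_cell X Q \<Longrightarrow> q w \<noteq> 0 \<Longrightarrow> w \<in> Q"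
  using chart_image unfolding closed_cell_def cube_point_def by (fastforce split: if_splits)

lemma closed_cell_pos:
  assumes "q \<in> closed_cell X Q" shows "\<exists>w\<in>Q. q w > 0"
proof -
  obtain n \<phi> t where q: "q = cube_point n \<phi> t" "cube_chart X n \<phi> Q" "\<forall>i<n. t i \<in> {0..1}"
    using assms unfolding closed_cell_def by blast
  \<comment> \<open>At this corner each factor of the product is some \<open>t i > 0\<close> or
    equals 1.\<close>
  define A where "A = {i. i < n \<and> t i > 0}"
  have A: "A \<subseteq> {..<n}" by (auto simp: A_def)
  have "inv_into (Pow {..<n}) \<phi> (\<phi> A) = A"
    using inv_into_f_f[OF chart_inj[OF q(2)]] A by blast
  then have "q (\<phi> A) = (\<Prod>i<n. if i \<in> A then t i else 1 - t i)"
    using A by (simp add: q(1) cube_point_def)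
  also have "\<dots> > 0" by (rule prod_pos) (use q(3) in \<open>force simp: A_def\<close>)
  finally show ?thesis using chart_mem[OF q(2) A] by blast
qed

lemma topspace_R: "topspace R = (\<Union>Q\<in>X. closed_cell X Q)"
  by (rule topspace_realization)

text \<open>The support of a point lies in one cube, so stars with a common point have their centres
  in a common cube.\<close>

lemma common_cube:
  assumes "q \<in> topspace R" obtains Q where "Q \<in> X" "\<And>w. q \<in> star w \<Longrightarrow> w \<in> Q"
proof -
  obtain Q where "Q \<in> X" "q \<in> closed_cell X Q" using assms topspace_R by blast
  with that show ?thesis using closed_cell_support unfolding star_def by fastforce
qed

lemma star_cover: assumes "q \<in> topspace R" shows "\<exists>v\<in>V. q \<in> star v"
proof -
  obtain Q where "Q \<in> X" "q \<in> closed_cell X Q" using assms topspace_R by blast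
  then show ?thesis using closed_cell_pos[of q Q] assms cube_subset_V unfolding star_def by blast
qed

lemma openin_star: "openin R (star v)"
  unfolding openin_realization
proof (intro conjI ballI)
  show "star v \<subseteq> (\<Union>Q\<in>X. closed_cell X Q)" using topspace_R unfolding star_def by blast
  fix Q assume Q: "Q \<in> X"
  have "continuous_on UNIV (\<lambda>q::'a \<Rightarrow> real. q v)" by (rule continuous_on_product_coordinates)
  then have "open {q::'a \<Rightarrow> real. q v > 0}" by (intro open_Collect_less continuous_intros) auto
  moreover have "star v \<inter> closed_cell X Q = closed_cell X Q \<inter> {q. q v > 0}"
    using Q topspace_R unfolding star_def by blast
  ultimately show "openin (top_of_set (closed_cell X Q)) (star v \<inter> closed_cell X Q)"
    by (simp add: openin_open_Int)
qed

lemma star_nonempty: assumes "v \<in> V" shows "star v \<noteq> {}"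
proof -
  have vX: "{v} \<in> X" using vertex_cube assms .
  then obtain n \<phi> where ch: "cube_chart X n \<phi> {v}" by (rule cube_cases)
  have q: "cube_point n \<phi> (\<lambda>_. 0) \<in> closed_cell X {v}"
    unfolding closed_cell_def using ch by force
  then have "cube_point n \<phi> (\<lambda>_. 0) v > 0" using closed_cell_pos by blast
  then show ?thesis using q vX topspace_R unfolding star_def by blast
qed

lemma cube_connected:
  assumes P: "\<And>u w. adj u w \<Longrightarrow> P u \<Longrightarrow> P w" and "Q \<in> X" "v \<in> Q" "w \<in> Q" "P v"
  shows "P w"
proof -
  obtain n \<phi> where ch: "cube_chart X n \<phi> Q" using assms(2) by (rule cube_cases)
  have *: "P (\<phi> A) \<longleftrightarrow> P (\<phi> {})" if "A \<subseteq> {..<n}" for A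
  proof -
    have "finite A" using that finite_subset by blast
    then show ?thesis using that
    proof (induction A rule: finite_induct)
      case (insert i A)
      have "adj (\<phi> A) (\<phi> (insert i A))"
        using adj_chart_flip[OF ch, of A i] insert by (simp add: flip_def)
      then show ?case using insert P adj_sym by blast
    qed simp
  qed
  obtain A B where "A \<subseteq> {..<n}" "v = \<phi> A" "B \<subseteq> {..<n}" "w = \<phi> B"
    using chart_ex[OF ch assms(3)] chart_ex[OF ch assms(4)] by metis
  then show ?thesis using *[of A] *[of B] assms(5) by simp
qed

text \<open>If \<open>P\<close> failed somewhere, the stars of the vertices with \<open>P\<close>
  and of those without it would disconnect the realization: overlapping stars have centres in one
  cube, where \<open>P\<close> spreads along edges.\<close>

lemma adj_connected:
  assumes conn: "connected_space R" and P: "\<And>u w. adj u w \<Longrightarrow> P u \<Longrightarrow> P w"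
    and "v \<in> V" "w \<in> V" "P v"
  shows "P w"
proof (rule ccontr)
  assume "\<not> P w"
  define E where "E = (\<Union>v\<in>{v\<in>V. P v}. star v)"
  define F where "F = (\<Union>v\<in>{v\<in>V. \<not> P v}. star v)"
  have "openin R E" "openin R F" unfolding E_def F_def using openin_star by blast+
  moreover have "topspace R \<subseteq> E \<union> F" using star_cover unfolding E_def F_def by blast
  moreover have "E \<inter> F = {}"
  proof (rule ccontr)
    assume "E \<inter> F \<noteq> {}"
    then obtain q a b where q: "q \<in> star a" "P a" "q \<in> star b" "\<not> P b" unfolding E_def F_def by blast
    then have "q \<in> topspace R" unfolding star_def by blast
    then obtain Q where "Q \<in> X" "a \<in> Q" "b \<in> Q" using common_cube q by metis
    then show False using cube_connected[of P Q a b] P q by blast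
  qed
  moreover have "E \<noteq> {}" "F \<noteq> {}"
    using star_nonempty assms(3-5) \<open>\<not> P w\<close> unfolding E_def F_def by blast+
  ultimately show False using conn unfolding connected_space_def by blast
qed

lemma edge_point:
  assumes "adj v w" "0 \<le> \<theta>" "\<theta> \<le> 1"
  shows "(\<lambda>x. if x = v then 1 - \<theta> else if x = w then \<theta> else 0) \<in> closed_cell X {v, w}" (is "?q \<in> _")
proof -
  have e: "{v, w} \<in> X" "card {v, w} = 2" using assms(1) by (auto simp: adj_def edges_def)
  obtain n \<phi> where ch: "cube_chart X n \<phi> {v, w}" using e(1) by (rule cube_cases)
  have "(2::nat) ^ n = 2 ^ 1" using chart_card[OF ch] e(2) by simp
  then have n: "n = 1" by (rule two_power_inject)
  have Pow1: "Pow {..<Suc 0} = {{}, {0}}" by (auto simp: lessThan_Suc)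
  have im: "\<phi> ` {{}, {0}} = {v, w}" and inj: "inj_on \<phi> {{}, {0}}"
    using chart_image[OF ch] chart_inj[OF ch] n Pow1 by simp_all
  have i0: "inv_into {{}, {0}} \<phi> (\<phi> {}) = {}" "inv_into {{}, {0}} \<phi> (\<phi> {0}) = {0}"
    using inv_into_f_f[OF inj] by blast+
  \<comment> \<open>The chart may run through the edge in either direction.\<close>
  define t where "t = (if \<phi> {} = v then \<theta> else 1 - \<theta>)"
  have ne: "\<phi> {} \<noteq> \<phi> {0}" using inj by (auto simp: inj_on_def)
  then have vw: "\<phi> {} = v \<and> \<phi> {0} = w \<or> \<phi> {} = w \<and> \<phi> {0} = v"
    using im by (simp add: doubleton_eq_iff)
  have "?q x = cube_point n \<phi> (\<lambda>_. t) x" for x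
  proof (cases "x \<in> {v, w}")
    case True
    then show ?thesis using vw ne i0 im adj_neq[OF assms(1)] unfolding n cube_point_def t_def One_nat_def Pow1
      by auto
  next
    case False
    then show ?thesis using im unfolding n cube_point_def One_nat_def Pow1 by simp
  qed
  then have "?q = cube_point n \<phi> (\<lambda>_. t)" by blast
  moreover have "\<forall>i<n. t \<in> {0..1}" using assms by (auto simp: t_def)
  ultimately show ?thesis unfolding closed_cell_def using ch by blast
qed

text \<open>The closed edge path through the vertices \<open>\<gamma> 0, \<dots>, \<gamma> n\<close>, written as a sum of hat functions
  so that it is visibly continuous in each coordinate.\<close>

definition edge_path :: "nat \<Rightarrow> (nat \<Rightarrow> 'a) \<Rightarrow> real \<Rightarrow> 'a \<Rightarrow> real" where
  "edge_path n \<gamma> t x = (\<Sum>k\<le>n. if \<gamma> k = x then max 0 (1 - \<bar>real n * t - real k\<bar>) else 0)"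

lemma edge_path_eq:
  assumes a: "adj (\<gamma> k) (\<gamma> (Suc k))" and k: "k < n" "real k \<le> real n * t" "real n * t \<le> real k + 1"
  shows "edge_path n \<gamma> t = (\<lambda>x. if x = \<gamma> k then 1 - (real n * t - real k)
    else if x = \<gamma> (Suc k) then real n * t - real k else 0)"
proof
  fix x
  let ?f = "\<lambda>j. if \<gamma> j = x then max 0 (1 - \<bar>real n * t - real j\<bar>) else 0"
  have z: "?f j = 0" if "j \<noteq> k" "j \<noteq> Suc k" for j
  proof -
    have "real j \<le> real k - 1 \<or> real j \<ge> real k + 2"
      using that by (cases "j < k") auto
    then show ?thesis using k by auto
  qed
  have "edge_path n \<gamma> t x = sum ?f {k, Suc k}"
    unfolding edge_path_def by (rule sum.mono_neutral_right) (use k z in auto)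
  also have "\<dots> = ?f k + ?f (Suc k)" by simp
  also have "\<dots> = (if x = \<gamma> k then 1 - (real n * t - real k)
    else if x = \<gamma> (Suc k) then real n * t - real k else 0)"
    using k adj_neq[OF a] by auto
  finally show "edge_path n \<gamma> t x = (if x = \<gamma> k then 1 - (real n * t - real k)
    else if x = \<gamma> (Suc k) then real n * t - real k else 0)" .
qed

lemma edge_path_cell:
  assumes "adj (\<gamma> k) (\<gamma> (Suc k))" "k < n" "real k \<le> real n * t" "real n * t \<le> real k + 1"
  shows "edge_path n \<gamma> t \<in> closed_cell X {\<gamma> k, \<gamma> (Suc k)}"
  unfolding edge_path_eq[OF assms] using edge_point[OF assms(1), of "real n * t - real k"] assms by simp

text \<open>The realization has the weak topology, so coordinatewise continuity alone is not enough.
  It is used on each of \<open>n\<close> parameter intervals, whose image lies in one closed edge,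
  and the finitely many closed preimages are united.\<close>

lemma edge_path_pathin:
  assumes n: "n > 0" and a: "\<And>k. k < n \<Longrightarrow> adj (\<gamma> k) (\<gamma> (Suc k))"
  shows "pathin R (edge_path n \<gamma>)"
proof -
  let ?p = "edge_path n \<gamma>"
  define I where "I k = {real k / real n .. (real k + 1) / real n}" for k
  have I_iff: "t \<in> I k \<longleftrightarrow> real k \<le> real n * t \<and> real n * t \<le> real k + 1" for t k
    using n by (auto simp: I_def field_simps)
  have cover: "\<exists>k<n. t \<in> I k" if "t \<in> {0..1}" for t :: real
  proof (cases "t = 1")
    case True
    have "t \<in> I (n - 1)" using True n by (simp add: I_iff of_nat_diff)
    then show ?thesis using n by (intro exI[of _ "n - 1"]) simp
  next
    case False
    define k where "k = nat \<lfloor>real n * t\<rfloor>"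
    have "0 \<le> real n * t" "real n * t < real n" using that False n by auto
    then have "k < n" "real k \<le> real n * t" "real n * t \<le> real k + 1"
      unfolding k_def by linarith+
    then show ?thesis using I_iff by blast
  qed
  have I01: "I k \<subseteq> {0..1}" if "k < n" for k
    using that n by (auto simp: I_def field_simps)
  have e: "{\<gamma> k, \<gamma> (Suc k)} \<in> X" if "k < n" for k
    using a[OF that] by (auto simp: adj_def edges_def)
  have cell: "?p t \<in> closed_cell X {\<gamma> k, \<gamma> (Suc k)}" if "k < n" "t \<in> I k" for k t
    using edge_path_cell[of \<gamma> k n t, OF a[OF that(1)] that(1)] that(2) I_iff by blast
  have cont: "continuous_on S ?p" for S
  proof (rule continuous_on_coordinatewise_then_product)
    fix x
    have "continuous_on S (\<lambda>t. if \<gamma> k = x then max 0 (1 - \<bar>real n * t - real k\<bar>) else 0)" for k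
      by (cases "\<gamma> k = x") (auto intro!: continuous_intros)
    then show "continuous_on S (\<lambda>t. ?p t x)"
      unfolding edge_path_def by (intro continuous_on_sum) auto
  qed
  show ?thesis
    unfolding pathin_def continuous_map_closedin
  proof (intro conjI allI impI)
    show "?p \<in> topspace (top_of_set {0..1}) \<rightarrow> topspace R"
    proof
      fix t :: real assume "t \<in> topspace (top_of_set {0..1})"
      then obtain k where "k < n" "t \<in> I k" using cover by auto
      then show "?p t \<in> topspace R" using cell e topspace_R by blast
    qed
    fix C assume C: "closedin R C"
    have "closed {t \<in> I k. ?p t \<in> C}" if k: "k < n" for k
    proof -
      let ?c = "closed_cell X {\<gamma> k, \<gamma> (Suc k)}"
      have "openin (top_of_set ?c) ((topspace R - C) \<inter> ?c)"
        using C e[OF k] unfolding closedin_def openin_realization by blast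
      moreover have "?c \<subseteq> topspace R" using e[OF k] topspace_R by blast
      then have "?c - C \<inter> ?c = (topspace R - C) \<inter> ?c" by blast
      ultimately have "closedin (top_of_set ?c) (C \<inter> ?c)" by (simp add: closedin_def)
      then have "closedin (top_of_set (I k)) (I k \<inter> ?p -` (C \<inter> ?c))"
        using cont[of "I k"] cell[OF k] by (intro continuous_closedin_preimage_gen) auto
      moreover have "I k \<inter> ?p -` (C \<inter> ?c) = {t \<in> I k. ?p t \<in> C}" using cell[OF k] by blast
      moreover have "closed (I k)" by (simp add: I_def)
      ultimately show ?thesis using closedin_closed_trans by metis
    qed
    then have "closed (\<Union>k<n. {t \<in> I k. ?p t \<in> C})" by (intro closed_UN) auto
    moreover have "(\<Union>k<n. {t \<in> I k. ?p t \<in> C}) = {t \<in> topspace (top_of_set {0..1}). ?p t \<in> C}"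
    proof (intro equalityI subsetI)
      fix t assume "t \<in> (\<Union>k<n. {t \<in> I k. ?p t \<in> C})"
      then obtain k where "k < n" "t \<in> I k" "?p t \<in> C" by blast
      then show "t \<in> {t \<in> topspace (top_of_set {0..1}). ?p t \<in> C}" using I01[of k] by (auto simp: subset_iff)
    next
      fix t assume "t \<in> {t \<in> topspace (top_of_set {0..1}). ?p t \<in> C}"
      then show "t \<in> (\<Union>k<n. {t \<in> I k. ?p t \<in> C})" using cover[of t] by auto
    qed
    ultimately show "closedin (top_of_set {0..1}) {t \<in> topspace (top_of_set {0..1}). ?p t \<in> C}"
      by (metis (no_types, lifting) closed_subset mem_Collect_eq subsetI topspace_euclidean_subtopology)
  qed
qed

text \<open>\<open>e\<close> is a Lebesgue number for the cover of the square by the preimages of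
  the open stars.\<close>

lemma lebesgue_grid:
  assumes h: "continuous_map (prod_topology (top_of_set {0..1::real}) (top_of_set {0..1::real})) R h"
  obtains e where "e > 0" "\<And>x. x \<in> {0..1} \<times> {0..1} \<Longrightarrow>
     \<exists>v\<in>V. \<forall>y\<in>{0..1} \<times> {0..1}. dist x y < e \<longrightarrow> h y \<in> star v"
proof -
  let ?S = "{0..1::real} \<times> {0..1::real}"
  have hS: "continuous_map (top_of_set ?S) R h"
    using h by (simp add: prod_topology_subtopology_eu)
  define G where "G = {U. open U \<and> (\<exists>v\<in>V. {z \<in> ?S. h z \<in> star v} = ?S \<inter> U)}"
  have "compact ?S" by (intro compact_Times) auto
  moreover have "?S \<subseteq> \<Union>G"
  proof
    fix z assume z: "z \<in> ?S"
    then have "h z \<in> topspace R" using hS continuous_map_image_subset_topspace by fastforce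
    then obtain v where v: "v \<in> V" "h z \<in> star v" using star_cover by blast
    have "openin (top_of_set ?S) {z \<in> topspace (top_of_set ?S). h z \<in> star v}"
      using openin_continuous_map_preimage[OF hS openin_star] .
    then obtain U where "open U" "{z \<in> ?S. h z \<in> star v} = ?S \<inter> U" by (auto simp: openin_open)
    then have "U \<in> G" "z \<in> U" using v z unfolding G_def by blast+
    then show "z \<in> \<Union>G" by blast
  qed
  moreover have "\<And>U. U \<in> G \<Longrightarrow> open U" unfolding G_def by blast
  ultimately obtain e where e: "e > 0" "\<forall>x\<in>?S. \<exists>U\<in>G. ball x e \<subseteq> U"
    by (metis Heine_Borel_lemma)
  show ?thesis
  proof (rule that[OF e(1)])
    fix x assume "x \<in> ?S"
    then obtain U v where U: "ball x e \<subseteq> U" "v \<in> V" "{z \<in> ?S. h z \<in> star v} = ?S \<inter> U"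
      using e(2) G_def by blast
    show "\<exists>v\<in>V. \<forall>y\<in>?S. dist x y < e \<longrightarrow> h y \<in> star v"
    proof (intro bexI[OF _ U(2)] ballI impI)
      fix y assume y: "y \<in> ?S" "dist x y < e"
      then have "y \<in> ?S \<inter> U" using U(1) by (auto simp only: subset_iff mem_ball Int_iff)
      then have "y \<in> {z \<in> ?S. h z \<in> star v}" by (simp only: U(3))
      then show "h y \<in> star v" by (simp only: mem_Collect_eq)
    qed
  qed
qed

end

context transport
begin

text \<open>A contraction of the edge loop is cut into a fine grid, and each cell is labelled by a
  vertex whose star contains the images of its four corners. Labels of cells with a common corner
  lie in a common cube. The loop itself is put below as an extra row, and the labels of the last row
  lie in one cube because the homotopy ends at a point; so \<open>grid_monodromy\<close>
  applies.\<close>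

lemma loop_trivial:
  assumes sc: "simply_connected_space R"
    and xs: "xs \<noteq> []" "successively adj (b # xs)" "last xs = b" and s0: "s0 \<in> S b"
  shows "fold T xs s0 = s0"
proof -
  define n where "n = length xs"
  define \<gamma> where "\<gamma> k = (b # xs) ! k" for k
  have n: "n > 0" using xs by (simp add: n_def)
  have a: "adj (\<gamma> k) (\<gamma> (Suc k))" if "k < n" for k
    using xs(2) that unfolding \<gamma>_def n_def successively_conv_nth by (metis Suc_less_eq length_Cons)
  have \<gamma>0: "\<gamma> 0 = b" "\<gamma> n = b"
    using xs n by (simp_all add: \<gamma>_def n_def nth_Cons' last_conv_nth)
  let ?p = "edge_path n \<gamma>"
  have p: "pathin R ?p" by (rule edge_path_pathin[OF n]) (rule a)
  have p01: "?p 1 = ?p 0"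
  proof -
    have "?p 0 = (\<lambda>x. if x = b then 1 else 0)"
      using edge_path_eq[of \<gamma> 0 n 0, OF a[OF n] n] \<gamma>0 by (auto simp: fun_eq_iff)
    moreover have "?p 1 = (\<lambda>x. if x = b then 1 else 0)"
    proof -
      have n1: "n - 1 < n" "Suc (n - 1) = n" "real (n - 1) = real n - 1" using n by (auto simp: of_nat_diff)
      show ?thesis
        using edge_path_eq[of \<gamma> "n - 1" n 1, OF a[OF n1(1)] n1(1)] n1 \<gamma>0 adj_neq[OF a[OF n1(1)]]
        by (auto simp: fun_eq_iff)
    qed
    ultimately show ?thesis by simp
  qed
  obtain c where "homotopic_with (\<lambda>r. r 1 = r 0) (top_of_set {0..1}) R ?p (\<lambda>_. c)"
    using sc p p01 unfolding simply_connected_space_def by blast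
  then obtain h where h: "continuous_map (prod_topology (top_of_set {0..1::real}) (top_of_set {0..1})) R h"
      "\<And>x. h (0, x) = ?p x" "\<And>x. h (1, x) = c" "\<And>t. t \<in> {0..1} \<Longrightarrow> h (t, 1) = h (t, 0)"
    unfolding homotopic_with_def by auto
  obtain e where e: "e > 0" "\<And>x. x \<in> {0..1} \<times> {0..1} \<Longrightarrow>
     \<exists>v\<in>V. \<forall>y\<in>{0..1} \<times> {0..1}. dist x y < e \<longrightarrow> h y \<in> star v"
    by (rule lebesgue_grid[OF h(1)]) blast
  \<comment> \<open>Corners of a cell of side \<open>1 / N\<close> are within \<open>2 / N\<close>
    of each other; \<open>N\<close> will be a multiple of \<open>n\<close>, so that every edge of
    the loop is cut into \<open>M\<close> equal pieces.\<close>
  obtain M0 :: nat where M0: "real M0 > 2 / e" using reals_Archimedean2 by blast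
  define M where "M = Suc M0"
  define N where "N = n * M"
  have M: "M > 0" and N: "N > 0" using n by (auto simp: M_def N_def)
  have "real M > 2 / e" using M0 by (simp add: M_def)
  moreover have "real N \<ge> real M" using n M by (simp add: N_def)
  ultimately have "real N > 2 / e" by linarith
  then have Ne: "2 / real N < e" using e(1) N by (simp add: field_simps)
  have in01: "real i / real N \<in> {0..1}" if "i \<le> N" for i using that N by (auto simp: field_simps)
  have "\<exists>v\<in>V. \<forall>y\<in>{(real i / N, real j / N), (real i / N, real (Suc j) / N),
      (real (Suc i) / N, real j / N), (real (Suc i) / N, real (Suc j) / N)}. h y \<in> star v"
    if ij: "i < N" "j < N" for i j
  proof -
    have x: "(real i / N, real j / N) \<in> {0..1} \<times> {0..1}" using in01 ij by simp
    obtain v where v: "v \<in> V" "\<And>y. y \<in> {0..1} \<times> {0..1} \<Longrightarrow> dist (real i / N, real j / N) y < e \<Longrightarrow> h y \<in> star v"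
      using e(2)[OF x] by blast
    have dst: "dist (real i / N, real j / N) (real i' / N, real j' / N) < e"
      if "i' = i \<or> i' = Suc i" "j' = j \<or> j' = Suc j" for i' j'
    proof -
      have "\<bar>real i / N - real i' / N\<bar> \<le> 1 / N" "\<bar>real j / N - real j' / N\<bar> \<le> 1 / N"
        using that by (auto simp: diff_divide_distrib[symmetric])
      then have "dist (real i / N) (real i' / N) + dist (real j / N) (real j' / N) \<le> 2 / N"
        by (simp add: dist_real_def)
      moreover have "dist (real i / N, real j / N) (real i' / N, real j' / N)
        \<le> dist (real i / N) (real i' / N) + dist (real j / N) (real j' / N)"
        unfolding dist_Pair_Pair by (rule sqrt_sum_squares_le_sum) auto
      ultimately show ?thesis using Ne by linarith
    qed
    have hv: "h (real i' / N, real j' / N) \<in> star v" if "i' = i \<or> i' = Suc i" "j' = j \<or> j' = Suc j" for i' j'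
    proof -
      have "i' \<le> N" "j' \<le> N" using that ij by auto
      then show ?thesis using v(2)[OF _ dst[OF that]] in01 by blast
    qed
    show ?thesis
      by (rule bexI[OF _ v(1)]) (use hv[of i j] hv[of i "Suc j"] hv[of "Suc i" j] hv[of "Suc i" "Suc j"]
          in \<open>simp del: of_nat_Suc\<close>)
  qed
  then obtain W where W: "\<And>i j. i < N \<Longrightarrow> j < N \<Longrightarrow> W i j \<in> V \<and>
      h (real i / N, real j / N) \<in> star (W i j) \<and> h (real i / N, real (Suc j) / N) \<in> star (W i j) \<and>
      h (real (Suc i) / N, real j / N) \<in> star (W i j) \<and> h (real (Suc i) / N, real (Suc j) / N) \<in> star (W i j)"
    by simp metis
  \<comment> \<open>The homotopy runs through loops, so its two lateral sides agree and columns may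
    be taken modulo \<open>N\<close>.\<close>
  have wrap: "h (real i / N, real (Suc j mod N) / N) = h (real i / N, real (Suc j) / N)"
    if "i \<le> N" "j < N" for i j
  proof (cases "Suc j = N")
    case True then show ?thesis using h(4)[OF in01[OF that(1)]] N by simp
  next
    case False then show ?thesis using that by simp
  qed
  have Wr: "h (real i / N, real (Suc j) / N) \<in> star (W i (Suc j mod N))"
    "h (real (Suc i) / N, real (Suc j) / N) \<in> star (W i (Suc j mod N))"
    if "i < N" "j < N" for i j
    using W[OF that(1), of "Suc j mod N"] N wrap[of i j] wrap[of "Suc i" j] that by simp_all
  have htop: "h (real i / N, real j / N) \<in> topspace R" if "i \<le> N" "j \<le> N" for i j
    using continuous_map_image_subset_topspace[OF h(1)] in01[OF that(1)] in01[OF that(2)] by auto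
  \<comment> \<open>Row 0 carries the vertices of the loop, row \<open>i + 1\<close> the labels of
    the cells in row \<open>i\<close>.\<close>
  define w where "w i j = (if i = 0 then \<gamma> (j div M) else W (i - 1) (j mod N))" for i j
  define s where "s j = fold T (take (j div M) xs) s0" for j
  have sm: "s j \<in> S (\<gamma> (j div M))" if "j \<le> N" for j
  proof -
    have k: "j div M \<le> n" using that by (simp add: N_def M div_le_mono less_eq_div_iff_mult_less_eq) (metis M div_le_mono nonzero_mult_div_cancel_right not_gr_zero)
    have sp: "successively adj (b # take (j div M) xs)"
      using xs(2) by (metis append_take_drop_id append_Cons successively_append_iff)
    have "last (b # take (j div M) xs) = \<gamma> (j div M)"
      using k by (cases "j div M") (auto simp: \<gamma>_def n_def last_conv_nth min_def)
    then show ?thesis using fold_T_mem[OF sp s0] by (simp add: s_def)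
  qed
  have divM: "j div M < n" "Suc j div M = j div M \<or> Suc j div M = Suc (j div M)" if "j < N" for j
    using that M by (auto simp: N_def less_mult_imp_div_less div_Suc)
  have "s N = s 0"
  proof (rule grid_monodromy[of N N w s])
    show "\<exists>Q\<in>X. {w i j, w i (Suc j), w (Suc i) j, w (Suc i) (Suc j)} \<subseteq> Q" if ij: "i < N" "j < N" for i j
    proof (cases i)
      case 0
      define k where "k = j div M"
      let ?e = "{\<gamma> k, \<gamma> (Suc k)}"
      have k: "k < n" using divM(1)[OF ij(2)] by (simp add: k_def)
      have "k * M \<le> j" "j < (k + 1) * M" using M by (simp_all add: k_def dividend_less_div_times add.commute)
      then have kj: "real k * real M \<le> real j" "real (Suc j) \<le> (real k + 1) * real M"
        by (metis of_nat_le_iff of_nat_mult, metis Suc_leI of_nat_1 of_nat_add of_nat_le_iff of_nat_mult)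
      have "real n * (real (Suc j) / N) = real (Suc j) / real M" using n by (simp add: N_def)
      moreover have "real k \<le> real (Suc j) / real M" "real (Suc j) / real M \<le> real k + 1"
        using kj M by (simp_all add: field_simps)
      ultimately have "real k \<le> real n * (real (Suc j) / N)" "real n * (real (Suc j) / N) \<le> real k + 1"
        by (simp_all only:)
      then have pc: "?p (real (Suc j) / N) \<in> closed_cell X ?e" using edge_path_cell[of \<gamma> k n] a[OF k] k by blast
      have sup: "v \<in> ?e" if "h (0, real (Suc j) / N) \<in> star v" for v
        using that closed_cell_support[of "?p (real (Suc j) / N)" ?e v, OF pc] unfolding star_def h(2) by simp
      have "W 0 j \<in> ?e" "W 0 (Suc j mod N) \<in> ?e"
        using sup W[OF N ij(2)] Wr(1)[OF N ij(2)] by simp_all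
      moreover have "\<gamma> (j div M) \<in> ?e" "\<gamma> (Suc j div M) \<in> ?e" using divM(2)[OF ij(2)] by (auto simp: k_def)
      moreover have "?e \<in> X" using a[OF k] by (simp add: adj_def edges_def)
      ultimately show ?thesis using 0 ij by (intro bexI[of _ ?e]) (simp_all add: w_def)
    next
      case (Suc i')
      let ?q = "h (real i / N, real (Suc j) / N)"
      obtain Q where Q: "Q \<in> X" "\<And>v. ?q \<in> star v \<Longrightarrow> v \<in> Q"
        using common_cube[OF htop[of i "Suc j"]] ij by auto
      have "W i' j \<in> Q" "W i' (Suc j mod N) \<in> Q" "W i j \<in> Q" "W i (Suc j mod N) \<in> Q"
        using Q(2) W[of i' j] W[OF ij] Wr(2)[of i' j] Wr(1)[OF ij] ij Suc by auto
      then show ?thesis using Q(1) ij Suc by (intro bexI[of _ Q]) (simp_all add: w_def)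
    qed
    show "w i N = w i 0" if "i \<le> N" for i using \<gamma>0 M by (simp add: w_def N_def)
    show "\<exists>Q\<in>X. \<forall>j\<le>N. w N j \<in> Q"
    proof -
      have "h (real N / N, real 0 / N) \<in> topspace R" by (rule htop) auto
      then have "c \<in> topspace R" using h(3) N by simp
      then obtain Q where Q: "Q \<in> X" "\<And>v. c \<in> star v \<Longrightarrow> v \<in> Q" using common_cube by metis
      have "w N j \<in> Q" for j
      proof -
        have "h (real (Suc (N - 1)) / N, real (j mod N) / N) \<in> star (W (N - 1) (j mod N))"
          using W[of "N - 1" "j mod N"] N by simp
        then have "c \<in> star (W (N - 1) (j mod N))" using N h(3) by simp
        then show ?thesis using Q N by (simp add: w_def)
      qed
      then show ?thesis using Q by blast
    qed
    show "rel (w 0 j) (s j) (w 0 (Suc j)) (s (Suc j))" if j: "j < N" for j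
    proof (cases "Suc j div M = j div M")
      case True
      then show ?thesis using rel_refl[OF adj_V(1)[OF a[OF divM(1)[OF j]]]] sm[of j] j by (simp add: w_def s_def)
    next
      case False
      then have k: "Suc j div M = Suc (j div M)" using divM(2)[OF j] by simp
      have "take (Suc (j div M)) xs = take (j div M) xs @ [\<gamma> (Suc (j div M))]"
        using divM(1)[OF j] by (simp add: take_Suc_conv_app_nth \<gamma>_def n_def)
      then have "s (Suc j) = T (\<gamma> (Suc (j div M))) (s j)" using k by (simp add: s_def)
      then show ?thesis using rel_adj[OF a[OF divM(1)[OF j]] sm[of j]] j k by (simp add: w_def)
    qed
  qed (use N in simp)
  moreover have "N div M = n" using M by (simp add: N_def)
  ultimately show ?thesis by (simp add: s_def n_def)
qed

end

section \<open>Combinatorial distance and halfspaces\<close>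

context cat0
begin

lemma simply_connected: "simply_connected_space R"
  using cat0 by (simp add: cat0_cube_complex_def)

lemma connected: "connected_space R"
  using simply_connected path_connected_imp_connected_space by (auto simp: simply_connected_space_def)

lemma walk_ex:
  assumes "b \<in> V" "v \<in> V" shows "\<exists>xs. successively adj (b # xs) \<and> last (b # xs) = v"
proof (rule adj_connected[OF connected _ assms(1,2)])
  show "\<exists>xs. successively adj (b # xs) \<and> last (b # xs) = b" by (rule exI[of _ "[]"]) simp
  fix u w assume uw: "adj u w" "\<exists>xs. successively adj (b # xs) \<and> last (b # xs) = u"
  then obtain xs where xs: "successively adj (b # xs)" "last (b # xs) = u" by blast
  have "successively adj ((b # xs) @ [w])"
    using xs uw(1) successively_append_iff[of adj "b # xs" "[w]"] by simp
  then show "\<exists>xs. successively adj (b # xs) \<and> last (b # xs) = w"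
    by (intro exI[of _ "xs @ [w]"]) simp
qed

text \<open>By trivial monodromy the class of the constant path at \<open>b\<close> extends to a
  global section; its value at \<open>v\<close> is the class of each of the two paths.\<close>

lemma reduced_eqv_unique:
  assumes "reduced (v # p)" "successively adj (v # p)" "last (v # p) = b"
    and "reduced (v # q)" "successively adj (v # q)" "last (v # q) = b" and "b \<in> V"
  shows "eqv (v # p) (v # q)"
proof -
  have "reduced [b]"
    unfolding reduced_def backtrack_def using eqv_length by fastforce
  then have "cls [b] \<in> St b b" by (intro St_I) auto
  moreover have "fold Tr xs s = s"
    if "xs \<noteq> []" "successively adj (b # xs)" "last xs = b" "s \<in> St b b" for xs s
    using that by (rule paths.loop_trivial[OF simply_connected])
  ultimately obtain g where "g b = cls [b]" "\<And>u u'. adj u u' \<Longrightarrow> g u \<in> St b u \<and> g u' = Tr u' (g u)"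
    using paths.global_section[OF walk_ex[OF assms(7)]] by metis
  then show ?thesis using section_reduced[of g b v] assms cls_eq by metis
qed

section \<open>The combinatorial metric\<close>

definition walk :: "'a \<Rightarrow> 'a \<Rightarrow> 'a list \<Rightarrow> bool" where
  "walk b v p \<longleftrightarrow> successively adj p \<and> p \<noteq> [] \<and> hd p = v \<and> last p = b"

definition d :: "'a \<Rightarrow> 'a \<Rightarrow> nat" where
  "d b v = (LEAST n. \<exists>p. walk b v p \<and> length p = Suc n)"

lemma walk_rev: "walk b v p \<Longrightarrow> walk v b (rev p)"
  unfolding walk_def using adj_sym by (auto simp: hd_rev last_rev intro: successively_mono)

lemma walk_exists: assumes "b \<in> V" "v \<in> V" shows "\<exists>p. walk b v p"
  using walk_ex[OF assms(2,1)] unfolding walk_def by (metis list.distinct(1) list.sel(1))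

lemma geodesic:
  assumes "b \<in> V" "v \<in> V" obtains p where "walk b v p" "length p = Suc (d b v)"
proof -
  obtain p where p: "walk b v p" using walk_exists assms by blast
  then have "length p = Suc (length p - 1)" by (simp add: walk_def)
  then have "\<exists>n p. walk b v p \<and> length p = Suc n" using p by metis
  then have "\<exists>p. walk b v p \<and> length p = Suc (d b v)" unfolding d_def by (rule LeastI_ex)
  then show ?thesis using that by blast
qed

lemma d_le: "walk b v p \<Longrightarrow> d b v \<le> length p - 1"
  unfolding d_def by (rule Least_le) (auto simp: walk_def)

lemma d_less_length: "walk b v p \<Longrightarrow> d b v < length p"
  using d_le[of b v p] by (auto simp: walk_def) (metis Suc_pred le_imp_less_Suc length_greater_0_conv)

lemma d_sym: assumes "b \<in> V" "v \<in> V" shows "d b v = d v b"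
proof -
  have "d x y \<le> d y x" if xy: "x \<in> V" "y \<in> V" for x y
  proof -
    obtain p where "walk y x p" "length p = Suc (d y x)" using geodesic xy by blast
    then show ?thesis using d_le[OF walk_rev] by fastforce
  qed
  then show ?thesis using assms by (simp add: antisym)
qed

lemma geodesic_reduced:
  assumes "walk b v p" "length p = Suc (d b v)" shows "reduced p"
  unfolding reduced_def
proof (intro allI impI notI)
  fix q assume q: "eqv p q" and "backtrack q"
  then obtain l x y r where lr: "q = l @ x # y # x # r" unfolding backtrack_def by blast
  have "walk b v q"
    using assms(1) eqv_successively[OF q] eqv_hd[OF q] eqv_last[OF q] unfolding walk_def by auto
  then have "walk b v (l @ x # r)"
    unfolding walk_def lr by (cases l) (auto simp: successively_append_iff successively_Cons hd_append split: if_splits)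
  then have "d b v < length (l @ x # r)" by (rule d_less_length)
  then show False using assms(2) eqv_length[OF q] lr by simp
qed

text \<open>A geodesic with the same ends is reduced as well, hence equivalent, and swaps preserve
  length.\<close>

lemma reduced_walk_length:
  assumes "walk b v p" "reduced p" "b \<in> V" "v \<in> V" shows "length p = Suc (d b v)"
proof -
  obtain q where q: "walk b v q" "length q = Suc (d b v)" using geodesic assms by blast
  have "reduced q" using geodesic_reduced q by blast
  moreover obtain p' q' where "p = v # p'" "q = v # q'"
    using assms(1) q(1) unfolding walk_def by (metis list.collapse)
  ultimately have "eqv p q"
    using reduced_eqv_unique[of v p' b q'] assms q unfolding walk_def by simp
  then show ?thesis using eqv_length q by simp
qed

lemma walk_Cons: "walk b v p \<Longrightarrow> adj v w \<Longrightarrow> walk b w (w # p)"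
  unfolding walk_def by (auto simp: successively_Cons adj_sym)

lemma walk_tl: "walk b v (v # w # p) \<Longrightarrow> walk b w (w # p) \<and> adj v w"
  unfolding walk_def by (auto simp: successively_Cons)

lemma walk_eqv: "walk b v p \<Longrightarrow> eqv p q \<Longrightarrow> walk b v q"
  using eqv_successively[of p q] eqv_hd[of p q] eqv_last[of p q] unfolding walk_def by auto

lemma d_refl: "d v v = 0"
  using d_le[of v v "[v]"] by (simp add: walk_def)

lemma d_eq_0: assumes "b \<in> V" "v \<in> V" "d b v = 0" shows "b = v"
proof -
  obtain p where "walk b v p" "length p = Suc 0" using geodesic assms by metis
  then show ?thesis unfolding walk_def by (cases p) auto
qed

text \<open>Depending on whether a geodesic to \<open>u\<close> can be swapped so as to arrive
  through \<open>w\<close>, removing or adding the edge gives a reduced path to \<open>w\<close>. So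
  the 1-skeleton is bipartite.\<close>

lemma d_adj:
  assumes "b \<in> V" "adj u w" shows "d b w = Suc (d b u) \<or> d b u = Suc (d b w)"
proof -
  have V: "u \<in> V" "w \<in> V" using adj_V assms(2) by blast+
  obtain p where p: "walk b u p" "length p = Suc (d b u)" using geodesic assms V by blast
  obtain p' where p': "p = u # p'" using p unfolding walk_def by (metis list.collapse)
  have rp: "reduced p" using geodesic_reduced p by blast
  show ?thesis
  proof (cases "\<exists>q. eqv (u # p') (u # w # q)")
    case True
    then obtain q where q: "eqv p (u # w # q)" using p' by blast
    have "reduced (w # q)" using rp q reduced_eqv reduced_ConsD by blast
    moreover have "walk b w (w # q)" using walk_tl walk_eqv[OF p(1) q] by blast
    ultimately have "length (w # q) = Suc (d b w)" using reduced_walk_length assms V by blast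
    then show ?thesis using eqv_length[OF q] p by simp
  next
    case False
    then have "reduced (w # p)" using reduced_extend rp p' assms by blast
    moreover have "walk b w (w # p)" using walk_Cons p assms by blast
    ultimately have "length (w # p) = Suc (d b w)" using reduced_walk_length assms V by blast
    then show ?thesis using p by simp
  qed
qed

text \<open>Geodesics from \<open>b\<close> to \<open>u\<close> through \<open>w\<close> and through
  \<open>w'\<close> are equivalent by uniqueness, and splitting them at \<open>u\<close> gives the
  square.\<close>

lemma descending_square:
  assumes "b \<in> V" "adj u w" "adj u w'" "w \<noteq> w'" "d b u = Suc (d b w)" "d b u = Suc (d b w')"
  obtains c where "sq u w c w'" "d b w = Suc (d b c)"
proof -
  have V: "u \<in> V" "w \<in> V" "w' \<in> V" using adj_V assms by blast+
  obtain p where p: "walk b w p" "length p = Suc (d b w)" using geodesic assms V by blast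
  obtain p' where p': "walk b w' p'" "length p' = Suc (d b w')" using geodesic assms V by blast
  have W: "walk b u (u # p)" "walk b u (u # p')" using walk_Cons p p' assms adj_sym by blast+
  have R: "reduced (u # p)" "reduced (u # p')"
    using geodesic_reduced W p p' assms by (metis length_Cons)+
  have "eqv (u # p) (u # p')" using reduced_eqv_unique R W assms(1) unfolding walk_def by blast
  then have "split_eqv u p p'" by (rule eqv_Cons_split)
  moreover have "\<not> eqv p p'" using eqv_hd[of p p'] p(1) p'(1) assms(4) unfolding walk_def by auto
  ultimately obtain x x' c B where x: "sq u x c x'" "eqv p (x # c # B)" "eqv p' (x' # c # B)"
    unfolding split_eqv_def by blast
  have xw: "x = w" "x' = w'"
    using eqv_hd[OF x(2)] eqv_hd[OF x(3)] p(1) p'(1) unfolding walk_def by auto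
  have "reduced (c # B)" using R(1) x(2) reduced_ConsD reduced_eqv by blast
  moreover have "walk b c (c # B)" using walk_tl walk_eqv[OF p(1) x(2)] xw by blast
  moreover have "c \<in> V" using sq_adj[OF x(1)] adj_V by blast
  ultimately have "length (c # B) = Suc (d b c)" using reduced_walk_length assms(1) by blast
  then have "d b w = Suc (d b c)" using eqv_length[OF x(2)] p by simp
  then show ?thesis using that x(1) xw by blast
qed

lemma descend:
  assumes "b \<in> V" "v \<in> V" "d b v = Suc n" obtains w where "adj v w" "d b w = n"
proof -
  obtain p where p: "walk b v p" "length p = Suc (Suc n)" using geodesic assms by metis
  then obtain w q where q: "p = v # w # q" unfolding walk_def by (cases p; cases "tl p") auto
  then have w: "walk b w (w # q)" "adj v w" using walk_tl p by blast+
  have "d b w \<le> n" using d_le[OF w(1)] p q by simp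
  then have "d b w = n" using d_adj[OF assms(1) w(2)] assms(3) by auto
  then show ?thesis using that w by blast
qed

section \<open>Halfspaces from distances\<close>

definition H :: "'a \<Rightarrow> 'a \<Rightarrow> 'a set" where
  "H a b = {x \<in> V. d x a < d x b}"

lemma H_self: assumes "adj a b" shows "a \<in> H a b" "b \<notin> H a b"
  using assms adj_V[OF assms] d_refl d_eq_0[of a b] adj_neq[OF assms] by (auto simp: H_def)

lemma H_compl: assumes "adj a b" shows "V - H a b = H b a"
proof (intro set_eqI)
  fix x
  show "x \<in> V - H a b \<longleftrightarrow> x \<in> H b a"
    using d_adj[of x a b] assms by (cases "x \<in> V") (auto simp: H_def)
qed

lemma H_subset: "H a b \<subseteq> V" by (auto simp: H_def)

lemma H_Suc: assumes "adj a b" "x \<in> V" shows "x \<in> H a b \<longleftrightarrow> d x b = Suc (d x a)"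
  using d_adj[OF assms(2,1)] assms(2) by (auto simp: H_def)

text \<open>Otherwise \<open>a\<close> and \<open>b'\<close> are both closer to \<open>x\<close>
  than \<open>b\<close> is, and the square they span at \<open>b\<close> has its far corner closer
  still; by uniqueness this corner is \<open>a'\<close>, which is farther from \<open>x\<close> than
  \<open>a\<close>.\<close>

lemma sq_H_subset: assumes s: "sq a b b' a'" shows "H a b \<subseteq> H a' b'"
proof
  fix x assume "x \<in> H a b"
  then have x: "x \<in> V" "d x b = Suc (d x a)" using H_Suc sq_adj[OF s] by (auto simp: H_def)
  show "x \<in> H a' b'"
  proof (rule ccontr)
    assume "x \<notin> H a' b'"
    then have "d x a' = Suc (d x b')" using d_adj[OF x(1), of a' b'] sq_adj[OF s] x by (auto simp: H_def)
    then have e: "d x b' = d x a" "d x a' = Suc (d x a)"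
      using d_adj[OF x(1) sq_adj(8)[OF s]] d_adj[OF x(1) sq_adj(2)[OF s]] x(2) by arith+
    obtain c where c: "sq b a c b'" "d x a = Suc (d x c)"
      using descending_square[OF x(1), of b a b'] sq_adj[OF s] sq_neq[OF s] e x by metis
    have "sq b a a' b'" using s sq_rot sq_flip by blast
    then have "c = a'" using c(1) sq_unique by blast
    then show False using c(2) e by simp
  qed
qed

lemma sq_H: "sq a b b' a' \<Longrightarrow> H a b = H a' b'"
  using sq_H_subset[of a b b' a'] sq_H_subset[of a' b' b a] sq_rot sq_flip by blast

lemma class_H:
  assumes "({a, b}, e) \<in> (opposite_edges X)\<^sup>*" "adj a b"
  shows "\<exists>x y. e = {x, y} \<and> adj x y \<and> H x y = H a b"
  using assms(1)
proof (induction rule: rtrancl_induct)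
  case base then show ?case using assms(2) by blast
next
  case (step e e')
  then obtain x y where xy: "e = {x, y}" "adj x y" "H x y = H a b" by blast
  obtain p q q' p' where s: "e = {p, q}" "e' = {p', q'}" "sq p q q' p'"
    using opposite_edgesE[OF step(2)] by metis
  have "sq q p p' q'" using s(3) sq_rot sq_flip by blast
  then have "H p q = H p' q'" "H q p = H q' p'" using sq_H s(3) by blast+
  moreover have "x = p \<and> y = q \<or> x = q \<and> y = p" using s(1) xy(1) by (simp add: doubleton_eq_iff)
  moreover have "adj p' q'" "adj q' p'" using sq_adj[OF s(3)] by blast+
  ultimately show ?case using s(2) xy(3) by (metis insert_commute)
qed

text \<open>Induction on the distance from \<open>a\<close>: an edge leaving \<open>H a b\<close>
  elsewhere than at \<open>a\<close> lies in a square whose opposite edge also leaves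
  \<open>H a b\<close> and is closer to \<open>a\<close>, so a strip of squares leads back to
  \<open>{a, b}\<close>.\<close>

lemma H_class:
  assumes "adj a b" "adj x y" "x \<in> H a b" "y \<notin> H a b"
  shows "({a, b}, {x, y}) \<in> (opposite_edges X)\<^sup>*"
  using assms
proof (induction "d a x" arbitrary: x y)
  have V: "a \<in> V" "b \<in> V" using adj_V assms(1) by blast+
  {
    case (0 x y)
    have xV: "x \<in> V" "y \<in> V" using adj_V "0.prems"(2) by blast+
    have "a = x" using d_eq_0[OF V(1) xV(1)] "0.hyps" by simp
    have "y \<in> H b a" using H_compl[OF assms(1)] "0.prems"(4) xV by blast
    then have "d y b < d y x" using \<open>a = x\<close> by (simp add: H_def)
    moreover have "d y x \<le> 1" using d_adj[OF xV(2) "0.prems"(2)] d_refl[of y] by auto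
    ultimately have "y = b" using d_eq_0[OF xV(2) V(2)] by simp
    then show ?case using \<open>a = x\<close> by simp
  next
    case (Suc n x y)
    have xV: "x \<in> V" "y \<in> V" using adj_V Suc.prems(2) by blast+
    have ya: "d y a = Suc (d y b)"
      using H_Suc[OF adj_sym[OF assms(1)] xV(2)] H_compl[OF assms(1)] Suc.prems(4) xV by blast
    have xb: "d x b = Suc (d x a)" using H_Suc[OF assms(1) xV(1)] Suc.prems(3) by blast
    have xa: "d x a = Suc n" using Suc.hyps(2) d_sym V xV by simp
    have dy: "d a y = Suc (d a x)"
    proof (rule ccontr)
      assume "\<not> ?thesis"
      then have "d a x = Suc (d a y)" using d_adj[OF V(1) Suc.prems(2)] by blast
      then have "d y a = n" using Suc.hyps(2) d_sym V xV by simp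
      then have "d y b < n" using ya by simp
      moreover have "d b x = Suc (Suc n)" using xb xa d_sym V xV by simp
      moreover have "d b y = d y b" using d_sym V xV by simp
      ultimately show False using d_adj[OF V(2) Suc.prems(2)] by linarith
    qed
    have by': "d b y = Suc n" using dy ya Suc.hyps(2) d_sym[OF V(1) xV(2)] d_sym[OF V(2) xV(2)] by simp
    \<comment> \<open>The square comes from a step from \<open>y\<close> towards \<open>b\<close>:
      both \<open>x\<close> and \<open>y1\<close> are closer to \<open>a\<close> than
      \<open>y\<close>.\<close>
    obtain y1 where y1: "adj y y1" "d b y1 = n" using descend[OF V(2) xV(2) by'] .
    have y1V: "y1 \<in> V" using adj_V y1 by blast
    have ay1: "d a y1 = Suc n"
    proof -
      have "d a y = Suc (Suc n)" using dy Suc.hyps(2) by simp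
      moreover have "d a y1 \<le> Suc n"
        using d_adj[OF y1V assms(1)] d_sym[OF V(1) y1V] d_sym[OF V(2) y1V] y1(2) by auto
      ultimately show ?thesis using d_adj[OF V(1) y1(1)] by auto
    qed
    have "x \<noteq> y1" using xb xa y1(2) d_sym[OF V(2) xV(1)] by auto
    then obtain c where c: "sq y x c y1" "d a x = Suc (d a c)"
      using descending_square[OF V(1) adj_sym[OF Suc.prems(2)] y1(1)] dy ay1 Suc.hyps(2) by metis
    have cV: "c \<in> V" using sq_adj[OF c(1)] adj_V by blast
    have ca: "d a c = n" using c(2) Suc.hyps(2) by simp
    have "d b x = Suc (Suc n)" using xb xa d_sym V xV by simp
    then have "d b c \<ge> Suc n" using d_adj[OF V(2), of x c] sq_adj[OF c(1)] by auto
    then have cH: "c \<in> H a b" using ca d_sym[OF V(1) cV] d_sym[OF V(2) cV] cV by (simp add: H_def)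
    have y1H: "y1 \<notin> H a b" using ay1 y1 d_sym[OF V(1) y1V] d_sym[OF V(2) y1V] by (simp add: H_def)
    have "({a, b}, {c, y1}) \<in> (opposite_edges X)\<^sup>*"
      using Suc.hyps(1)[of c y1] ca assms(1) sq_adj[OF c(1)] cH y1H by blast
    moreover have "({c, y1}, {x, y}) \<in> opposite_edges X"
      using c(1) sq_opposite[of c y1 y x] sq_rot by blast
    ultimately show ?case by (rule rtrancl_into_rtrancl)
  }
qed

definition hyp :: "'a \<Rightarrow> 'a \<Rightarrow> 'a set set" where
  "hyp a b = (opposite_edges X)\<^sup>* `` {{a, b}}"

lemma edge_in_hyp:
  assumes "adj a b" "adj x y"
  shows "{x, y} \<in> hyp a b \<longleftrightarrow> (x \<in> H a b) \<noteq> (y \<in> H a b)"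
proof
  assume "{x, y} \<in> hyp a b"
  then obtain p q where pq: "{x, y} = {p, q}" "adj p q" "H p q = H a b"
    using class_H[OF _ assms(1)] unfolding hyp_def by blast
  then show "(x \<in> H a b) \<noteq> (y \<in> H a b)" using H_self[OF pq(2)] by (auto simp: doubleton_eq_iff)
next
  assume "(x \<in> H a b) \<noteq> (y \<in> H a b)"
  then show "{x, y} \<in> hyp a b"
    using H_class[OF assms(1), of x y] H_class[OF assms(1), of y x] assms(2) adj_sym
    unfolding hyp_def by (auto simp: insert_commute)
qed

text \<open>A step from a vertex of \<open>H a b\<close> towards \<open>a\<close> stays in
  \<open>H a b\<close>, so \<open>H a b\<close> remains connected when the crossed edges are
  removed.\<close>

lemma component_H:
  assumes ab: "adj a b" and v: "v \<in> H a b"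
  shows "{u. (v, u) \<in> {(p, q). {p, q} \<in> edges X - hyp a b}\<^sup>*} = H a b"
proof -
  let ?r = "{(p, q). {p, q} \<in> edges X - hyp a b}"
  have closed: "u \<in> H a b" if "(v, u) \<in> ?r\<^sup>*" for u
    using that
  proof (induction rule: rtrancl_induct)
    case (step p q)
    then have "adj p q" "{p, q} \<notin> hyp a b" by (auto simp: adj_def)
    then show ?case using edge_in_hyp[OF ab] step by blast
  qed (rule v)
  have V: "a \<in> V" "b \<in> V" using adj_V ab by blast+
  have conn: "(x, a) \<in> ?r\<^sup>*" if "x \<in> H a b" for x
    using that
  proof (induction "d a x" arbitrary: x)
    case 0
    then have "a = x" using d_eq_0[OF V(1), of x] by (simp add: H_def)
    then show ?case by simp
  next
    case (Suc n x)
    have xV: "x \<in> V" using Suc.prems by (simp add: H_def)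
    obtain w where w: "adj x w" "d a w = n" using descend[OF V(1) xV] Suc.hyps(2) by metis
    have wV: "w \<in> V" using adj_V w by blast
    have "d b x = Suc (Suc n)"
      using Suc.prems Suc.hyps(2) H_Suc[OF ab xV] d_sym[OF V(1) xV] d_sym[OF V(2) xV] by simp
    then have "d b w \<ge> Suc n" using d_adj[OF V(2) w(1)] by auto
    then have "w \<in> H a b" using w(2) wV d_sym[OF V(1) wV] d_sym[OF V(2) wV] by (simp add: H_def)
    then have "(w, a) \<in> ?r\<^sup>*" "(x, w) \<in> ?r"
      using Suc.hyps(1)[of w] w Suc.prems edge_in_hyp[OF ab w(1)] by (auto simp: adj_def)
    then show ?case by (meson converse_rtrancl_into_rtrancl)
  qed
  have "sym ?r" by (auto simp: sym_def insert_commute)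
  then have "(a, x) \<in> ?r\<^sup>*" if "x \<in> H a b" for x
    using conn[OF that] sym_rtrancl symD by metis
  then have "(v, u) \<in> ?r\<^sup>*" if "u \<in> H a b" for u
    using conn[OF v] that by (meson rtrancl_trans)
  then show ?thesis using closed by blast
qed

lemma hyp_commute: "hyp a b = hyp b a"
  by (simp add: hyp_def insert_commute)

lemma sides_hyp: assumes ab: "adj a b" shows "sides X (hyp a b) = {H a b, H b a}"
proof -
  let ?r = "{(p, q). {p, q} \<in> edges X - hyp a b}"
  have *: "{u. (v, u) \<in> ?r\<^sup>*} = (if v \<in> H a b then H a b else H b a)" if "v \<in> V" for v
  proof (cases "v \<in> H a b")
    case False
    then have "v \<in> H b a" using that H_compl[OF ab] by blast
    then show ?thesis using component_H[OF adj_sym[OF ab]] False by (simp add: hyp_commute)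
  qed (use component_H[OF ab] in simp)
  have "sides X (hyp a b) = (\<lambda>v. if v \<in> H a b then H a b else H b a) ` V"
  proof -
    have "sides X (hyp a b) = (\<lambda>v. {u. (v, u) \<in> ?r\<^sup>*}) ` V" unfolding sides_def V_def[symmetric] by blast
    also have "\<dots> = (\<lambda>v. if v \<in> H a b then H a b else H b a) ` V" by (rule image_cong) (use * in auto)
    finally show ?thesis .
  qed
  moreover have "a \<in> V" "b \<in> V" "a \<in> H a b" "b \<notin> H a b" using adj_V H_self ab by blast+
  ultimately show ?thesis by (auto simp: image_def)
qed

lemma hyperplanes_eq: "hyperplanes X = {hyp a b | a b. adj a b}"
proof -
  have "{a, b} \<in> edges X \<longleftrightarrow> adj a b" for a b by (simp add: adj_def)
  then show ?thesis unfolding hyperplanes_def quotient_def hyp_def using edge_cases by blast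
qed

definition HS :: "'a set set" where "HS = halfspaces X"

lemma HS_eq: "HS = {H a b | a b. adj a b}"
  unfolding HS_def halfspaces_def hyperplanes_eq using sides_hyp adj_sym by fastforce

lemma HS_I: "adj a b \<Longrightarrow> H a b \<in> HS" using HS_eq by blast

lemma HS_E: assumes "h \<in> HS" obtains a b where "adj a b" "h = H a b" using assms HS_eq by blast

lemma HS_compl: assumes "h \<in> HS" shows "V - h \<in> HS"
proof -
  obtain a b where "adj a b" "h = H a b" using assms by (rule HS_E)
  then show ?thesis using HS_I[OF adj_sym] H_compl by simp
qed

lemma HS_subset: "h \<in> HS \<Longrightarrow> h \<subseteq> V" using HS_eq H_subset by blast

lemma HS_nonempty: "h \<in> HS \<Longrightarrow> h \<noteq> {}" using H_self(1) by (metis HS_E empty_iff)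

lemma HS_double_compl: "h \<in> HS \<Longrightarrow> V - (V - h) = h" using HS_subset by blast

lemma crossed: assumes "adj a b" "h \<in> HS" "a \<in> h" "b \<notin> h" shows "h = H a b"
proof -
  obtain x y where xy: "adj x y" "h = H x y" using assms(2) by (rule HS_E)
  then have "{a, b} \<in> hyp x y" using edge_in_hyp[OF xy(1) assms(1)] assms by blast
  then obtain p q where pq: "{a, b} = {p, q}" "adj p q" "H p q = H x y"
    using class_H[OF _ xy(1)] unfolding hyp_def by blast
  then show ?thesis using xy assms H_self[OF pq(2)] by (auto simp: doubleton_eq_iff)
qed

text \<open>A vertex behind both edges sees \<open>a\<close> and \<open>b\<close> as neighbours of
  \<open>v\<close> that are closer to it than \<open>v\<close>.\<close>

lemma spans_square:
  assumes "adj v a" "adj v b" "a \<noteq> b" "H a v \<inter> H b v \<noteq> {}" obtains c where "sq v a c b"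
proof -
  obtain x where "x \<in> V" "d x v = Suc (d x a)" "d x v = Suc (d x b)"
    using assms(4) H_Suc[OF adj_sym[OF assms(1)]] H_Suc[OF adj_sym[OF assms(2)]] H_subset by blast
  then show ?thesis using descending_square[OF _ assms(1-3)] that by metis
qed

lemma sq_H': "sq v a c b \<Longrightarrow> H a v = H c b"
  using sq_H[of a v b c] sq_rot sq_flip by blast

lemma sq_H_neq: assumes "sq v a c b" shows "a \<notin> H b v"
proof -
  have V: "a \<in> V" "b \<in> V" "v \<in> V" using sq_adj[OF assms] adj_V by blast+
  have "d a v \<le> 1" using d_adj[OF V(1) sq_adj(5)[OF assms]] d_refl[of a] by auto
  moreover have "d a b \<noteq> 0" using d_eq_0 V sq_neq[OF assms] by blast
  ultimately show ?thesis by (simp add: H_def)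
qed

lemma H_inj: assumes "adj v a" "adj v b" "H a v = H b v" shows "a = b"
proof (rule ccontr)
  assume "a \<noteq> b"
  moreover have "a \<in> H a v" using H_self adj_sym assms by blast
  ultimately obtain c where "sq v a c b" using spans_square[OF assms(1,2)] assms(3) by blast
  then show False using sq_H_neq \<open>a \<in> H a v\<close> assms(3) by blast
qed

text \<open>Induction along a geodesic to a vertex of \<open>h\<close>. If the next vertex
  \<open>w\<close> is still outside \<open>h\<close>, some edge from \<open>w\<close> to
  \<open>a\<close> works there. If \<open>H a w\<close> misses \<open>H v w\<close>, it lies behind
  the edge from \<open>v\<close> to \<open>w\<close>; otherwise a square carries the edge to
  \<open>a\<close> back to \<open>v\<close>.\<close>

lemma gate:
  assumes "v \<in> V" "h \<in> HS" "v \<notin> h" obtains a where "adj v a" "h \<subseteq> H a v"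
proof -
  obtain q where q: "q \<in> h" "q \<in> V" using HS_nonempty HS_subset assms(2) by blast
  have "\<exists>a. adj v a \<and> h \<subseteq> H a v" using assms
  proof (induction "d q v" arbitrary: v)
    case 0 then show ?case using d_eq_0[OF q(2)] q(1) by metis
  next
    case (Suc n v)
    obtain w where w: "adj v w" "d q w = n" using descend[OF q(2) Suc.prems(1)] Suc.hyps(2) by metis
    have qw: "q \<in> H w v" using w Suc.hyps(2) q by (simp add: H_def)
    show ?case
    proof (cases "w \<in> h")
      case True
      then show ?thesis using crossed[OF adj_sym[OF w(1)]] Suc.prems w by blast
    next
      case False
      then obtain a where a: "adj w a" "h \<subseteq> H a w" using Suc.hyps(1)[of w] w Suc.prems adj_V by blast
      have "a \<noteq> v" using a qw q H_compl[OF adj_sym[OF w(1)]] by blast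
      show ?thesis
      proof (cases "H v w \<inter> H a w = {}")
        case True
        then have "H a w \<subseteq> H w v" using H_compl[OF w(1)] H_subset by blast
        then show ?thesis using a w by blast
      next
        case False
        then obtain c where c: "sq w v c a" using spans_square[OF adj_sym[OF w(1)] a(1)] \<open>a \<noteq> v\<close> by metis
        then have "H a w = H c v" using sq_H' sq_flip by blast
        then show ?thesis using a sq_adj[OF c] by metis
      qed
    qed
  qed
  then show ?thesis using that by blast
qed

lemma separating_finite: assumes "u \<in> V" "v \<in> V" shows "finite {h \<in> HS. u \<in> h \<and> v \<notin> h}"
  using assms(2)
proof (induction "d u v" arbitrary: v)
  case 0
  then have "u = v" using d_eq_0[OF assms(1)] by simp
  then show ?case by simp
next
  case (Suc n v)
  obtain w where w: "adj v w" "d u w = n" using descend[OF assms(1) Suc.prems] Suc.hyps(2) by metis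
  have "{h \<in> HS. u \<in> h \<and> v \<notin> h} \<subseteq> insert (H w v) {h \<in> HS. u \<in> h \<and> w \<notin> h}"
    using crossed[OF adj_sym[OF w(1)]] by blast
  moreover have "finite {h \<in> HS. u \<in> h \<and> w \<notin> h}" using Suc.hyps(1)[of w] w adj_V by blast
  ultimately show ?case by (meson finite.insertI finite_subset)
qed

lemma separated: assumes "u \<in> V" "v \<in> V" "u \<noteq> v" obtains a where "adj v a" "u \<in> H a v"
proof -
  obtain n where n: "d u v = Suc n" using d_eq_0[OF assms(1,2)] assms(3) not0_implies_Suc by blast
  obtain w where "adj v w" "d u w = n" using descend[OF assms(1,2) n] .
  then show ?thesis using that n assms by (simp add: H_def)
qed

text \<open>As \<open>c\<close> is at distance 2 from \<open>u\<close>, both \<open>a\<close> and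
  \<open>b\<close> are closer to \<open>c\<close>, and the square they span at \<open>u\<close> can
  only end in \<open>c\<close>.\<close>

lemma four_cycle_sq:
  assumes "adj u a" "adj a c" "adj c b" "adj b u" "a \<noteq> b" "u \<noteq> c" shows "sq u a c b"
proof -
  have V: "c \<in> V" "a \<in> V" "b \<in> V" "u \<in> V" using adj_V assms by blast+
  have one: "d c x = 1" if "adj c x" for x
    using d_adj[OF V(1) that] d_refl[of c] by auto
  have c1: "d c a = 1" "d c b = 1" using one assms adj_sym by blast+
  moreover have "d c u \<noteq> 0" using d_eq_0[OF V(1,4)] assms(6) by auto
  ultimately have "d c u = 2" using d_adj[OF V(1) assms(1)] by auto
  then obtain e where e: "sq u a e b" "d c a = Suc (d c e)"
    using descending_square[OF V(1) assms(1) adj_sym[OF assms(4)] assms(5)] c1 by auto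
  then have "e = c" using c1 d_eq_0[OF V(1)] sq_adj[OF e(1)] adj_V by (metis One_nat_def Suc_inject)
  then show ?thesis using e by simp
qed

end

section \<open>Boundary points, rays and lines\<close>

context cat0
begin

section \<open>Ultrafilters and boundary points\<close>

definition U :: "'a set set \<Rightarrow> bool" where
  "U x \<longleftrightarrow> x \<subseteq> HS \<and> (\<forall>h\<in>x. \<forall>k\<in>x. h \<inter> k \<noteq> {}) \<and> (\<forall>h\<in>HS. h \<in> x \<or> V - h \<in> x)"

abbreviation \<sigma> :: "'a \<Rightarrow> 'a set set" where "\<sigma> v \<equiv> vertex_ultrafilter X v"

abbreviation bd :: "'a set set set" where "bd \<equiv> roller_boundary X"

lemma ultrafilter_iff: "ultrafilter X x \<longleftrightarrow> U x"
proof -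
  have "(\<forall>W\<in>hyperplanes X. \<exists>h\<in>sides X W. h \<in> x) \<longleftrightarrow> (\<forall>a b. adj a b \<longrightarrow> H a b \<in> x \<or> H b a \<in> x)"
    unfolding hyperplanes_eq using sides_hyp by fastforce
  also have "\<dots> \<longleftrightarrow> (\<forall>h\<in>HS. h \<in> x \<or> V - h \<in> x)"
    unfolding HS_eq using H_compl by fastforce
  finally show ?thesis unfolding ultrafilter_def U_def HS_def by blast
qed

lemma sigma_eq: "\<sigma> v = {h \<in> HS. v \<in> h}"
  by (simp add: vertex_ultrafilter_def HS_def)

lemma U_sigma: "v \<in> V \<Longrightarrow> U (\<sigma> v)"
  unfolding U_def sigma_eq using HS_compl by blast

lemma bd_iff: "x \<in> bd \<longleftrightarrow> U x \<and> x \<notin> \<sigma> ` V"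
  by (simp add: roller_boundary_def roller_compactification_def ultrafilter_iff V_def)

lemma bd_U: "x \<in> bd \<Longrightarrow> U x"
  by (simp add: bd_iff)

lemma U_HS: "U x \<Longrightarrow> h \<in> x \<Longrightarrow> h \<in> HS"
  by (auto simp: U_def)

lemma U_meet: "U x \<Longrightarrow> h \<in> x \<Longrightarrow> k \<in> x \<Longrightarrow> h \<inter> k \<noteq> {}"
  by (auto simp: U_def)

lemma U_compl: assumes "U x" "h \<in> HS" shows "V - h \<in> x \<longleftrightarrow> h \<notin> x"
  using assms U_meet[OF assms(1), of h "V - h"] by (auto simp: U_def)

lemma U_up: assumes "U x" "h \<in> x" "k \<in> HS" "h \<subseteq> k" shows "k \<in> x"
  using U_compl[OF assms(1,3)] U_meet[OF assms(1,2), of "V - k"] assms(4) by blast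

lemma U_H: assumes "U x" "adj a b" shows "H a b \<in> x \<longleftrightarrow> H b a \<notin> x"
  using U_compl[OF assms(1) HS_I[OF assms(2)]] H_compl[OF assms(2)] by simp

lemma U_ext: assumes "U x" "U y" "x \<subseteq> y" shows "x = y"
  using assms U_compl U_HS by (metis subsetD subsetI subset_antisym)

lemma U_gate:
  assumes "U x" "h \<in> x" "v \<in> V" "v \<notin> h"
  obtains a where "adj v a" "h \<subseteq> H a v" "H a v \<in> x"
proof -
  obtain a where a: "adj v a" "h \<subseteq> H a v" using gate[OF assms(3) U_HS[OF assms(1,2)] assms(4)] .
  then have "H a v \<in> x" using U_up assms HS_I adj_sym by metis
  with a that show ?thesis by blast
qed

text \<open>The hyperplanes counted by a Gromov product are recorded by their sides containing \<open>x\<close> and \<open>y\<close>.\<close>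

definition gp :: "'a \<Rightarrow> 'a set set \<Rightarrow> 'a set set \<Rightarrow> 'a set set" where
  "gp v x y = {h. h \<in> x \<and> h \<in> y \<and> v \<notin> h}"

lemma gp_sym: "gp v x y = gp v y x"
  by (auto simp: gp_def)

lemma gp_step:
  assumes "U x" "adj v a" "H a v \<in> x" "H a v \<in> y"
  shows "gp a x y = gp v x y - {H a v}"
proof -
  have a: "a \<in> H a v" using H_self adj_sym assms(2) by blast
  have "v \<notin> h" if "h \<in> x" "a \<notin> h" for h
  proof
    assume "v \<in> h"
    then have "h = H v a" using crossed[OF assms(2)] U_HS assms(1) that by blast
    then show False using U_H[OF assms(1,2)] that assms(3) by blast
  qed
  moreover have "h = H a v" if "h \<in> x" "a \<in> h" "v \<notin> h" for h
    using crossed[OF adj_sym[OF assms(2)]] U_HS assms(1) that by blast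
  ultimately show ?thesis using a unfolding gp_def by (intro set_eqI iffI) (blast, blast)
qed

lemma bd_gp_ex:
  assumes "x \<in> bd" "v \<in> V" obtains h where "h \<in> x" "v \<notin> h"
proof -
  have "\<not> x \<subseteq> \<sigma> v" using U_ext[of x "\<sigma> v"] assms bd_iff U_sigma by blast
  then show ?thesis using that U_HS bd_U[OF assms(1)] unfolding sigma_eq by blast
qed

text \<open>Finiteness of the Gromov product of \<open>x\<close> and \<open>y\<close>; for
  ultrafilters, \<open>gp_finite_change\<close> shows that the choice of vertex does not
  matter.\<close>

definition perp :: "'a set set \<Rightarrow> 'a set set \<Rightarrow> bool" where
  "perp x y \<longleftrightarrow> finite (gp (base_vertex X) x y)"

lemma base_V: "base_vertex X \<in> V"
proof -
  have "verts X \<noteq> {}" using cat0 by (simp add: cat0_cube_complex_def)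
  then show ?thesis unfolding base_vertex_def V_def using someI_ex[of "\<lambda>v. v \<in> verts X"] by blast
qed

lemma gp_finite_change:
  assumes "U x" "v \<in> V" "w \<in> V" "finite (gp v x y)" shows "finite (gp w x y)"
proof (rule finite_subset)
  show "gp w x y \<subseteq> gp v x y \<union> {h \<in> HS. v \<in> h \<and> w \<notin> h}"
    using U_HS assms(1) by (auto simp: gp_def)
  show "finite (gp v x y \<union> {h \<in> HS. v \<in> h \<and> w \<notin> h})"
    using assms separating_finite by simp
qed

lemma perp_iff: "U x \<Longrightarrow> v \<in> V \<Longrightarrow> perp x y \<longleftrightarrow> finite (gp v x y)"
  unfolding perp_def using gp_finite_change base_V by blast

lemma perp_sym: "perp x y \<longleftrightarrow> perp y x"
  by (simp add: perp_def gp_sym)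

lemma perp_I: "U x \<Longrightarrow> v \<in> V \<Longrightarrow> gp v x y = {} \<Longrightarrow> perp x y"
  by (simp add: perp_iff)

text \<open>The inclusion says that the edges at \<open>r (Suc n)\<close> do not span a square.\<close>

definition ray :: "(nat \<Rightarrow> 'a) \<Rightarrow> bool" where
  "ray r \<longleftrightarrow> (\<forall>n. adj (r n) (r (Suc n)) \<and> H (r (Suc (Suc n))) (r (Suc n)) \<subseteq> H (r (Suc n)) (r n))"

definition K :: "(nat \<Rightarrow> 'a) \<Rightarrow> nat \<Rightarrow> 'a set" where
  "K r n = H (r (Suc n)) (r n)"

definition ray_end :: "(nat \<Rightarrow> 'a) \<Rightarrow> 'a set set" where
  "ray_end r = {h \<in> HS. \<exists>n. \<forall>m\<ge>n. r m \<in> h}"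

lemma ray_adj: "ray r \<Longrightarrow> adj (r n) (r (Suc n))"
  by (simp add: ray_def)

lemma ray_V: "ray r \<Longrightarrow> r n \<in> V"
  using ray_adj adj_V by blast

lemma K_HS: "ray r \<Longrightarrow> K r n \<in> HS"
  unfolding K_def using HS_I ray_adj adj_sym by blast

lemma K_mono: "ray r \<Longrightarrow> n \<le> m \<Longrightarrow> K r m \<subseteq> K r n"
  by (rule lift_Suc_antimono_le) (auto simp: ray_def K_def)

lemma ray_mem_K: assumes "ray r" shows "r m \<in> K r n \<longleftrightarrow> n < m"
proof
  assume "n < m"
  then obtain k where m: "m = Suc k" "n \<le> k" by (metis Suc_le_lessD Suc_pred less_Suc_eq_le less_nat_zero_code not_gr_zero)
  then have "r m \<in> K r k" using H_self adj_sym ray_adj[OF assms] by (simp add: K_def)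
  then show "r m \<in> K r n" using K_mono[OF assms m(2)] by blast
next
  assume "r m \<in> K r n"
  moreover have "r m \<notin> K r m" using H_self adj_sym ray_adj[OF assms] by (simp add: K_def)
  ultimately show "n < m" using K_mono[OF assms, of m n] by (meson in_mono not_less)
qed

lemma K_inj: "ray r \<Longrightarrow> inj (K r)"
  by (rule injI) (metis linorder_neqE_nat ray_mem_K less_irrefl_nat)

lemma ray_cross: "ray r \<Longrightarrow> h \<in> HS \<Longrightarrow> r n \<notin> h \<Longrightarrow> r (Suc n) \<in> h \<Longrightarrow> h = K r n"
  unfolding K_def using crossed adj_sym ray_adj by blast

lemma K_en: "ray r \<Longrightarrow> K r n \<in> ray_end r"
  unfolding ray_end_def using K_HS ray_mem_K by (auto intro!: exI[of _ "Suc n"])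

lemma crossing_index:
  assumes "\<not> P n" "P m" "n \<le> m" shows "\<exists>k. n \<le> k \<and> \<not> P k \<and> P (Suc k)"
  using assms(3,2) by (induction m rule: dec_induct) (use assms(1) in auto)

text \<open>If the ray ever crosses the hyperplane of \<open>h\<close>, then \<open>h\<close> or its
  complement is some \<open>K r n\<close>, which contains the rest of the ray; otherwise the ray
  stays on one side.\<close>

lemma en_dichotomy: assumes "ray r" "h \<in> HS" shows "h \<in> ray_end r \<or> V - h \<in> ray_end r"
proof -
  consider n where "r n \<notin> h" "r (Suc n) \<in> h" | n where "r n \<in> h" "r (Suc n) \<notin> h"
    | "\<And>n. r n \<in> h \<longleftrightarrow> r (Suc n) \<in> h" by blast
  then show ?thesis
  proof cases
    case 1 then show ?thesis using ray_cross K_en assms by metis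
  next
    case 2
    then have "V - h = K r n"
      using ray_cross[OF assms(1) HS_compl[OF assms(2)], of n] ray_V[OF assms(1)] by blast
    then show ?thesis using K_en assms by metis
  next
    case 3
    have "r m \<in> h \<longleftrightarrow> r 0 \<in> h" for m by (induction m) (use 3 in auto)
    then show ?thesis unfolding ray_end_def using assms HS_compl ray_V by blast
  qed
qed

lemma en_U: assumes "ray r" shows "U (ray_end r)"
  unfolding U_def
proof (intro conjI ballI)
  show "ray_end r \<subseteq> HS" by (auto simp: ray_end_def)
  fix h assume h: "h \<in> ray_end r"
  fix k assume k: "k \<in> ray_end r"
  obtain n m where nm: "\<And>i. i \<ge> n \<Longrightarrow> r i \<in> h" "\<And>i. i \<ge> m \<Longrightarrow> r i \<in> k"
    using h k unfolding ray_end_def by blast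
  have "r (max n m) \<in> h \<inter> k" using nm by simp
  then show "h \<inter> k \<noteq> {}" by blast
next
  fix h assume "h \<in> HS" then show "h \<in> ray_end r \<or> V - h \<in> ray_end r" using en_dichotomy assms by blast
qed

lemma en_new: assumes "ray r" "h \<in> ray_end r" "r 0 \<notin> h" obtains n where "h = K r n"
proof -
  obtain m where "r m \<in> h" using assms(2) unfolding ray_end_def by blast
  then obtain k where "r k \<notin> h" "r (Suc k) \<in> h" using crossing_index[of "\<lambda>n. r n \<in> h" 0 m] assms(3) by auto
  then show ?thesis using that ray_cross[OF assms(1)] assms(2) unfolding ray_end_def by blast
qed

lemma en_new_subset: assumes "ray r" "h \<in> ray_end r" "r 0 \<notin> h" shows "h \<subseteq> K r 0"
  using en_new[OF assms] K_mono[OF assms(1)] by (metis le0)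

lemma gp_en: assumes "ray r" shows "gp (r 0) (ray_end r) y = range (K r) \<inter> y"
proof (intro equalityI subsetI)
  fix h assume "h \<in> gp (r 0) (ray_end r) y"
  then have h: "h \<in> ray_end r" "r 0 \<notin> h" "h \<in> y" by (simp_all add: gp_def)
  obtain n where "h = K r n" using en_new[OF assms h(1,2)] .
  then show "h \<in> range (K r) \<inter> y" using h(3) by blast
next
  fix h assume "h \<in> range (K r) \<inter> y"
  then show "h \<in> gp (r 0) (ray_end r) y" using K_en[OF assms] ray_mem_K[OF assms] by (auto simp: gp_def)
qed

text \<open>By \<open>gp_en\<close> the product counts those \<open>K r n\<close> that belong to
  \<open>y\<close>. As they decrease with \<open>n\<close>, an ultrafilter containing infinitely
  many of them contains all.\<close>

lemma not_perp_en: assumes r: "ray r" and y: "U y" shows "\<not> perp (ray_end r) y \<longleftrightarrow> (\<forall>n. K r n \<in> y)"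
proof
  assume "\<forall>n. K r n \<in> y"
  then have "gp (r 0) (ray_end r) y = range (K r)" using gp_en[OF r] by blast
  then show "\<not> perp (ray_end r) y"
    using perp_iff[OF en_U[OF r] ray_V[OF r]] range_inj_infinite[OF K_inj[OF r]] by metis
next
  assume np: "\<not> perp (ray_end r) y"
  show "\<forall>n. K r n \<in> y"
  proof (rule ccontr)
    assume "\<not> ?thesis"
    then obtain n where n: "K r n \<notin> y" by blast
    have "m < n" if "K r m \<in> y" for m
      using that n U_up[OF y _ K_HS[OF r] K_mono[OF r]] by (meson not_less)
    then have "range (K r) \<inter> y \<subseteq> K r ` {..<n}" by auto
    then have "finite (gp (r 0) (ray_end r) y)" unfolding gp_en[OF r] by (rule finite_subset) simp
    then show False using np perp_iff[OF en_U[OF r] ray_V[OF r]] by blast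
  qed
qed

lemma en_bd: assumes r: "ray r" shows "ray_end r \<in> bd"
proof -
  have "ray_end r \<noteq> \<sigma> w" if w: "w \<in> V" for w
  proof
    assume e: "ray_end r = \<sigma> w"
    have "range (K r) \<subseteq> {h \<in> HS. w \<in> h \<and> r 0 \<notin> h}"
      using K_en[OF r] K_HS[OF r] ray_mem_K[OF r] unfolding e sigma_eq by auto
    then show False
      using separating_finite[OF w ray_V[OF r]] range_inj_infinite[OF K_inj[OF r]] finite_subset by blast
  qed
  then show ?thesis using en_U[OF r] bd_iff by blast
qed

text \<open>Every halfspace of the end that misses \<open>r 0\<close> lies in \<open>K r 0\<close>,
  so the edge to \<open>a\<close> enters \<open>K r 0\<close> too, and different edges at a vertex
  cross different hyperplanes.\<close>

lemma en_first_edge: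
  assumes r: "ray r" and a: "adj (r 0) a" "H a (r 0) \<in> ray_end r" shows "a = r 1"
proof -
  have "H a (r 0) \<subseteq> K r 0" using en_new_subset[OF r a(2)] H_self(2)[OF adj_sym[OF a(1)]] by blast
  then have "a \<in> K r 0" using H_self(1)[OF adj_sym[OF a(1)]] by blast
  then have "K r 0 = H a (r 0)"
    using crossed[OF adj_sym[OF a(1)] K_HS[OF r]] ray_mem_K[OF r] by blast
  then show ?thesis using H_inj[OF a(1), of "r 1"] ray_adj[OF r, of 0] by (simp add: K_def)
qed

lemma not_perp_trans:
  assumes r: "ray r" and "U x" "U y" "\<not> perp (ray_end r) x" "\<not> perp (ray_end r) y" shows "\<not> perp x y"
proof
  assume "perp x y"
  then have "finite (gp (r 0) x y)" using perp_iff[OF assms(2) ray_V[OF r]] by blast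
  moreover have "range (K r) \<subseteq> gp (r 0) x y"
    using not_perp_en[OF r] assms ray_mem_K[OF r] by (auto simp: gp_def)
  ultimately show False using range_inj_infinite[OF K_inj[OF r]] finite_subset by blast
qed

lemma ray_away: assumes r: "ray r" "U x" "K r 0 \<notin> x" shows "gp (r 0) x (ray_end r) = {}"
proof -
  have "h \<notin> x" if "h \<in> ray_end r" "r 0 \<notin> h" for h
    using en_new_subset[OF r(1) that] U_up[OF r(2) _ K_HS[OF r(1)]] r(3) by blast
  then show ?thesis by (auto simp: gp_def)
qed

lemma en_shift: "ray_end (\<lambda>n. r (n + k)) = ray_end r"
proof -
  have "(\<exists>n. \<forall>m\<ge>n. r (m + k) \<in> h) \<longleftrightarrow> (\<exists>n. \<forall>m\<ge>n. r m \<in> h)" for h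
  proof
    assume "\<exists>n. \<forall>m\<ge>n. r (m + k) \<in> h"
    then obtain n where n: "\<And>m. m \<ge> n \<Longrightarrow> r (m + k) \<in> h" by blast
    have "r m \<in> h" if "m \<ge> n + k" for m using n[of "m - k"] that by simp
    then show "\<exists>n. \<forall>m\<ge>n. r m \<in> h" by blast
  next
    assume "\<exists>n. \<forall>m\<ge>n. r m \<in> h"
    then show "\<exists>n. \<forall>m\<ge>n. r (m + k) \<in> h" by (meson le_add1 le_trans)
  qed
  then show ?thesis by (simp add: ray_end_def)
qed

section \<open>Bi-infinite lines\<close>

definition line :: "(int \<Rightarrow> 'a) \<Rightarrow> bool" where
  "line l \<longleftrightarrow> (\<forall>i. adj (l i) (l (i + 1)) \<and> H (l (i + 2)) (l (i + 1)) \<subseteq> H (l (i + 1)) (l i))"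

definition L :: "(int \<Rightarrow> 'a) \<Rightarrow> int \<Rightarrow> 'a set" where
  "L l i = H (l (i + 1)) (l i)"

definition up :: "(int \<Rightarrow> 'a) \<Rightarrow> 'a set set" where "up l = ray_end (\<lambda>n. l (int n))"

definition dn :: "(int \<Rightarrow> 'a) \<Rightarrow> 'a set set" where "dn l = ray_end (\<lambda>n. l (- int n))"

lemma line_adj: "line l \<Longrightarrow> adj (l i) (l (i + 1))"
  by (simp add: line_def)

lemma L_HS: "line l \<Longrightarrow> L l i \<in> HS"
  unfolding L_def using HS_I line_adj adj_sym by blast

lemma L_step: "line l \<Longrightarrow> L l (i + 1) \<subseteq> L l i"
  unfolding line_def L_def by (metis add.assoc one_add_one)

lemma L_compl: "line l \<Longrightarrow> H (l i) (l (i + 1)) = V - L l i"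
  unfolding L_def using H_compl line_adj adj_sym by metis

lemma line_shift: "line l \<Longrightarrow> line (\<lambda>i. l (i + c))"
proof -
  have e: "i + 1 + c = i + c + 1" "i + 2 + c = i + c + 2" for i :: int by simp_all
  show "line l \<Longrightarrow> line (\<lambda>i. l (i + c))" unfolding line_def e by blast
qed

lemma line_rev: assumes "line l" shows "line (\<lambda>i. l (- i))"
  unfolding line_def
proof (intro allI conjI)
  fix i
  show "adj (l (- i)) (l (- (i + 1)))" using adj_sym[OF line_adj[OF assms, of "- (i + 1)"]] by simp
  have e: "- (i + 1) = - i - 1" "- (i + 2) = - i - 2" "- i - 2 + 1 = - i - 1" "- i - 1 + 1 = - i" by simp_all
  have "H (l (- (i + 2))) (l (- (i + 1))) = V - L l (- i - 2)" using L_compl[OF assms, of "- i - 2"] by (simp only: e)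
  moreover have "H (l (- (i + 1))) (l (- i)) = V - L l (- i - 1)" using L_compl[OF assms, of "- i - 1"] by (simp only: e)
  moreover have "L l (- i - 1) \<subseteq> L l (- i - 2)" using L_step[OF assms, of "- i - 2"] by (simp only: e)
  ultimately show "H (l (- (i + 2))) (l (- (i + 1))) \<subseteq> H (l (- (i + 1))) (l (- i))" by blast
qed

lemma L_rev: assumes "line l" shows "L (\<lambda>i. l (- i)) i = V - L l (- i - 1)"
proof -
  have "- (i + 1) = - i - 1" "- i - 1 + 1 = - i" by simp_all
  then show ?thesis using L_compl[OF assms, of "- i - 1"] by (simp only: L_def)
qed

lemma L_shift: "L (\<lambda>i. l (i + c)) i = L l (i + c)"
  by (simp add: L_def algebra_simps)

lemma line_ray: assumes "line l" shows "ray (\<lambda>n. l (i + int n))"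
  unfolding ray_def
proof (intro allI conjI)
  fix n
  show "adj (l (i + int n)) (l (i + int (Suc n)))" using line_adj[OF assms, of "i + int n"] by (simp add: algebra_simps)
  show "H (l (i + int (Suc (Suc n)))) (l (i + int (Suc n))) \<subseteq> H (l (i + int (Suc n))) (l (i + int n))"
    using assms unfolding line_def by (metis (no_types, opaque_lifting) add.assoc int_Suc one_add_one)
qed

lemma K_line: "K (\<lambda>n. l (i + int n)) n = L l (i + int n)"
  by (simp add: K_def L_def algebra_simps)

lemma up_shift: assumes "line l" shows "ray_end (\<lambda>n. l (i + int n)) = up l"
proof -
  have *: "ray_end (\<lambda>n. l (i + int n)) = ray_end (\<lambda>n. l (j + int n))" if "i \<le> j" for i j
  proof -
    have "(\<lambda>n. l (j + int n)) = (\<lambda>n. l (i + int (n + nat (j - i))))" using that by (simp add: algebra_simps)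
    then show ?thesis using en_shift[of "\<lambda>n. l (i + int n)" "nat (j - i)"] by simp
  qed
  then show ?thesis unfolding up_def using *[of i 0] *[of 0 i] by (cases "i \<le> 0") auto
qed

lemma dn_rev: "dn l = up (\<lambda>i. l (- i))"
  by (simp add: dn_def up_def)

lemma up_rev: "up l = dn (\<lambda>i. l (- i))"
  by (simp add: dn_def up_def)

lemma L_mono: assumes "line l" "i \<le> j" shows "L l j \<subseteq> L l i"
  using assms(2)
proof (induction j rule: int_ge_induct)
  case (step j) then show ?case using L_step[OF assms(1), of j] by blast
qed simp

lemma up_bd: "line l \<Longrightarrow> up l \<in> bd"
  using en_bd[OF line_ray[of l 0]] by (simp add: up_def)

lemma dn_bd: "line l \<Longrightarrow> dn l \<in> bd"
  using up_bd[OF line_rev] dn_rev by simp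

lemma line_mem_L: assumes l: "line l" shows "l j \<in> L l i \<longleftrightarrow> i < j"
proof (cases "i \<le> j")
  case True
  then show ?thesis using ray_mem_K[OF line_ray[OF l, of i], of "nat (j - i)" 0] by (simp add: K_line)
next
  case False
  then have "l j \<notin> L l j" using ray_mem_K[OF line_ray[OF l, of j], of 0 0] by (simp add: K_line)
  then show ?thesis using L_mono[OF l, of j i] False by auto
qed

lemma L_less: assumes l: "line l" shows "L l i \<subseteq> L l j \<longleftrightarrow> j \<le> i"
proof
  assume "L l i \<subseteq> L l j"
  then have "l (i + 1) \<in> L l j" using line_mem_L[OF l, of "i + 1" i] by auto
  then show "j \<le> i" using line_mem_L[OF l] by simp
qed (rule L_mono[OF l])

lemma L_inj: "line l \<Longrightarrow> L l i = L l j \<longleftrightarrow> i = j"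
  using L_less by (metis antisym order_refl)

lemma line_inj: "line l \<Longrightarrow> inj l"
  by (rule injI) (metis linorder_neqE line_mem_L less_irrefl)

lemma L_up: assumes "line l" shows "L l i \<in> up l"
  using K_en[OF line_ray[OF assms, of i], of 0] up_shift[OF assms, of i] by (simp add: K_line)

lemma L_dn: assumes "line l" shows "L l i \<notin> dn l"
  using L_up[OF line_rev[OF assms], of "- i - 1"] L_rev[OF assms, of "- i - 1"] dn_rev
    U_compl[OF bd_U[OF dn_bd[OF assms]] L_HS[OF assms]] by simp

text \<open>Such a halfspace excludes \<open>l\<close> far in the negative direction and contains it
  far in the positive one, so the line enters it across some edge.\<close>

lemma up_dn_L: assumes l: "line l" and h: "h \<in> up l" "h \<notin> dn l" obtains i where "h = L l i"
proof -
  have hH: "h \<in> HS" using U_HS[OF bd_U[OF up_bd[OF l]] h(1)] .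
  obtain n where n: "\<And>m. m \<ge> n \<Longrightarrow> l (int m) \<in> h" using h(1) unfolding up_def ray_end_def by blast
  have "V - h \<in> dn l" using U_compl[OF bd_U[OF dn_bd[OF l]] hH] h(2) by blast
  then obtain m where m: "l (- int m) \<notin> h" unfolding dn_def ray_end_def by blast
  let ?r = "\<lambda>k. l (- int m + int k)"
  have "?r (m + n) \<in> h" using n[of n] by simp
  then obtain k where "?r k \<notin> h" "?r (Suc k) \<in> h"
    using crossing_index[of "\<lambda>k. ?r k \<in> h" 0 "m + n"] m by auto
  then have "h = K ?r k" using ray_cross[OF line_ray[OF l] hH] by blast
  then show ?thesis using that K_line by blast
qed

lemma not_perp_up: assumes l: "line l" and u: "U u" shows "\<not> perp (up l) u \<longleftrightarrow> (\<forall>i. L l i \<in> u)"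
proof -
  have "\<not> perp (up l) u \<longleftrightarrow> (\<forall>n. L l (int n) \<in> u)"
    using not_perp_en[OF line_ray[OF l, of 0] u] up_shift[OF l, of 0] by (simp add: K_line[of l 0, simplified])
  also have "\<dots> \<longleftrightarrow> (\<forall>i. L l i \<in> u)"
    using U_up[OF u _ L_HS[OF l] L_mono[OF l]] by (metis nat_0_le nle_le)
  finally show ?thesis .
qed

lemma not_perp_dn: assumes l: "line l" and u: "U u" shows "\<not> perp (dn l) u \<longleftrightarrow> (\<forall>i. L l i \<notin> u)"
proof -
  have "\<not> perp (dn l) u \<longleftrightarrow> (\<forall>i. V - L l (- i - 1) \<in> u)"
    using not_perp_up[OF line_rev[OF l] u] L_rev[OF l] dn_rev by simp
  also have "\<dots> \<longleftrightarrow> (\<forall>i. L l (- i - 1) \<notin> u)" using U_compl[OF u L_HS[OF l]] by simp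
  also have "\<dots> \<longleftrightarrow> (\<forall>i. L l i \<notin> u)" by (metis add.commute add_diff_cancel_left' minus_diff_eq diff_minus_eq_add uminus_add_conv_diff)
  finally show ?thesis .
qed

text \<open>Among the halfspaces of the line, \<open>u\<close> contains the same ones as the vertex
  \<open>l p\<close>, see \<open>line_mem_L\<close>.\<close>

definition has_position :: "(int \<Rightarrow> 'a) \<Rightarrow> int \<Rightarrow> 'a set set \<Rightarrow> bool" where
  "has_position l p u \<longleftrightarrow> (\<forall>i. L l i \<in> u \<longleftrightarrow> i < p)"

text \<open>The indices of the halfspaces belonging to \<open>u\<close> are closed downwards; both
  products are finite exactly if these indices are neither all integers nor none.\<close>

lemma finite_position:
  assumes l: "line l" and u: "U u" shows "perp (up l) u \<and> perp (dn l) u \<longleftrightarrow> (\<exists>p. has_position l p u)"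
proof
  assume "perp (up l) u \<and> perp (dn l) u"
  then obtain i j where ij: "L l i \<notin> u" "L l j \<in> u" using not_perp_up[OF l u] not_perp_dn[OF l u] by blast
  have down: "L l a \<in> u" if "L l b \<in> u" "a \<le> b" for a b
    using U_up[OF u that(1) L_HS[OF l] L_mono[OF l that(2)]] .
  have "j \<le> i" using down[OF ij(2), of i] ij(1) by linarith
  let ?P = "\<lambda>n::nat. L l (j + int n) \<notin> u"
  have "?P (nat (i - j))" using ij \<open>j \<le> i\<close> by simp
  then have lp: "?P (LEAST n. ?P n)" "\<And>m. m < (LEAST n. ?P n) \<Longrightarrow> L l (j + int m) \<in> u"
    by (rule LeastI, use not_less_Least in blast)
  define p where "p = j + int (LEAST n. ?P n)"
  have "L l k \<in> u \<longleftrightarrow> k < p" for k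
  proof
    assume "L l k \<in> u"
    then show "k < p" using lp(1) down[of k p] unfolding p_def by (meson not_less)
  next
    assume k: "k < p"
    show "L l k \<in> u"
    proof (cases "k \<le> j")
      case True then show ?thesis using down ij by blast
    next
      case False
      then show ?thesis using lp(2)[of "nat (k - j)"] k by (simp add: p_def)
    qed
  qed
  then show "\<exists>p. has_position l p u" unfolding has_position_def by blast
next
  assume "\<exists>p. has_position l p u"
  then obtain p where p: "\<And>i. L l i \<in> u \<longleftrightarrow> i < p" unfolding has_position_def by blast
  have "L l p \<notin> u" "L l (p - 1) \<in> u" using p by auto
  then show "perp (up l) u \<and> perp (dn l) u" using not_perp_up[OF l u] not_perp_dn[OF l u] by blast
qed

lemma line_ends_perp: assumes l: "line l" shows "perp (dn l) (up l)"
  using not_perp_up[OF l bd_U[OF dn_bd[OF l]]] L_dn[OF l] perp_sym by blast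

lemma not_both_ends: "line l \<Longrightarrow> U u \<Longrightarrow> perp (up l) u \<or> perp (dn l) u"
  using not_perp_up not_perp_dn by blast

lemma line_adj': "line l \<Longrightarrow> adj (l i) (l (i - 1))"
  using adj_sym[OF line_adj[of l "i - 1"]] by simp

text \<open>By connectedness the line visits all vertices. A square would have to use both edges of
  the line at some vertex, although the halfspaces behind these are disjoint.\<close>

lemma line_complex:
  assumes l: "line l" and nb: "\<And>i b. adj (l i) b \<Longrightarrow> b = l (i + 1) \<or> b = l (i - 1)"
  shows "isomorphic_complexes X real_line_complex"
proof -
  have lV: "l i \<in> V" for i using line_adj[OF l] adj_V by blast
  have "v \<in> range l" if "v \<in> V" for v
  proof (rule adj_connected[OF connected, of "\<lambda>v. v \<in> range l" "l 0" v])
    show "w \<in> range l" if "adj u w" "u \<in> range l" for u w using that nb by blast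
  qed (use lV that in auto)
  then have Vl: "V = range l" using lV by blast
  define F where "F = inv l"
  have Fl: "F (l i) = i" for i unfolding F_def using line_inj[OF l] by simp
  have cube: "Q \<in> X \<longleftrightarrow> (\<exists>i. Q = {l i} \<or> Q = {l i, l (i + 1)})" for Q
  proof
    assume Q: "Q \<in> X"
    obtain n \<phi> where ch: "cube_chart X n \<phi> Q" using Q by (rule cube_cases)
    consider "n = 0" | "n = 1" | "n \<ge> 2" by linarith
    then show "\<exists>i. Q = {l i} \<or> Q = {l i, l (i + 1)}"
    proof cases
      case 1
      then have "Q = {\<phi> {}}" using chart_image[OF ch] by simp
      moreover have "\<phi> {} \<in> V" using calculation Q cube_subset_V by blast
      ultimately show ?thesis using Vl by blast
    next
      case 2
      have "{..<Suc 0} = {0}" by auto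
      then have "Q = {\<phi> {}, \<phi> {0}}" using chart_image[OF ch] 2 by (auto simp: Pow_insert)
      moreover have a: "adj (\<phi> {}) (\<phi> {0})" using adj_chart_flip[OF ch, of "{}" 0] 2 by (simp add: flip_def)
      moreover obtain i where "\<phi> {} = l i" using a adj_V Vl by blast
      moreover have "\<phi> {0} = l (i + 1) \<or> \<phi> {0} = l (i - 1)" using nb a calculation(3) by simp
      ultimately have "Q = {l i, l (i + 1)} \<or> Q = {l (i - 1), l (i - 1 + 1)}" by auto
      then show ?thesis by blast
    next
      case 3
      have s: "sq (\<phi> {}) (\<phi> (flip 0 {})) (\<phi> (flip 1 (flip 0 {}))) (\<phi> (flip 1 {}))"
        using sq_chart_flip[OF ch, of "{}" 0 1] 3 by simp
      obtain v a c b where s: "sq v a c b" using s by blast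
      obtain i where i: "v = l i" using sq_adj[OF s] adj_V Vl by blast
      have c: "c \<in> H a v" "c \<in> H b v"
        using sq_H'[OF s] sq_H'[OF sq_flip[OF s]] H_self(1) sq_adj[OF s] by auto
      have "{a, b} = {l (i + 1), l (i - 1)}"
        using nb[of i a] nb[of i b] sq_adj[OF s] sq_neq[OF s] i by auto
      then have "c \<in> H (l (i + 1)) (l i)" "c \<in> H (l (i - 1)) (l i)"
        using c i by (auto simp: doubleton_eq_iff)
      then have "c \<in> L l i" "c \<in> V - L l (i - 1)"
        using L_compl[OF l, of "i - 1"] by (simp_all add: L_def)
      then show ?thesis using L_step[OF l, of "i - 1"] by auto
    qed
  next
    assume "\<exists>i. Q = {l i} \<or> Q = {l i, l (i + 1)}"
    then show "Q \<in> X" using vertex_cube lV line_adj[OF l] unfolding adj_def edges_def by blast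
  qed
  have "bij_betw F (verts X) UNIV"
    unfolding V_def[symmetric] Vl F_def using line_inj[OF l] by (simp add: inj_imp_bij_betw_inv)
  moreover have "verts real_line_complex = UNIV"
    by (auto simp: verts_def real_line_complex_def)
  moreover have "(\<lambda>Q. F ` Q) ` X = real_line_complex"
  proof -
    have "X = range (\<lambda>i. {l i}) \<union> range (\<lambda>i. {l i, l (i + 1)})" using cube by auto
    moreover have "(\<lambda>Q. F ` Q) ` (range (\<lambda>i. {l i}) \<union> range (\<lambda>i. {l i, l (i + 1)})) = real_line_complex"
      by (simp add: image_Un image_image Fl real_line_complex_def)
    ultimately show ?thesis by (simp only:)
  qed
  ultimately show ?thesis unfolding isomorphic_complexes_def cubical_iso_def by metis
qed

end

section \<open>Lines through every edge\<close>

locale nonextremal = cat0 +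
  assumes nonextremal: "\<not> (\<exists>v. extremal_vertex X v)"
begin

text \<open>Nonextremality gives an edge spanning no square with the given one, and by
  \<open>spans_square\<close> the halfspaces behind the two are then disjoint.\<close>

lemma disjoint_edge:
  assumes "adj v a" obtains b where "adj v b" "H a v \<inter> H b v = {}"
proof -
  have e: "{v, a} \<in> edges X" "v \<in> verts X" using assms adj_V by (auto simp: adj_def V_def)
  then obtain e' where e': "e' \<in> edges X" "v \<in> e'" "e' \<noteq> {v, a}" "\<And>Q. Q \<in> squares X \<Longrightarrow> \<not> {v, a} \<union> e' \<subseteq> Q"
    using nonextremal unfolding extremal_vertex_def by (metis insertI1)
  obtain p q where pq: "e' = {p, q}" "adj p q" using e'(1) by (rule edge_cases)
  then obtain b where b: "e' = {v, b}" "adj v b" using e'(2) adj_sym by (metis insert_commute insertE singletonD)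
  then have "a \<noteq> b" using e'(3) by blast
  have "H a v \<inter> H b v = {}"
  proof (rule ccontr)
    assume "H a v \<inter> H b v \<noteq> {}"
    then obtain c where "sq v a c b" using spans_square[OF assms b(2) \<open>a \<noteq> b\<close>] by blast
    then show False using e'(4)[of "{v, a, c, b}"] b(1) by (auto simp: sq_def)
  qed
  then show ?thesis using that b by blast
qed

lemma ray_ex: assumes "adj a b" obtains r where "ray r" "r 0 = a" "r 1 = b"
proof -
  \<comment> \<open>The state is the last edge traversed; the next vertex is chosen so that the
    halfspaces behind and ahead are disjoint.\<close>
  define nx where "nx p = (snd p, SOME c. adj (snd p) c \<and> H (fst p) (snd p) \<inter> H c (snd p) = {})" for p :: "'a \<times> 'a"
  define s where "s n = (nx ^^ n) (a, b)" for n
  define r where "r n = fst (s n)" for n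
  have s_Suc: "s (Suc n) = nx (s n)" for n by (simp add: s_def)
  have snd_s: "snd (s n) = r (Suc n)" for n by (simp add: r_def s_Suc nx_def)
  have nxt: "adj (r (Suc n)) (r (Suc (Suc n))) \<and> H (r n) (r (Suc n)) \<inter> H (r (Suc (Suc n))) (r (Suc n)) = {}"
    if an: "adj (r n) (r (Suc n))" for n
  proof -
    have e: "s (Suc n) = (r (Suc n), SOME c. adj (r (Suc n)) c \<and> H (r n) (r (Suc n)) \<inter> H c (r (Suc n)) = {})"
      by (simp add: s_Suc nx_def snd_s r_def[symmetric])
    have "r (Suc (Suc n)) = (SOME c. adj (r (Suc n)) c \<and> H (r n) (r (Suc n)) \<inter> H c (r (Suc n)) = {})"
      using snd_s[of "Suc n"] e by simp
    moreover obtain c where "adj (r (Suc n)) c \<and> H (r n) (r (Suc n)) \<inter> H c (r (Suc n)) = {}"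
      using disjoint_edge[OF adj_sym[OF an]] by blast
    ultimately show ?thesis
      using someI[of "\<lambda>c. adj (r (Suc n)) c \<and> H (r n) (r (Suc n)) \<inter> H c (r (Suc n)) = {}" c] by simp
  qed
  have r01: "r 0 = a" "r 1 = b" using snd_s[of 0] by (simp_all add: r_def s_def)
  have adj: "adj (r n) (r (Suc n))" for n
    by (induction n) (use r01 assms nxt in auto)
  have "ray r"
    unfolding ray_def
  proof (intro allI conjI)
    fix n
    show "H (r (Suc (Suc n))) (r (Suc n)) \<subseteq> H (r (Suc n)) (r n)"
      using nxt[OF adj, of n] H_compl[OF adj, of n] H_subset by blast
  qed (rule adj)
  then show ?thesis using that r01 by blast
qed

lemma line_of_ray: assumes r: "ray r" obtains l where "line l" "\<And>n. l (int n) = r n"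
proof -
  \<comment> \<open>The backward ray starts with the reversed first edge of \<open>r\<close>;
    overlapping in this edge, the two rays supply the condition for a line at both of its
    ends.\<close>
  obtain s where s: "ray s" "s 0 = r 1" "s 1 = r 0"
    using ray_ex[OF adj_sym[OF ray_adj[OF r, of 0]]] by auto
  define l where "l i = (if i \<ge> 0 then r (nat i) else s (nat (1 - i)))" for i
  have pos: "l i = r (nat i)" if "i \<ge> 0" for i using that by (simp add: l_def)
  have neg: "l i = s (nat (1 - i))" if "i \<le> 1" for i
    using that s by (cases "i = 0"; cases "i = 1") (auto simp: l_def)
  have "line l" unfolding line_def
  proof
    fix i
    show "adj (l i) (l (i + 1)) \<and> H (l (i + 2)) (l (i + 1)) \<subseteq> H (l (i + 1)) (l i)"
    proof (cases "i \<ge> 0")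
      case True
      then have "nat (i + 1) = Suc (nat i)" "nat (i + 2) = Suc (Suc (nat i))" by auto
      then show ?thesis using True r unfolding ray_def by (simp add: pos)
    next
      case False
      define n where "n = nat (- 1 - i)"
      have n: "nat (1 - i) = Suc (Suc n)" "nat (1 - (i + 1)) = Suc n" "nat (1 - (i + 2)) = n"
        using False by (auto simp: n_def)
      have e: "l i = s (Suc (Suc n))" "l (i + 1) = s (Suc n)" "l (i + 2) = s n"
        using False n neg by simp_all
      have a: "adj (s n) (s (Suc n))" "adj (s (Suc n)) (s (Suc (Suc n)))" using ray_adj[OF s(1)] by blast+
      have "H (s (Suc (Suc n))) (s (Suc n)) \<subseteq> H (s (Suc n)) (s n)" using s(1) by (simp add: ray_def)
      then have "H (s n) (s (Suc n)) \<subseteq> H (s (Suc n)) (s (Suc (Suc n)))"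
        using H_compl[OF adj_sym[OF a(1)]] H_compl[OF adj_sym[OF a(2)]] by blast
      then show ?thesis using e a adj_sym by simp
    qed
  qed
  moreover have "l (int n) = r n" for n by (simp add: pos)
  ultimately show ?thesis using that by blast
qed

lemma line_ex: assumes "adj a b" obtains l where "line l" "l 0 = a" "l 1 = b"
proof -
  obtain r where r: "ray r" "r 0 = a" "r 1 = b" using ray_ex assms by blast
  obtain l where l: "line l" "\<And>n. l (int n) = r n" using line_of_ray[OF r(1)] by blast
  then show ?thesis using that l(2)[of 0] l(2)[of 1] r by simp
qed

definition ray_ends :: "'a set set set" where "ray_ends = {ray_end r | r. ray r}"

lemma ray_ends_bd: "x \<in> ray_ends \<Longrightarrow> x \<in> bd"
  unfolding ray_ends_def using en_bd by blast

lemma up_ray_ends: "line l \<Longrightarrow> up l \<in> ray_ends"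
  unfolding ray_ends_def up_def using line_ray[of l 0] by auto

lemma dn_ray_ends: "line l \<Longrightarrow> dn l \<in> ray_ends"
  using up_ray_ends[OF line_rev] dn_rev by simp

text \<open>In an exceptional pair every vertex has exactly one edge pointing away from both points;
  the model is \<open>\<real> \<times> Z\<close> with the two points over the same end of \<open>\<real>\<close> and \<open>Z\<close> the interval
  between their other coordinates.\<close>

definition exceptional :: "'a set set \<Rightarrow> 'a set set \<Rightarrow> bool" where
  "exceptional x y \<longleftrightarrow> x \<in> bd \<and> y \<in> bd \<and> \<not> perp x y \<and>
     (\<forall>z\<in>ray_ends. \<forall>u\<in>ray_ends. perp z x \<and> perp z y \<and> perp u x \<and> perp u y \<longrightarrow> \<not> perp z u)"

context
  fixes x y assumes exc: "exceptional x y"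
begin

lemma Ux: "U x" and Uy: "U y"
  using exc bd_U by (auto simp: exceptional_def)

definition zero :: "'a \<Rightarrow> 'a \<Rightarrow> bool" where "zero v g \<longleftrightarrow> adj v g \<and> H g v \<notin> x \<and> H g v \<notin> y"

definition both :: "'a \<Rightarrow> 'a \<Rightarrow> bool" where "both v e \<longleftrightarrow> adj v e \<and> H e v \<in> x \<and> H e v \<in> y"

lemma both_ex: assumes "v \<in> V" obtains e where "both v e"
proof -
  have "infinite (gp v x y)" using exc perp_iff[OF Ux assms] by (simp add: exceptional_def)
  then have "gp v x y \<noteq> {}" by auto
  then obtain h where h: "h \<in> x" "h \<in> y" "v \<notin> h" by (auto simp: gp_def)
  obtain a where a: "adj v a" "h \<subseteq> H a v" "H a v \<in> x" using U_gate[OF Ux h(1) assms h(3)] .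
  then have "H a v \<in> y" using U_up[OF Uy h(2)] HS_I adj_sym by blast
  then show ?thesis using that a by (simp add: both_def)
qed

lemma both_disjoint_zero: assumes "both v e" "adj v b" "H e v \<inter> H b v = {}" shows "zero v b"
  using assms U_meet[OF Ux, of "H e v" "H b v"] U_meet[OF Uy, of "H e v" "H b v"]
  by (auto simp: zero_def both_def)

lemma zero_ex: assumes "v \<in> V" obtains g where "zero v g"
  using both_ex[OF assms] both_disjoint_zero disjoint_edge by (metis both_def)

lemma zero_ray:
  assumes "zero v g" "ray r" "r 0 = v" "r 1 = g"
  shows "perp (ray_end r) x" "perp (ray_end r) y" "ray_end r \<in> ray_ends"
proof -
  have "K r 0 \<notin> x" "K r 0 \<notin> y" using assms by (simp_all add: K_def zero_def)
  then show "perp (ray_end r) x" "perp (ray_end r) y"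
    using ray_away[OF assms(2) Ux] ray_away[OF assms(2) Uy] ray_V[OF assms(2)] perp_sym Ux Uy perp_I by metis+
  show "ray_end r \<in> ray_ends" using assms(2) ray_ends_def by blast
qed

lemma zero_rays_not_perp:
  assumes "zero v g" "ray r" "r 0 = v" "r 1 = g" "zero v' g'" "ray r'" "r' 0 = v'" "r' 1 = g'"
  shows "K r n \<in> ray_end r'"
proof -
  have "\<not> perp (ray_end r) (ray_end r')"
    using zero_ray[OF assms(1-4)] zero_ray[OF assms(5-8)] exc by (simp add: exceptional_def)
  then show ?thesis using not_perp_en[OF assms(2) en_U[OF assms(6)]] by blast
qed

text \<open>Rays starting with two such edges have ends with infinite product, so the second ray
  ends behind the first edge of the first ray; by \<open>en_first_edge\<close> it starts with that
  edge.\<close>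

lemma zero_unique: assumes "zero v g" "zero v g'" shows "g = g'"
proof -
  obtain r where r: "ray r" "r 0 = v" "r 1 = g" using ray_ex assms(1) by (metis zero_def)
  obtain r' where r': "ray r'" "r' 0 = v" "r' 1 = g'" using ray_ex assms(2) by (metis zero_def)
  have "K r 0 \<in> ray_end r'" using zero_rays_not_perp[OF assms(1) r assms(2) r'] .
  then show ?thesis using en_first_edge[OF r'(1), of g] r r' assms(1) by (simp add: K_def zero_def)
qed

lemma both_back_zero: assumes "both v e" shows "zero e v"
  using assms U_H[OF Ux, of v e] U_H[OF Uy, of v e] adj_sym by (auto simp: both_def zero_def)

lemma both_zero_disjoint: assumes "both v e" "zero v g" shows "H e v \<inter> H g v = {}"
proof -
  obtain b where "adj v b" "H e v \<inter> H b v = {}" using disjoint_edge assms by (metis both_def)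
  then show ?thesis using both_disjoint_zero[OF assms(1)] zero_unique[OF assms(2)] by metis
qed

text \<open>Edges towards both points are followed. An edge disjoint from such an edge points away
  from both points, as does the edge back; since there is only one of that kind, the path is
  straight.\<close>

lemma exceptional_ray: obtains c where "ray c" "\<not> perp (ray_end c) x" "\<not> perp (ray_end c) y"
proof -
  obtain v0 where v0: "v0 \<in> V" using base_V by blast
  define m where "m v = (SOME e. both v e)" for v
  have m: "both v (m v)" if "v \<in> V" for v using both_ex[OF that] someI_ex unfolding m_def by metis
  define c where "c n = (m ^^ n) v0" for n
  have cV: "c n \<in> V" for n
  proof (induction n)
    case (Suc n) then show ?case using m[of "c n"] adj_V(2) by (auto simp: c_def both_def)
  qed (simp add: c_def v0)
  have b: "both (c n) (c (Suc n))" for n using m[OF cV[of n]] by (simp add: c_def)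
  have "ray c" unfolding ray_def
  proof (intro allI conjI)
    fix n show a: "adj (c n) (c (Suc n))" using b both_def by blast
    show "H (c (Suc (Suc n))) (c (Suc n)) \<subseteq> H (c (Suc n)) (c n)"
      using both_zero_disjoint[OF b both_back_zero[OF b], of n] H_compl[OF a] H_subset by blast
  qed
  moreover have "K c n \<in> x" "K c n \<in> y" for n using b[of n] by (simp_all add: both_def K_def)
  ultimately show ?thesis using that not_perp_en Ux Uy by blast
qed

text \<open>A third neighbour \<open>b\<close> of \<open>l i\<close> lies towards \<open>y\<close>
  but not towards \<open>x\<close>: only \<open>l (i + 1)\<close> lies towards \<open>x\<close>, and
  only \<open>l (i - 1)\<close> away from both. Comparing rays with infinite product shows that the
  edge at \<open>b\<close> away from both points leads back to \<open>l i\<close>, although this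
  direction is towards \<open>x\<close>.\<close>

lemma exceptional_line:
  assumes "x \<in> ray_ends" shows "isomorphic_complexes X real_line_complex"
proof -
  obtain r where r: "ray r" "x = ray_end r" using assms by (auto simp: ray_ends_def)
  obtain l where l: "line l" "\<And>n. l (int n) = r n" using line_of_ray[OF r(1)] by blast
  have xl: "x = up l" using r(2) l(2) by (simp add: up_def)
  have np: "\<not> perp x y" using exc by (simp add: exceptional_def)
  have Lx: "L l i \<in> x" for i using L_up[OF l(1)] xl by simp
  have Ly: "L l i \<in> y" for i using np not_perp_up[OF l(1) Uy] xl by blast
  have z: "zero (l i) (l (i - 1))" for i
  proof -
    have "both (l (i - 1)) (l i)"
      using Lx[of "i - 1"] Ly[of "i - 1"] line_adj[OF l(1), of "i - 1"] by (simp add: both_def L_def)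
    then show ?thesis by (rule both_back_zero)
  qed
  have first: "a = l (i + 1)" if "adj (l i) a" "H a (l i) \<in> x" for a i
    using en_first_edge[OF line_ray[OF l(1), of i], of a] that up_shift[OF l(1)] xl by simp
  show ?thesis
  proof (rule line_complex[OF l(1)], rule ccontr)
    fix i b assume b: "adj (l i) b" "\<not> (b = l (i + 1) \<or> b = l (i - 1))"
    have bx: "H b (l i) \<notin> x" using first b by blast
    have by': "H b (l i) \<in> y" using zero_unique[OF z, of i b] b bx by (auto simp: zero_def)
    obtain c where c: "adj (l i) c" "H b (l i) \<inter> H c (l i) = {}" using disjoint_edge[OF b(1)] .
    have cy: "H c (l i) \<notin> y" using c(2) by' U_meet[OF Uy] by blast
    then have "H c (l i) \<notin> x" using first[OF c(1)] Ly[of i] by (auto simp: L_def)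
    then have zc: "zero (l i) c" using c cy by (simp add: zero_def)
    obtain g where g: "zero b g" using zero_ex[OF adj_V(2)[OF b(1)]] .
    obtain s where s: "ray s" "s 0 = l i" "s 1 = c" using ray_ex[OF c(1)] .
    obtain t where t: "ray t" "t 0 = b" "t 1 = g" using ray_ex g by (metis zero_def)
    have "K s 0 \<in> ray_end t" using zero_rays_not_perp[OF zc s g t] .
    moreover have "H c (l i) \<subseteq> H (l i) b" using c(2) H_compl[OF adj_sym[OF b(1)]] H_subset[of c "l i"] by blast
    then have "K s 0 \<subseteq> H (l i) b" using s by (simp add: K_def)
    ultimately have "H (l i) b \<in> ray_end t" using U_up[OF en_U[OF t(1)]] HS_I[OF b(1)] by blast
    then have "l i = g" using en_first_edge[OF t(1), of "l i"] t adj_sym[OF b(1)] by simp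
    then show False using g bx U_H[OF Ux b(1)] by (simp add: zero_def)
  qed
qed

end

lemma not_exceptional:
  assumes "\<not> isomorphic_complexes X real_line_complex" "x \<in> ray_ends" "y \<in> bd" "\<not> perp x y"
  obtains z u where "z \<in> ray_ends" "u \<in> ray_ends" "perp z x" "perp z y" "perp u x" "perp u y" "perp z u"
  using exceptional_line[of x y] assms ray_ends_bd unfolding exceptional_def by blast

text \<open>A ray leaving the line through a third edge at \<open>l i\<close> has position
  \<open>i\<close>.\<close>

lemma finite_position_ex:
  assumes "\<not> isomorphic_complexes X real_line_complex" and l: "line l"
  obtains u p where "u \<in> bd" "has_position l p u"
proof -
  obtain i b where b: "adj (l i) b" "b \<noteq> l (i + 1)" "b \<noteq> l (i - 1)"
    using line_complex[OF l] assms(1) by blast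
  obtain r where r: "ray r" "r 0 = l i" "r 1 = b" using ray_ex[OF b(1)] .
  have 1: "L l i \<notin> ray_end r" using en_first_edge[OF r(1), of "l (i + 1)"] line_adj[OF l, of i] r b by (auto simp: L_def)
  have "V - L l (i - 1) \<notin> ray_end r"
    using en_first_edge[OF r(1), of "l (i - 1)"] line_adj'[OF l, of i] r b L_compl[OF l, of "i - 1"] by auto
  then have 2: "L l (i - 1) \<in> ray_end r" using U_compl[OF en_U[OF r(1)] L_HS[OF l]] by blast
  have "has_position l i (ray_end r)" unfolding has_position_def
  proof
    fix j
    show "L l j \<in> ray_end r \<longleftrightarrow> j < i"
      using 1 2 U_up[OF en_U[OF r(1)] _ L_HS[OF l] L_mono[OF l]] by (metis not_less zle_diff1_eq)
  qed
  then show ?thesis using that en_bd[OF r(1)] by blast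
qed

end

section \<open>Gromov products and branching\<close>

lemma ecard_Un_Int: "ecard A + ecard B = ecard (A \<union> B) + ecard (A \<inter> B)"
  using card_Un_Int[of A B] by (auto simp: ecard_def)

lemma ecard_mono: "A \<subseteq> B \<Longrightarrow> ecard A \<le> ecard B"
  by (auto simp: ecard_def card_mono finite_subset)

lemma ecard_eq_infinity: "ecard A = \<infinity> \<longleftrightarrow> infinite A"
  by (simp add: ecard_def)

context cat0
begin

definition crossing_edges :: "'a set \<Rightarrow> 'a set set" where
  "crossing_edges h = {{p, q} | p q. adj p q \<and> p \<in> h \<and> q \<notin> h}"

lemma hyp_eq: assumes "adj a b" shows "hyp a b = crossing_edges (H a b)"
proof (intro set_eqI iffI)
  fix e assume "e \<in> hyp a b"
  then obtain p q where "e = {p, q}" "adj p q" "H p q = H a b"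
    using class_H[OF _ assms] unfolding hyp_def by blast
  then show "e \<in> crossing_edges (H a b)" using H_self[of p q] unfolding crossing_edges_def by auto
next
  fix e assume "e \<in> crossing_edges (H a b)"
  then show "e \<in> hyp a b" using edge_in_hyp[OF assms] unfolding crossing_edges_def by auto
qed

lemma crossing_edges_inj:
  assumes "h \<in> HS" "k \<in> HS" "crossing_edges h = crossing_edges k" "v \<in> V" "v \<notin> h" "v \<notin> k" shows "h = k"
proof -
  obtain a b where ab: "adj a b" "h = H a b" using assms(1) by (rule HS_E)
  then have "{a, b} \<in> crossing_edges k" using H_self[OF ab(1)] assms(3) unfolding crossing_edges_def by blast
  then have "(a \<in> k \<and> b \<notin> k) \<or> (b \<in> k \<and> a \<notin> k)" unfolding crossing_edges_def by (auto simp: doubleton_eq_iff)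
  then have "k = H a b \<or> k = H b a" using crossed ab(1) adj_sym assms(2) by blast
  then show ?thesis using ab assms(4-6) H_compl[OF ab(1)] by blast
qed

text \<open>A counted hyperplane is recorded by its side away from \<open>v\<close>, and recovered
  from it as the set of edges leaving that side.\<close>

lemma gromov_eq:
  assumes v: "v \<in> V" and x: "U x" shows "gromov_product X v x y = ecard (gp v x y)"
proof -
  have sg: "V - h \<in> \<sigma> v \<longleftrightarrow> v \<notin> h" if "h \<in> HS" for h
    using that v HS_compl by (auto simp: sigma_eq)
  have "separating X {\<sigma> v} {x, y} = crossing_edges ` gp v x y"
  proof (intro set_eqI iffI)
    fix W assume "W \<in> separating X {\<sigma> v} {x, y}"
    then obtain h where W: "W \<in> hyperplanes X" "h \<in> sides X W" "h \<in> x" "h \<in> y" "V - h \<in> \<sigma> v"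
      unfolding separating_def V_def by auto
    obtain a b where ab: "adj a b" "W = hyp a b" using W(1) hyperplanes_eq by blast
    then have "h = H a b \<or> h = H b a" using W(2) sides_hyp by blast
    then have "W = crossing_edges h" using hyp_eq ab adj_sym hyp_commute by metis
    moreover have "h \<in> gp v x y" using W sg U_HS[OF x] by (simp add: gp_def)
    ultimately show "W \<in> crossing_edges ` gp v x y" by blast
  next
    fix W assume "W \<in> crossing_edges ` gp v x y"
    then obtain h where h: "W = crossing_edges h" "h \<in> x" "h \<in> y" "v \<notin> h" by (auto simp: gp_def)
    have hH: "h \<in> HS" using U_HS x h by blast
    then obtain a b where ab: "adj a b" "h = H a b" by (rule HS_E)
    have "W = hyp a b" using h ab hyp_eq by simp
    then have "W \<in> hyperplanes X" "h \<in> sides X W" using ab hyperplanes_eq sides_hyp by blast+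
    moreover have "V - h \<in> \<sigma> v" using sg[OF hH] h by simp
    ultimately show "W \<in> separating X {\<sigma> v} {x, y}" using h unfolding separating_def V_def by auto
  qed
  moreover have "inj_on crossing_edges (gp v x y)"
    by (rule inj_onI) (use crossing_edges_inj[OF _ _ _ v] U_HS[OF x] in \<open>auto simp: gp_def\<close>)
  ultimately show ?thesis
    unfolding gromov_product_def ecard_def by (simp add: card_image finite_image_iff)
qed

text \<open>The Gromov product at the base vertex used by \<open>admissible\<close> and \<open>cross_ratio\<close>.\<close>

definition e :: "'a set set \<Rightarrow> 'a set set \<Rightarrow> enat" where
  "e x y = gromov_product X (base_vertex X) x y"

lemma e_eq: "U x \<Longrightarrow> e x y = ecard (gp (base_vertex X) x y)"
  unfolding e_def using gromov_eq base_V by blast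

lemma e_perp: "U x \<Longrightarrow> e x y = \<infinity> \<longleftrightarrow> \<not> perp x y"
  by (simp add: e_eq ecard_eq_infinity perp_def)

lemma e_sym: "U x \<Longrightarrow> U y \<Longrightarrow> e x y = e y x"
  by (simp add: e_eq gp_sym)

text \<open>No hyperplane separates \<open>x, u\<close> from \<open>y, w\<close>; it suffices to look at the sides containing
  \<open>x, u\<close>, see \<open>nosep_sym\<close>.\<close>

definition nosep :: "'a set set \<Rightarrow> 'a set set \<Rightarrow> 'a set set \<Rightarrow> 'a set set \<Rightarrow> bool" where
  "nosep x u y w \<longleftrightarrow> (\<forall>h\<in>HS. h \<in> x \<and> h \<in> u \<longrightarrow> h \<in> y \<or> h \<in> w)"

lemma nosep_sym:
  assumes "U x" "U u" "U y" "U w" "nosep x u y w" shows "nosep y w x u"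
  unfolding nosep_def
proof (intro ballI impI)
  fix h assume h: "h \<in> HS" "h \<in> y \<and> h \<in> w"
  show "h \<in> x \<or> h \<in> u"
  proof (rule ccontr)
    assume "\<not> ?thesis"
    then have "V - h \<in> x" "V - h \<in> u" using U_compl assms h(1) by blast+
    then have "V - h \<in> y \<or> V - h \<in> w" using assms(5) HS_compl[OF h(1)] unfolding nosep_def by blast
    then show False using U_compl assms h by blast
  qed
qed

text \<open>The two sets counted on the left have their union and their intersection inside those of
  the two sets on the right; \<open>ecard_Un_Int\<close> turns this into the inequality, also for
  infinite values.\<close>

lemma nosep_le:
  assumes U: "U x" "U u" "U y" "U w" and n: "nosep x u y w"
  shows "e x u + e y w \<le> e x y + e u w"
proof -
  let ?g = "gp (base_vertex X)"
  have "?g x u \<union> ?g y w \<subseteq> ?g x y \<union> ?g u w"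
    using n nosep_sym[OF U n] U_HS U unfolding nosep_def gp_def by blast
  moreover have "?g x u \<inter> ?g y w \<subseteq> ?g x y \<inter> ?g u w" by (auto simp: gp_def)
  ultimately show ?thesis
    unfolding e_eq[OF U(1)] e_eq[OF U(2)] e_eq[OF U(3)] ecard_Un_Int[of "?g x u"] ecard_Un_Int[of "?g x y"]
    by (intro add_mono ecard_mono)
qed

text \<open>The inclusion behind \<open>nosep_le\<close>, with \<open>y\<close> and \<open>u\<close>
  exchanged, is made strict by a hyperplane separating \<open>x, u\<close> from \<open>y, w\<close>:
  its side away from the base vertex is counted only in the larger sum. Finiteness of the smaller
  sum keeps the inequality strict.\<close>

lemma sep_less:
  assumes U: "U x" "U u" "U y" "U w" and n: "nosep x y u w" and s: "\<not> nosep x u y w"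
    and fin: "perp x y" "perp u w"
  shows "e x y + e u w < e x u + e y w"
proof -
  let ?g = "gp (base_vertex X)"
  let ?A = "?g x u" and ?B = "?g y w" and ?C = "?g x y" and ?D = "?g u w"
  have sub: "?C \<union> ?D \<subseteq> ?A \<union> ?B"
    using n nosep_sym[OF U(1,3,2,4) n] U_HS U unfolding nosep_def gp_def by blast
  have int: "?C \<inter> ?D = ?A \<inter> ?B" by (auto simp: gp_def)
  obtain h where h: "h \<in> HS" "h \<in> x" "h \<in> u" "h \<notin> y" "h \<notin> w" using s unfolding nosep_def by blast
  have "\<exists>k. k \<in> ?A \<union> ?B \<and> k \<notin> ?C \<union> ?D"
  proof (cases "base_vertex X \<in> h")
    case False
    then show ?thesis using h by (intro exI[of _ h]) (auto simp: gp_def)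
  next
    case True
    then show ?thesis using h U_compl[OF U(1) h(1)] U_compl[OF U(2) h(1)] U_compl[OF U(3) h(1)] U_compl[OF U(4) h(1)]
      by (intro exI[of _ "V - h"]) (auto simp: gp_def)
  qed
  then have ss: "?C \<union> ?D \<subset> ?A \<union> ?B" using sub by blast
  have f: "finite ?C" "finite ?D" using fin by (simp_all add: perp_def)
  show ?thesis
  proof (cases "finite (?A \<union> ?B)")
    case True
    then have "card (?C \<union> ?D) < card (?A \<union> ?B)" by (rule psubset_card_mono[OF _ ss])
    then have "ecard (?C \<union> ?D) + ecard (?C \<inter> ?D) < ecard (?A \<union> ?B) + ecard (?A \<inter> ?B)"
      using True f by (simp add: ecard_def int del: Un_Int_eq)
    then show ?thesis
      unfolding e_eq[OF U(1)] e_eq[OF U(2)] e_eq[OF U(3)] ecard_Un_Int[of ?A] ecard_Un_Int[of ?C] .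
  next
    case False
    then have "ecard ?A + ecard ?B = \<infinity>" by (auto simp: ecard_def)
    moreover have "ecard ?C + ecard ?D < \<infinity>" using f by (simp add: ecard_def)
    ultimately show ?thesis by (simp add: e_eq[OF U(1)] e_eq[OF U(2)] e_eq[OF U(3)])
  qed
qed

text \<open>Witnesses against both alternatives would separate the ends of \<open>l\<close> and
  hence be nested, but each of \<open>u\<close> and \<open>w\<close> contains exactly one of them,
  and not the same one. With \<open>nosep_le\<close> this gives the inequality for the ends of a
  line.\<close>

lemma line_nosep:
  assumes l: "line l" and U: "U u" "U w"
  shows "nosep (up l) w (dn l) u \<or> nosep (up l) u (dn l) w"
proof (rule ccontr)
  assume "\<not> ?thesis"
  then obtain h k where h: "h \<in> up l" "h \<in> w" "h \<notin> dn l" "h \<notin> u" and k: "k \<in> up l" "k \<in> u" "k \<notin> dn l" "k \<notin> w"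
    unfolding nosep_def by blast
  obtain i j where ij: "h = L l i" "k = L l j" using up_dn_L[OF l] h k by metis
  have "h \<subseteq> k \<or> k \<subseteq> h" using L_mono[OF l] ij by (meson linear)
  then show False using U_up U h k L_HS[OF l] ij by metis
qed

text \<open>Both sides count the same hyperplanes with the same multiplicities, except those of
  index \<open>i\<close> with \<open>p \<le> i\<close> and \<open>i < q\<close>, each of which is
  counted once more on the left.\<close>

lemma position_count:
  assumes l: "line l" and U: "U u" "U w" and p: "has_position l p u" and q: "has_position l q w" and pq: "p \<le> q"
  shows "e (dn l) u + e (up l) w = e (dn l) w + e (up l) u + enat (nat (q - p))"
proof -
  define b where "b = base_vertex X"
  have bV: "b \<in> V" using base_V by (simp add: b_def)
  let ?A = "gp b (dn l) u" and ?B = "gp b (up l) w" and ?C = "gp b (dn l) w" and ?D = "gp b (up l) u"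
  have Ul: "U (dn l)" "U (up l)" using dn_bd up_bd l bd_U by blast+
  \<comment> \<open>The hyperplane of index \<open>i\<close> is recorded by its side away from the
    base vertex.\<close>
  define g where "g i = (if b \<notin> L l i then L l i else V - L l i)" for i
  have gi: "inj g"
  proof (rule injI)
    fix i j assume ij: "g i = g j"
    have "L l i \<noteq> V - L l j" for i j using L_up[OF l] U_compl[OF Ul(2) L_HS[OF l]] by metis
    moreover have "V - L l i = V - L l j \<Longrightarrow> L l i = L l j" using HS_double_compl L_HS[OF l] by metis
    ultimately have "L l i = L l j" using ij unfolding g_def by (metis (full_types))
    then show "i = j" using L_inj[OF l] by blast
  qed
  have gb: "b \<notin> g i" for i by (simp add: g_def)
  let ?Z = "g ` {p..<q}"
  have Lu: "L l i \<in> u \<longleftrightarrow> i < p" and Lw: "L l i \<in> w \<longleftrightarrow> i < q" for i using p q by (auto simp: has_position_def)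
  have cu: "V - L l i \<in> u \<longleftrightarrow> p \<le> i" and cw: "V - L l i \<in> w \<longleftrightarrow> q \<le> i" for i
    using U_compl[OF U(1) L_HS[OF l]] U_compl[OF U(2) L_HS[OF l]] Lu Lw by auto
  have cl: "V - L l i \<in> dn l" "V - L l i \<notin> up l" for i
    using U_compl[OF Ul(1) L_HS[OF l]] U_compl[OF Ul(2) L_HS[OF l]] L_up[OF l] L_dn[OF l] by auto
  have Z1: "g i \<in> ?A \<union> ?B" "g i \<notin> ?C \<union> ?D" if "i \<in> {p..<q}" for i
    using that gb[of i] Lu[of i] Lw[of i] cu[of i] cw[of i] cl[of i] L_up[OF l, of i] L_dn[OF l, of i]
    by (auto simp: gp_def g_def)
  have Z2: "h \<in> ?C \<union> ?D \<or> h \<in> ?Z" if h: "h \<in> ?A \<union> ?B" for h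
  proof -
    have hH: "h \<in> HS" and hb: "b \<notin> h" using h U_HS Ul by (auto simp: gp_def)
    consider "h \<in> dn l" "h \<in> up l" | "h \<in> up l" "h \<notin> dn l" | "h \<in> dn l" "h \<notin> up l"
      using h by (auto simp: gp_def)
    then show ?thesis
    proof cases
      case 1 then show ?thesis using h by (auto simp: gp_def)
    next
      case 2
      obtain i where i: "h = L l i" using up_dn_L[OF l 2] .
      then have "i < q" using h 2 Lw by (auto simp: gp_def)
      then show ?thesis using i hb Lu[of i] 2 by (cases "i < p") (auto simp: gp_def g_def)
    next
      case 3
      have "V - h \<in> up l" "V - h \<notin> dn l" using 3 U_compl Ul hH by blast+
      then obtain i where "V - h = L l i" using up_dn_L[OF l] by metis
      then have i: "h = V - L l i" using HS_double_compl[OF hH] by simp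
      then have "p \<le> i" using h 3 cu by (auto simp: gp_def)
      then show ?thesis using i hb bV cw[of i] 3 by (cases "q \<le> i") (auto simp: gp_def g_def)
    qed
  qed
  have Z3: "h \<in> ?A \<union> ?B" if h: "h \<in> ?C \<union> ?D" for h
  proof -
    have hH: "h \<in> HS" and hb: "b \<notin> h" using h U_HS Ul by (auto simp: gp_def)
    consider "h \<in> dn l" "h \<in> up l" | "h \<in> up l" "h \<notin> dn l" | "h \<in> dn l" "h \<notin> up l"
      using h by (auto simp: gp_def)
    then show ?thesis
    proof cases
      case 1 then show ?thesis using h by (auto simp: gp_def)
    next
      case 2
      obtain i where i: "h = L l i" using up_dn_L[OF l 2] .
      then show ?thesis using h 2 Lu[of i] Lw[of i] pq by (auto simp: gp_def)
    next
      case 3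
      have "V - h \<in> up l" "V - h \<notin> dn l" using 3 U_compl Ul hH by blast+
      then obtain i where "V - h = L l i" using up_dn_L[OF l] by metis
      then have i: "h = V - L l i" using HS_double_compl[OF hH] by simp
      then show ?thesis using h 3 cu[of i] cw[of i] pq by (auto simp: gp_def)
    qed
  qed
  have un: "?A \<union> ?B = (?C \<union> ?D) \<union> ?Z" using Z1 Z2 Z3 by blast
  have dj: "(?C \<union> ?D) \<inter> ?Z = {}" using Z1(2) by blast
  have int: "?A \<inter> ?B = ?C \<inter> ?D" by (auto simp: gp_def)
  have Zc: "ecard ?Z = enat (nat (q - p))"
    using card_image[OF inj_on_subset[OF gi subset_UNIV]] by (simp add: ecard_def)
  have "ecard ((?C \<union> ?D) \<union> ?Z) = ecard (?C \<union> ?D) + ecard ?Z"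
    using ecard_Un_Int[of "?C \<union> ?D" ?Z] dj by (simp add: ecard_def zero_enat_def)
  then have "ecard ?A + ecard ?B = ecard ?C + ecard ?D + enat (nat (q - p))"
    unfolding ecard_Un_Int[of ?A] ecard_Un_Int[of ?C] un int Zc[symmetric] by (simp add: algebra_simps)
  then show ?thesis using e_eq[OF Ul(1)] e_eq[OF Ul(2)] by (simp add: b_def)
qed

text \<open>Crossing an edge at \<open>v\<close> into a halfspace shared by \<open>x\<close> and
  \<open>y\<close> removes exactly one element of \<open>gp v x y\<close>.\<close>

lemma interval_vertex:
  assumes "U x" "U y" "perp x y" obtains v where "v \<in> V" "gp v x y = {}"
proof -
  have "finite (gp v x y) \<Longrightarrow> v \<in> V \<Longrightarrow> \<exists>v\<in>V. gp v x y = {}" for v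
  proof (induction "card (gp v x y)" arbitrary: v rule: less_induct)
    case less
    show ?case
    proof (cases "gp v x y = {}")
      case False
      then obtain h where h: "h \<in> x" "h \<in> y" "v \<notin> h" by (auto simp: gp_def)
      obtain a where a: "adj v a" "h \<subseteq> H a v" "H a v \<in> x" using U_gate[OF assms(1) h(1) less.prems(2) h(3)] .
      have ay: "H a v \<in> y" using U_up[OF assms(2) h(2) _ a(2)] HS_I adj_sym a by blast
      have g: "gp a x y = gp v x y - {H a v}" using gp_step[OF assms(1) a(1,3) ay] .
      have "H a v \<in> gp v x y" using a ay H_self(2)[OF adj_sym[OF a(1)]] by (simp add: gp_def)
      then have "card (gp a x y) < card (gp v x y)" using g less.prems(1) by (metis card_Diff1_less)
      then show ?thesis using less.hyps[of a] less.prems g a adj_V by simp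
    qed (use less.prems in blast)
  qed
  then show ?thesis using that assms perp_iff base_V unfolding perp_def by metis
qed

text \<open>A halfspace \<open>h\<close> of \<open>y\<close> missing from the end would be avoided
  by \<open>l\<close> from some index on. Its gates there are the next vertices of \<open>l\<close>,
  so \<open>h\<close> would lie in infinitely many \<open>L l n\<close>, all separating a vertex of
  \<open>h\<close> from one vertex of \<open>l\<close>.\<close>

lemma line_end_eq:
  assumes l: "line l" and y: "U y" and only: "\<And>i a. adj (l i) a \<Longrightarrow> H a (l i) \<in> y \<Longrightarrow> a = l (i + 1)"
  shows "up l = y"
proof -
  have lV: "l i \<in> V" for i using line_adj[OF l] adj_V by blast
  have Uup: "U (up l)" using up_bd[OF l] bd_U by blast
  have "h \<in> up l" if h: "h \<in> y" for h
  proof (rule ccontr)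
    assume "h \<notin> up l"
    then have "V - h \<in> up l" using U_compl[OF Uup U_HS[OF y h]] by blast
    then obtain N where N: "\<And>n. n \<ge> N \<Longrightarrow> l (int n) \<notin> h" unfolding up_def ray_end_def by blast
    have sub: "h \<subseteq> L l (int n)" if n: "n \<ge> N" for n
    proof -
      obtain a where a: "adj (l (int n)) a" "h \<subseteq> H a (l (int n))" "H a (l (int n)) \<in> y"
        using U_gate[OF y h lV N[OF n]] .
      then show ?thesis using only[OF a(1,3)] by (simp add: L_def)
    qed
    obtain w where w: "w \<in> h" "w \<in> V" using HS_nonempty HS_subset U_HS[OF y h] by blast
    have "(\<lambda>n. L l (int n)) ` {N..} \<subseteq> {k \<in> HS. w \<in> k \<and> l (int N) \<notin> k}"
      using sub w L_HS[OF l] line_mem_L[OF l] by auto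
    moreover have "infinite ((\<lambda>n. L l (int n)) ` {N..})"
      using L_inj[OF l] by (subst finite_image_iff) (auto simp: inj_on_def infinite_Ici)
    ultimately show False using separating_finite[OF w(2) lV] finite_subset by blast
  qed
  then show ?thesis using U_ext[OF y Uup] by blast
qed

text \<open>Without branching, each vertex of the interval has a unique edge towards
  \<open>y\<close> and a unique one towards \<open>x\<close>. The two resulting maps preserve the
  interval and are inverse to each other, so iterating them gives a bi-infinite path.\<close>

lemma line_or_branch:
  assumes x: "x \<in> bd" and y: "y \<in> bd" and perp: "perp x y"
  obtains (line) l where "line l" "dn l = x" "up l = y"
  | (branch) v a b where "v \<in> V" "gp v x y = {}" "adj v a" "adj v b" "a \<noteq> b"
      "H a v \<in> x \<and> H b v \<in> x \<or> H a v \<in> y \<and> H b v \<in> y"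
proof (cases "\<exists>v a b. v \<in> V \<and> gp v x y = {} \<and> adj v a \<and> adj v b \<and> a \<noteq> b \<and>
      (H a v \<in> x \<and> H b v \<in> x \<or> H a v \<in> y \<and> H b v \<in> y)")
  case True
  then show ?thesis using branch by blast
next
  case False
  have Ux: "U x" and Uy: "U y" using x y bd_U by blast+
  define I where "I v \<longleftrightarrow> v \<in> V \<and> gp v x y = {}" for v
  have ux: "a = b" if "I v" "adj v a" "adj v b" "H a v \<in> x" "H b v \<in> x" for v a b
    using False that unfolding I_def by blast
  have uy: "a = b" if "I v" "adj v a" "adj v b" "H a v \<in> y" "H b v \<in> y" for v a b
    using False that unfolding I_def by blast
  have toward: "\<exists>a. adj v a \<and> H a v \<in> z" if "z \<in> bd" "v \<in> V" for v z
    using bd_gp_ex[OF that] U_gate[OF bd_U[OF that(1)]] that(2) by metis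
  define s where "s v = (SOME a. adj v a \<and> H a v \<in> y)" for v
  define t where "t v = (SOME a. adj v a \<and> H a v \<in> x)" for v
  have s: "adj v (s v)" "H (s v) v \<in> y" if "I v" for v
    using someI_ex[OF toward[OF y]] that unfolding s_def I_def by blast+
  have t: "adj v (t v)" "H (t v) v \<in> x" if "I v" for v
    using someI_ex[OF toward[OF x]] that unfolding t_def I_def by blast+
  have step: "I a" if Iv: "I v" and va: "adj v a" and xy: "H a v \<in> x \<or> H a v \<in> y" for v a
  proof -
    have "h \<notin> y \<or> a \<in> h" if h: "h \<in> x" for h
    proof (rule ccontr)
      assume "\<not> (h \<notin> y \<or> a \<in> h)"
      then have hy: "h \<in> y" "a \<notin> h" by blast+
      then have "v \<in> h" using Iv h by (auto simp: I_def gp_def)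
      then have "h = H v a" using crossed[OF va] U_HS Ux h hy by blast
      then show False using U_H[OF Ux va] U_H[OF Uy va] h hy xy by blast
    qed
    then show ?thesis using va adj_V unfolding I_def gp_def by blast
  qed
  have Is: "I (s v)" and It: "I (t v)" if "I v" for v using step s t that by blast+
  have notboth: "H a v \<notin> x \<or> H a v \<notin> y" if "I v" "adj v a" for v a
    using that H_self(2)[OF adj_sym[OF that(2)]] unfolding I_def gp_def by blast
  have ts: "t (s v) = v" if "I v" for v
  proof -
    have "H v (s v) \<in> x" using notboth[OF that s(1)[OF that]] s[OF that] U_H[OF Ux s(1)[OF that]] by blast
    then show ?thesis using ux[OF Is[OF that]] t[OF Is[OF that]] adj_sym s(1)[OF that] by blast
  qed
  have st: "s (t v) = v" if "I v" for v
  proof -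
    have "H v (t v) \<in> y" using notboth[OF that t(1)[OF that]] t[OF that] U_H[OF Uy t(1)[OF that]] by blast
    then show ?thesis using uy[OF It[OF that]] s[OF It[OF that]] adj_sym t(1)[OF that] by blast
  qed
  obtain v0 where v0: "I v0" using interval_vertex[OF Ux Uy perp] unfolding I_def by blast
  define l where "l i = (if i \<ge> 0 then (s ^^ nat i) v0 else (t ^^ nat (- i)) v0)" for i
  have Il: "I (l i)" for i
  proof -
    have "I ((s ^^ n) v0)" "I ((t ^^ n) v0)" for n by (induction n) (use v0 Is It in auto)
    then show ?thesis by (simp add: l_def)
  qed
  have ls: "l (i + 1) = s (l i)" for i
  proof (cases "i \<ge> 0")
    case True
    then have "nat (i + 1) = Suc (nat i)" by simp
    then show ?thesis using True by (simp add: l_def)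
  next
    case False
    then have "nat (- i) = Suc (nat (- (i + 1)))" by simp
    then have "l i = t (l (i + 1))" using False by (auto simp: l_def)
    then show ?thesis using st[OF Il] by simp
  qed
  have lt: "l (i - 1) = t (l i)" for i using ts[OF Il, of "i - 1"] ls[of "i - 1"] by simp
  have la: "adj (l i) (l (i + 1))" "H (l (i + 1)) (l i) \<in> y" for i using s[OF Il] ls by simp_all
  have l: "line l" unfolding line_def
  proof (intro allI conjI)
    fix i
    let ?w = "l (i + 1)"
    have ib: "adj ?w (l i)" "adj ?w (l (i + 2))" using la(1)[of i] la(1)[of "i + 1"] adj_sym by (simp_all add: algebra_simps)
    have "H (l (i + 2)) ?w \<in> y" using la(2)[of "i + 1"] by (simp add: algebra_simps)
    have ne: "l i \<noteq> l (i + 2)"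
      using la(2)[of i] \<open>H (l (i + 2)) ?w \<in> y\<close> U_H[OF Uy ib(1)] by auto
    \<comment> \<open>A square here would give \<open>l i\<close> a second edge towards
      \<open>y\<close>, the one to \<open>c\<close>.\<close>
    have "H (l i) ?w \<inter> H (l (i + 2)) ?w = {}"
    proof (rule ccontr)
      assume "H (l i) ?w \<inter> H (l (i + 2)) ?w \<noteq> {}"
      then obtain c where c: "sq ?w (l i) c (l (i + 2))" using spans_square[OF ib ne] by blast
      then have "H c (l i) \<in> y" using sq_H'[OF sq_flip[OF c]] \<open>H (l (i + 2)) ?w \<in> y\<close> by simp
      then have "c = ?w" using uy[OF Il la(1)] la(2) sq_adj[OF c] by blast
      then show False using sq_neq[OF c] by simp
    qed
    then show "H (l (i + 2)) (l (i + 1)) \<subseteq> H (l (i + 1)) (l i)"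
      using H_compl[OF adj_sym[OF ib(1)]] H_subset by blast
  qed (rule la)
  have "up l = y" by (rule line_end_eq[OF l Uy]) (use uy[OF Il] la in blast)
  moreover have "up (\<lambda>i. l (- i)) = x"
  proof (rule line_end_eq[OF line_rev[OF l] Ux])
    fix i a assume "adj (l (- i)) a" "H a (l (- i)) \<in> x"
    then have "a = t (l (- i))" using ux[OF Il] t[OF Il] by blast
    moreover have "- (i + 1) = - i - 1" by simp
    ultimately show "a = l (- (i + 1))" using lt[of "- i"] by (simp only:)
  qed
  ultimately show ?thesis using line l dn_rev by simp
qed

end

context nonextremal
begin

text \<open>At the bottom \<open>v\<close> of a square with edges to \<open>a\<close> and \<open>b\<close>, both towards \<open>y\<close>, take \<open>u\<close> beyond \<open>a\<close>
  and \<open>w\<close> beyond \<open>b\<close>, each on the near side of the other edge.\<close>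

lemma branch_quadruple:
  assumes U: "U x" "U y" and v: "gp v x y = {}" "adj v a" "adj v b" "a \<noteq> b" and y: "H a v \<in> y" "H b v \<in> y"
  obtains u w where "u \<in> ray_ends" "w \<in> ray_ends" "perp x u" "perp y w" "perp u w"
    "nosep x y u w" "\<not> nosep x w y u" "\<not> nosep x u y w"
proof -
  have va: "adj a v" "adj b v" using v adj_sym by blast+
  have xa: "H a v \<notin> x" "H b v \<notin> x" using v(1) y H_self(2)[OF va(1)] H_self(2)[OF va(2)] unfolding gp_def by blast+
  obtain c where c: "sq v a c b" using spans_square[OF v(2-4) U_meet[OF U(2) y]] .
  have Hc: "H a v = H c b" "H b v = H c a" using sq_H'[OF c] sq_H'[OF sq_flip[OF c]] by simp_all
  obtain r where r: "ray r" "r 0 = v" "r 1 = a" using ray_ex[OF v(2)] .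
  \<comment> \<open>The point beyond \<open>b\<close> must avoid \<open>H a v\<close>, which is also
    the halfspace behind the edge from \<open>b\<close> to \<open>c\<close>; hence an edge disjoint
    from that one.\<close>
  obtain g where g: "adj b g" "H c b \<inter> H g b = {}" using disjoint_edge[of b c] sq_adj[OF c] by blast
  obtain s where s: "ray s" "s 0 = b" "s 1 = g" using ray_ex[OF g(1)] .
  define u where "u = ray_end r" define w where "w = ray_end s"
  have Uu: "U u" "U w" using en_U r s by (auto simp: u_def w_def)
  have Kr: "K r 0 = H a v" and Ks: "K s 0 = H g b" using r s by (simp_all add: K_def)
  have disj: "H a v \<inter> H g b = {}" using g Hc by simp
  have au: "H a v \<in> u" using K_en[OF r(1), of 0] Kr by (simp add: u_def)
  have bu: "H b v \<notin> u" using en_first_edge[OF r(1), of b] r v by (auto simp: u_def)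
  have gw: "H g b \<in> w" using K_en[OF s(1), of 0] Ks by (simp add: w_def)
  have aw: "H a v \<notin> w" using U_meet[OF Uu(2) _ gw] disj by blast
  have bw: "H b v \<in> w"
  proof (rule ccontr)
    assume "H b v \<notin> w"
    then have "H v b \<in> ray_end s" using U_H[OF Uu(2) va(2)] by (simp add: w_def)
    then have "v = g" using en_first_edge[OF s(1), of v] s va by simp
    moreover have "c \<in> H a v" "c \<in> H b v" using Hc H_self(1) sq_adj[OF c] by auto
    moreover have "a \<notin> H b v" using sq_H_neq[OF c] .
    moreover have "a \<in> H a v" using H_self(1)[OF va(1)] .
    ultimately show False using disj H_compl[OF va(2)] adj_V va by blast
  qed
  have xu: "gp v x u = {}" using ray_away[OF r(1) U(1)] Kr xa r by (simp add: u_def)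
  have "H g b \<notin> y" using U_meet[OF U(2) y(1)] disj by blast
  then have yw: "gp b y w = {}" using ray_away[OF s(1) U(2)] Ks s by (simp add: w_def)
  have uw: "gp b u w = {}"
  proof -
    have "H g b \<notin> u" using U_meet[OF Uu(1) au] disj by blast
    then show ?thesis using ray_away[OF s(1) Uu(1)] Ks s by (simp add: w_def)
  qed
  have "nosep u w x y"
    unfolding nosep_def
  proof (intro ballI impI, rule ccontr)
    fix h assume h: "h \<in> HS" "h \<in> u \<and> h \<in> w" "\<not> (h \<in> x \<or> h \<in> y)"
    then have "V - h \<in> x" "V - h \<in> y" using U_compl U by blast+
    then have "v \<notin> h" using v(1) adj_V[OF v(2)] unfolding gp_def by blast
    then have "h \<subseteq> H a v" using en_new_subset[OF r(1), of h] h Kr r by (simp add: u_def)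
    then show False using U_up[OF Uu(2), of h "H a v"] h aw HS_I va by blast
  qed
  then have n: "nosep x y u w" using nosep_sym U Uu by blast
  have "\<not> nosep y u x w" unfolding nosep_def using HS_I[OF va(1)] au y xa aw by blast
  then have 1: "\<not> nosep x w y u" using nosep_sym U Uu by blast
  have "\<not> nosep y w x u" unfolding nosep_def using HS_I[OF va(2)] bw y xa bu by blast
  then have 2: "\<not> nosep x u y w" using nosep_sym U Uu by blast
  have V: "v \<in> V" "b \<in> V" using adj_V v by blast+
  show ?thesis
  proof (rule that[OF _ _ _ _ _ n 1 2])
    show "u \<in> ray_ends" "w \<in> ray_ends" using r s by (auto simp: ray_ends_def u_def w_def)
    show "perp x u" "perp y w" "perp u w" using perp_I xu yw uw U Uu V by blast+
  qed
qed

end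

section \<open>Moebius bijections and lines\<close>

text \<open>The cross ratio is a difference of two sums of which at most one is infinite, so its
  sign and its infinite values can be read off from the sums.\<close>

lemma ereal_cross_ratio:
  fixes p1 p2 q1 q2 :: enat
  defines "c \<equiv> ereal_of_enat p1 + ereal_of_enat p2 - ereal_of_enat q1 - ereal_of_enat q2"
  assumes "\<not> (p1 + p2 = \<infinity> \<and> q1 + q2 = \<infinity>)"
  shows "0 \<le> c \<longleftrightarrow> q1 + q2 \<le> p1 + p2" "c = \<infinity> \<longleftrightarrow> p1 + p2 = \<infinity>" "c = -\<infinity> \<longleftrightarrow> q1 + q2 = \<infinity>"
    "p1 + p2 = enat m \<Longrightarrow> q1 + q2 = enat n \<Longrightarrow> c = ereal (real m - real n)"
  using assms(2) unfolding c_def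
  by (cases p1; cases p2; cases q1; cases q2; auto)+

context cat0
begin

lemma admissible_bd:
  assumes "x \<in> bd" "y \<in> bd" "z \<in> bd" "w \<in> bd"
  shows "(x, y, z, w) \<in> admissible X \<longleftrightarrow>
    \<not> (e x y + e z w = \<infinity> \<and> e x z + e y w = \<infinity>) \<and> \<not> (e x y + e z w = \<infinity> \<and> e x w + e y z = \<infinity>) \<and>
    \<not> (e x z + e y w = \<infinity> \<and> e x w + e y z = \<infinity>)"
  using assms unfolding admissible_def admissible_at_def e_def roller_boundary_def Let_def by auto

lemma cross_ratio_eq: "cross_ratio X x y z w =
    ereal_of_enat (e x z) + ereal_of_enat (e y w) - ereal_of_enat (e x w) - ereal_of_enat (e y z)"
  by (simp add: cross_ratio_def cross_ratio_at_def e_def)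

lemma position_count_int:
  assumes l: "line l" and U: "U u" "U w" and p: "has_position l p u" and q: "has_position l q w"
  obtains a b c d where "e (dn l) u = enat a" "e (up l) w = enat b" "e (dn l) w = enat c" "e (up l) u = enat d"
    "int a + int b = int c + int d + (q - p)"
proof -
  have Ul: "U (dn l)" "U (up l)" using dn_bd up_bd l bd_U by blast+
  have "perp (up l) u" "perp (dn l) u" "perp (up l) w" "perp (dn l) w"
    using finite_position[OF l U(1)] finite_position[OF l U(2)] p q by blast+
  then have "e (dn l) u \<noteq> \<infinity>" "e (up l) w \<noteq> \<infinity>" "e (dn l) w \<noteq> \<infinity>" "e (up l) u \<noteq> \<infinity>"
    using e_perp Ul by blast+
  then obtain a b c d where eq: "e (dn l) u = enat a" "e (up l) w = enat b" "e (dn l) w = enat c" "e (up l) u = enat d"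
    by auto
  have "int a + int b = int c + int d + (q - p)"
  proof (cases "p \<le> q")
    case True
    then show ?thesis using position_count[OF l U p q True] eq by simp
  next
    case False
    then have "q \<le> p" by simp
    then show ?thesis using position_count[OF l U(2,1) q p] eq by simp
  qed
  with eq that show ?thesis by blast
qed

end

locale moebius = X: nonextremal X + Y: nonextremal Y
  for X :: "'a set set" and Y :: "'b set set" +
  fixes f :: "'a set set \<Rightarrow> 'b set set"
  assumes not_line: "\<not> isomorphic_complexes X real_line_complex"
    and bij: "bij_betw f (roller_boundary X) (roller_boundary Y)"
    and moebius: "moebius_map X Y f"
begin

lemma f_bd: "x \<in> X.bd \<Longrightarrow> f x \<in> Y.bd"
  using bij by (auto simp: bij_betw_def)

lemma f_surj: assumes "y \<in> Y.bd" obtains x where "x \<in> X.bd" "f x = y"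
proof -
  have "y \<in> f ` X.bd" using assms bij by (simp add: bij_betw_def)
  then show ?thesis using that by blast
qed

text \<open>The cross ratio of \<open>(x, w, y, u)\<close>, in this order, is \<open>S - S1\<close>;
  the conclusions decode its preservation.\<close>

lemma transfer:
  assumes bd: "x \<in> X.bd" "y \<in> X.bd" "u \<in> X.bd" "w \<in> X.bd"
    and adm: "\<not> (X.e x y + X.e u w = \<infinity> \<and> X.e x u + X.e y w = \<infinity>)"
      "\<not> (X.e x y + X.e u w = \<infinity> \<and> X.e x w + X.e y u = \<infinity>)"
      "\<not> (X.e x u + X.e y w = \<infinity> \<and> X.e x w + X.e y u = \<infinity>)"
  defines "S \<equiv> X.e x y + X.e u w" and "S1 \<equiv> X.e x u + X.e y w"
    and "S' \<equiv> Y.e (f x) (f y) + Y.e (f u) (f w)" and "S1' \<equiv> Y.e (f x) (f u) + Y.e (f y) (f w)"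
  shows "S1 \<le> S \<longleftrightarrow> S1' \<le> S'" "S = \<infinity> \<longleftrightarrow> S' = \<infinity>" "S1 = \<infinity> \<longleftrightarrow> S1' = \<infinity>"
    "S \<noteq> \<infinity> \<Longrightarrow> S1 \<noteq> \<infinity> \<Longrightarrow> S + S1' = S1 + S'"
    "\<not> (Y.e (f x) (f w) + Y.e (f y) (f u) = \<infinity> \<and> S1' = \<infinity>)"
proof -
  note bd' = f_bd[OF bd(1)] f_bd[OF bd(2)] f_bd[OF bd(3)] f_bd[OF bd(4)]
  note U = bd[THEN X.bd_U] and U' = bd'[THEN Y.bd_U]
  have sy: "X.e w u = X.e u w" "X.e w y = X.e y w" "X.e y u = X.e u y"
    "Y.e (f w) (f u) = Y.e (f u) (f w)" "Y.e (f w) (f y) = Y.e (f y) (f w)" "Y.e (f y) (f u) = Y.e (f u) (f y)"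
    using X.e_sym Y.e_sym U U' by simp_all
  have "(x, w, y, u) \<in> admissible X"
    unfolding X.admissible_bd[OF bd(1,4,2,3)] sy using adm[unfolded sy] by blast
  then have a': "(f x, f w, f y, f u) \<in> admissible Y"
    and cr: "cross_ratio Y (f x) (f w) (f y) (f u) = cross_ratio X x w y u"
    using moebius bd unfolding moebius_map_def by blast+
  have n: "\<not> (S = \<infinity> \<and> S1 = \<infinity>)" using adm by (simp add: S_def S1_def)
  have n': "\<not> (S' = \<infinity> \<and> S1' = \<infinity>)" "\<not> (Y.e (f x) (f w) + Y.e (f y) (f u) = \<infinity> \<and> S1' = \<infinity>)"
    using a' unfolding Y.admissible_bd[OF bd'(1,4,2,3)] by (auto simp: sy S'_def S1'_def)
  note C = ereal_cross_ratio[of "X.e x y" "X.e u w" "X.e x u" "X.e y w", OF n[unfolded S_def S1_def]]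
  note C' = ereal_cross_ratio[of "Y.e (f x) (f y)" "Y.e (f u) (f w)" "Y.e (f x) (f u)" "Y.e (f y) (f w)",
      OF n'(1)[unfolded S'_def S1'_def]]
  have eq: "ereal_of_enat (Y.e (f x) (f y)) + ereal_of_enat (Y.e (f u) (f w)) - ereal_of_enat (Y.e (f x) (f u)) - ereal_of_enat (Y.e (f y) (f w))
    = ereal_of_enat (X.e x y) + ereal_of_enat (X.e u w) - ereal_of_enat (X.e x u) - ereal_of_enat (X.e y w)"
    using cr unfolding X.cross_ratio_eq Y.cross_ratio_eq by (simp add: sy)
  show "S1 \<le> S \<longleftrightarrow> S1' \<le> S'" using C(1) C'(1) eq by (simp add: S_def S'_def S1_def S1'_def)
  show i: "S = \<infinity> \<longleftrightarrow> S' = \<infinity>" using C(2) C'(2) eq by (simp add: S_def S'_def S1_def S1'_def)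
  show i1: "S1 = \<infinity> \<longleftrightarrow> S1' = \<infinity>" using C(3) C'(3) eq by (simp add: S_def S'_def S1_def S1'_def)
  show "S + S1' = S1 + S'" if fin: "S \<noteq> \<infinity>" "S1 \<noteq> \<infinity>"
  proof -
    obtain m n m' n' where mn: "S = enat m" "S1 = enat n" "S' = enat m'" "S1' = enat n'"
      using fin i i1 by (metis not_infinity_eq)
    have "real m - real n = real m' - real n'"
      using C(4)[OF mn(1,2)[unfolded S_def S1_def]] C'(4)[OF mn(3,4)[unfolded S'_def S1'_def]] eq by simp
    then have "m + n' = n + m'" by linarith
    then show ?thesis using mn by simp
  qed
  show "\<not> (Y.e (f x) (f w) + Y.e (f y) (f u) = \<infinity> \<and> S1' = \<infinity>)" using n' by blast
qed

text \<open>For \<open>u = x\<close> and \<open>w = y\<close> only the sum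
  \<open>e x x + e y y\<close> can be infinite, so the quadruple is admissible and finiteness of
  \<open>e x y + e x y\<close> is transferred.\<close>

lemma perp_image: assumes "x \<in> X.bd" "y \<in> X.bd" "X.perp x y" shows "Y.perp (f x) (f y)"
proof -
  have U: "X.U x" "X.U y" "Y.U (f x)" "Y.U (f y)" using assms f_bd X.bd_U Y.bd_U by blast+
  have xy: "X.e x y \<noteq> \<infinity>" "X.e y x \<noteq> \<infinity>" using assms X.e_perp X.e_sym U by metis+
  then have s: "X.e x y + X.e x y \<noteq> \<infinity>" "X.e x y + X.e y x \<noteq> \<infinity>" by auto
  then have "Y.e (f x) (f y) + Y.e (f x) (f y) = \<infinity> \<longleftrightarrow> X.e x y + X.e x y = \<infinity>"
    by (intro transfer(2)[OF assms(1,2,1,2), symmetric]) (use s in simp_all)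
  then show ?thesis using xy Y.e_perp[OF U(3)] by (auto simp: plus_eq_infty_iff_enat)
qed

text \<open>The only infinite sum is the one containing \<open>e x y\<close>, so its image is
  infinite. As the product of \<open>f x\<close> and \<open>f y\<close> is finite, that of
  \<open>f z\<close> and \<open>f u\<close> cannot be.\<close>

lemma not_perp_witnesses:
  assumes bd: "x \<in> X.bd" "y \<in> X.bd" "z \<in> X.bd" "u \<in> X.bd"
    and "\<not> X.perp x y" "Y.perp (f x) (f y)"
    and "X.perp z x" "X.perp z y" "X.perp u x" "X.perp u y"
  shows "\<not> Y.perp (f z) (f u)"
proof -
  have U: "X.U x" "X.U y" "X.U z" "X.U u" and U': "Y.U (f x)" "Y.U (f z)"
    using bd f_bd X.bd_U Y.bd_U by blast+
  have "X.e x z \<noteq> \<infinity>" "X.e y z \<noteq> \<infinity>" "X.e x u \<noteq> \<infinity>" "X.e y u \<noteq> \<infinity>"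
    using X.e_perp U assms(7-10) X.perp_sym by blast+
  moreover have "X.e x y = \<infinity>" using X.e_perp U assms(5) by blast
  ultimately have "Y.e (f x) (f y) + Y.e (f z) (f u) = \<infinity>"
    using transfer(2)[of x y z u] bd by (simp add: plus_eq_infty_iff_enat)
  then show ?thesis using Y.e_perp U' assms(6) by (auto simp: plus_eq_infty_iff_enat)
qed

text \<open>If an infinite product became finite, \<open>not_exceptional\<close> would provide
  witnesses with finite product, on which \<open>perp_image\<close> and
  \<open>not_perp_witnesses\<close> contradict each other.\<close>

lemma perp_iff_ray:
  assumes "x \<in> X.ray_ends" "y \<in> X.bd" shows "X.perp x y \<longleftrightarrow> Y.perp (f x) (f y)"
proof
  assume p: "Y.perp (f x) (f y)"
  show "X.perp x y"
  proof (rule ccontr)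
    assume "\<not> X.perp x y"
    then obtain z u where zu: "z \<in> X.ray_ends" "u \<in> X.ray_ends" "X.perp z x" "X.perp z y" "X.perp u x" "X.perp u y" "X.perp z u"
      using X.not_exceptional[OF not_line assms] by metis
    then show False
      using not_perp_witnesses[of x y z u] \<open>\<not> X.perp x y\<close> p assms X.ray_ends_bd perp_image by blast
  qed
qed (use perp_image assms X.ray_ends_bd in blast)

text \<open>Witnesses with finite product are excluded by \<open>not_perp_witnesses\<close> and
  \<open>perp_image\<close>, so the pair is exceptional.\<close>

lemma not_perp_ray:
  assumes "s \<in> X.bd" "r \<in> X.bd" "\<not> X.perp s r" "Y.perp (f s) (f r)"
  obtains c where "c \<in> X.ray_ends" "\<not> X.perp c s" "\<not> X.perp c r"
proof -
  have "X.exceptional s r"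
    unfolding X.exceptional_def using not_perp_witnesses[OF assms(1,2) _ _ assms(3,4)] perp_image X.ray_ends_bd assms by blast
  then obtain c where "X.ray c" "\<not> X.perp (X.ray_end c) s" "\<not> X.perp (X.ray_end c) r"
    by (rule X.exceptional_ray)
  then show ?thesis using that X.ray_ends_def by blast
qed

lemma ray_ends_trans_X: "z \<in> X.ray_ends \<Longrightarrow> x \<in> X.bd \<Longrightarrow> y \<in> X.bd \<Longrightarrow> \<not> X.perp z x \<Longrightarrow> \<not> X.perp z y \<Longrightarrow> \<not> X.perp x y"
  using X.not_perp_trans X.bd_U by (auto simp: X.ray_ends_def)

lemma ray_ends_trans_Y: "z \<in> Y.ray_ends \<Longrightarrow> x \<in> Y.bd \<Longrightarrow> y \<in> Y.bd \<Longrightarrow> \<not> Y.perp z x \<Longrightarrow> \<not> Y.perp z y \<Longrightarrow> \<not> Y.perp x y"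
  using Y.not_perp_trans Y.bd_U by (auto simp: Y.ray_ends_def)

text \<open>Preimages \<open>u\<close>, \<open>w\<close> of the points given by
  \<open>branch_quadruple\<close> would make both other sums exceed \<open>e x y + e u w\<close>,
  against \<open>line_nosep\<close>. The work lies in admissibility: the finiteness is known in
  \<open>Y\<close> and has to be pulled back to \<open>X\<close>.\<close>

lemma image_no_branch:
  assumes l: "X.line l" and v: "Y.gp v (f (X.dn l)) (f (X.up l)) = {}" "Y.adj v a" "Y.adj v b" "a \<noteq> b"
    and ab: "Y.H a v \<in> f (X.up l)" "Y.H b v \<in> f (X.up l)"
  shows False
proof -
  define x where "x = X.dn l"
  define y where "y = X.up l"
  have bd: "x \<in> X.bd" "y \<in> X.bd" and ray_ends: "x \<in> X.ray_ends" "y \<in> X.ray_ends"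
    using l X.dn_bd X.up_bd X.dn_ray_ends X.up_ray_ends by (auto simp: x_def y_def)
  note U = bd[THEN X.bd_U] and U' = f_bd[OF bd(1), THEN Y.bd_U] f_bd[OF bd(2), THEN Y.bd_U]
  obtain u' w' where uw': "u' \<in> Y.ray_ends" "w' \<in> Y.ray_ends" "Y.perp (f x) u'" "Y.perp (f y) w'" "Y.perp u' w'"
    "Y.nosep (f x) (f y) u' w'" "\<not> Y.nosep (f x) w' (f y) u'" "\<not> Y.nosep (f x) u' (f y) w'"
    using Y.branch_quadruple[OF U' v[folded x_def y_def] ab[folded y_def]] by metis
  obtain u where u: "u \<in> X.bd" "f u = u'" using f_surj uw'(1) Y.ray_ends_bd by metis
  obtain w where w: "w \<in> X.bd" "f w = w'" using f_surj uw'(2) Y.ray_ends_bd by metis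
  have Uu: "X.U u" "X.U w" "Y.U u'" "Y.U w'" using u w uw' X.bd_U Y.bd_U Y.ray_ends_bd by blast+
  have xu: "X.perp x u" and yw: "X.perp y w"
    using perp_iff_ray[OF ray_ends(1) u(1)] perp_iff_ray[OF ray_ends(2) w(1)] uw' u w by simp_all
  have xy: "X.perp x y" using X.line_ends_perp[OF l] by (simp add: x_def y_def)
  have xy': "Y.perp (f x) (f y)" using perp_image bd xy by blast
  have es: "X.e x u \<noteq> \<infinity>" "X.e y w \<noteq> \<infinity>" "X.e x y \<noteq> \<infinity>" using X.e_perp U xu yw xy by blast+
  \<comment> \<open>Otherwise \<open>u\<close> and \<open>w\<close> would share the end \<open>c\<close> of an exceptional ray; as \<open>f u\<close> and \<open>f w\<close> are
    ends of rays, an end of \<open>l\<close> would share it too.\<close>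
  have fin: "X.perp u w \<or> X.perp x w \<and> X.perp y u"
  proof (rule ccontr)
    assume "\<not> ?thesis"
    then have n: "\<not> X.perp u w" "\<not> X.perp x w \<or> \<not> X.perp y u" by blast+
    obtain c where c: "c \<in> X.ray_ends" "\<not> X.perp c u" "\<not> X.perp c w"
      using not_perp_ray[OF u(1) w(1) n(1)] uw' u w by metis
    have cbd: "c \<in> X.bd" "f c \<in> Y.bd" using c X.ray_ends_bd f_bd by blast+
    have c': "\<not> Y.perp (f c) u'" "\<not> Y.perp (f c) w'"
      using c perp_iff_ray[OF c(1)] u w by blast+
    show False
    proof (cases "X.perp y u")
      case False
      then have "\<not> Y.perp (f y) u'" using perp_iff_ray[OF ray_ends(2) u(1)] u by simp
      then have "\<not> Y.perp (f c) (f y)"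
        using ray_ends_trans_Y[OF uw'(1) cbd(2) f_bd[OF bd(2)]] c' Y.perp_sym by blast
      then have "\<not> X.perp c y" using perp_iff_ray[OF c(1) bd(2)] by blast
      then show False using ray_ends_trans_X[OF c(1) bd(2) w(1)] c(3) yw by blast
    next
      case True
      then have "\<not> X.perp x w" using n by blast
      then have "\<not> Y.perp (f x) w'" using perp_iff_ray[OF ray_ends(1) w(1)] w by simp
      then have "\<not> Y.perp (f c) (f x)"
        using ray_ends_trans_Y[OF uw'(2) cbd(2) f_bd[OF bd(1)]] c' Y.perp_sym by blast
      then have "\<not> X.perp c x" using perp_iff_ray[OF c(1) bd(1)] by blast
      then show False using ray_ends_trans_X[OF c(1) bd(1) u(1)] c(2) xu by blast
    qed
  qed
  have es2: "\<not> (X.e x y + X.e u w = \<infinity> \<and> X.e x w + X.e y u = \<infinity>)"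
    using fin es X.e_perp U Uu by (auto simp: plus_eq_infty_iff_enat)
  have lt: "Y.e (f x) (f y) + Y.e u' w' < Y.e (f x) u' + Y.e (f y) w'"
    using Y.sep_less[OF U'(1) Uu(3) U'(2) Uu(4) uw'(6,8) xy' uw'(5)] .
  have "Y.nosep (f x) (f y) w' u'" using uw'(6) by (auto simp: Y.nosep_def)
  then have "Y.e (f x) (f y) + Y.e w' u' < Y.e (f x) w' + Y.e (f y) u'"
    using Y.sep_less[OF U'(1) Uu(4) U'(2) Uu(3) _ uw'(7) xy'] uw'(5) Y.perp_sym by blast
  then have lt2: "Y.e (f x) (f y) + Y.e u' w' < Y.e (f x) w' + Y.e (f y) u'"
    using Y.e_sym Uu by simp
  have t1: "\<not> X.e x u + X.e y w \<le> X.e x y + X.e u w"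
    using transfer(1)[OF bd u(1) w(1)] es es2 lt u w by (auto simp: plus_eq_infty_iff_enat)
  have t2: "\<not> X.e x w + X.e y u \<le> X.e x y + X.e u w"
    using transfer(1)[OF bd w(1) u(1)] es es2 lt2 u w X.e_sym[OF Uu(1,2)] Y.e_sym[OF Uu(3,4)]
    by (auto simp: plus_eq_infty_iff_enat)
  have sy: "X.e y x = X.e x y" "X.e w u = X.e u w" using X.e_sym U Uu by simp_all
  show False using X.line_nosep[OF l Uu(1,2)]
  proof
    assume "X.nosep (X.up l) w (X.dn l) u"
    then have "X.e y w + X.e x u \<le> X.e y x + X.e w u"
      using X.nosep_le[OF U(2) Uu(2) U(1) Uu(1)] by (simp add: x_def y_def)
    then show False using t1 by (simp add: sy add.commute)
  next
    assume "X.nosep (X.up l) u (X.dn l) w"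
    then have "X.e y u + X.e x w \<le> X.e y x + X.e u w"
      using X.nosep_le[OF U(2) Uu(1) U(1) Uu(2)] by (simp add: x_def y_def)
    then show False using t2 by (simp add: sy add.commute)
  qed
qed

lemma image_line_ends:
  assumes l: "X.line l" obtains l' where "Y.line l'" "Y.dn l' = f (X.dn l)" "Y.up l' = f (X.up l)"
proof -
  have bd: "X.dn l \<in> X.bd" "X.up l \<in> X.bd" using l X.dn_bd X.up_bd by blast+
  have p: "Y.perp (f (X.dn l)) (f (X.up l))" using perp_image[OF bd X.line_ends_perp[OF l]] .
  show ?thesis
    using f_bd[OF bd(1)] f_bd[OF bd(2)] p
  proof (cases rule: Y.line_or_branch)
    case (line l')
    then show ?thesis using that by blast
  next
    case (branch v a b)
    have rev: "X.line (\<lambda>i. l (- i))" "X.dn (\<lambda>i. l (- i)) = X.up l" "X.up (\<lambda>i. l (- i)) = X.dn l"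
      using X.line_rev[OF l] X.dn_rev X.up_rev by metis+
    have "Y.gp v (f (X.up l)) (f (X.dn l)) = {}" using branch(2) Y.gp_sym by metis
    then show ?thesis
      using image_no_branch[OF l branch(2-5)] image_no_branch[OF rev(1), of v a b] rev branch by auto
  qed
qed

text \<open>All finite positions are shifted by the same amount, because a difference of positions
  is a cross ratio; a boundary point without a position contains all or none of the
  \<open>L l i\<close>. The last clause serves to reach every halfspace of \<open>Y\<close>.\<close>

lemma image_line:
  assumes l: "X.line l"
  obtains l' where "Y.line l'" "\<And>u i. u \<in> X.bd \<Longrightarrow> X.L l i \<in> u \<longleftrightarrow> Y.L l' i \<in> f u"
    "\<And>k. k \<in> f (X.up l) \<Longrightarrow> k \<notin> f (X.dn l) \<Longrightarrow> k \<in> range (Y.L l')"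
proof -
  obtain l0 where l0: "Y.line l0" "Y.dn l0 = f (X.dn l)" "Y.up l0 = f (X.up l)" using image_line_ends[OF l] .
  have bd: "X.dn l \<in> X.bd" "X.up l \<in> X.bd" using l X.dn_bd X.up_bd by blast+
  have perp: "X.perp (X.dn l) u \<longleftrightarrow> Y.perp (Y.dn l0) (f u)" "X.perp (X.up l) u \<longleftrightarrow> Y.perp (Y.up l0) (f u)"
    if "u \<in> X.bd" for u
    using perp_iff_ray[OF X.dn_ray_ends[OF l] that] perp_iff_ray[OF X.up_ray_ends[OF l] that] l0 by simp_all
  obtain u0 p0 where u0: "u0 \<in> X.bd" "X.has_position l p0 u0" using X.finite_position_ex[OF not_line l] .
  have image_pos: "\<exists>q. Y.has_position l0 q (f u)" if "u \<in> X.bd" "X.has_position l p u" for u p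
  proof -
    have "X.perp (X.up l) u \<and> X.perp (X.dn l) u" using X.finite_position[OF l X.bd_U[OF that(1)]] that(2) by blast
    then show ?thesis using perp[OF that(1)] Y.finite_position[OF l0(1) Y.bd_U[OF f_bd[OF that(1)]]] by blast
  qed
  obtain q0 where q0: "Y.has_position l0 q0 (f u0)" using image_pos u0 by blast
  have shift: "q - q0 = p - p0" if u: "u \<in> X.bd" and p: "X.has_position l p u" and q: "Y.has_position l0 q (f u)" for u p q
  proof -
    obtain a b c d where A: "X.e (X.dn l) u0 = enat a" "X.e (X.up l) u = enat b" "X.e (X.dn l) u = enat c"
      "X.e (X.up l) u0 = enat d" "int a + int b = int c + int d + (p - p0)"
      using X.position_count_int[OF l X.bd_U[OF u0(1)] X.bd_U[OF u] u0(2) p] .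
    obtain a' b' c' d' where B: "Y.e (Y.dn l0) (f u0) = enat a'" "Y.e (Y.up l0) (f u) = enat b'"
      "Y.e (Y.dn l0) (f u) = enat c'" "Y.e (Y.up l0) (f u0) = enat d'" "int a' + int b' = int c' + int d' + (q - q0)"
      using Y.position_count_int[OF l0(1) Y.bd_U[OF f_bd[OF u0(1)]] Y.bd_U[OF f_bd[OF u]] q0 q] .
    have sy: "X.e u (X.up l) = X.e (X.up l) u" "X.e u0 (X.up l) = X.e (X.up l) u0"
      "Y.e (f u) (f (X.up l)) = Y.e (f (X.up l)) (f u)" "Y.e (f u0) (f (X.up l)) = Y.e (f (X.up l)) (f u0)"
      using X.e_sym Y.e_sym X.bd_U Y.bd_U f_bd u u0 bd by metis+
    have "X.e (X.dn l) u0 + X.e u (X.up l) + (Y.e (f (X.dn l)) (f u) + Y.e (f u0) (f (X.up l)))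
      = X.e (X.dn l) u + X.e u0 (X.up l) + (Y.e (f (X.dn l)) (f u0) + Y.e (f u) (f (X.up l)))"
      by (rule transfer(4)[OF bd(1) u0(1) u bd(2)]) (simp_all add: sy A)
    then have "a + b + (c' + d') = c + d + (a' + b')"
      using A B l0 by (simp add: sy)
    then show ?thesis using A(5) B(5) by linarith
  qed
  \<comment> \<open>Reparametrization by the common shift makes the positions agree.\<close>
  define l' where "l' = (\<lambda>i. l0 (i + (q0 - p0)))"
  have l': "Y.line l'" unfolding l'_def by (rule Y.line_shift[OF l0(1)])
  have L': "Y.L l' i = Y.L l0 (i + (q0 - p0))" for i unfolding l'_def by (rule Y.L_shift)
  show ?thesis
  proof (rule that[OF l'])
    fix u i assume u: "u \<in> X.bd"
    note Uu = X.bd_U[OF u] and Ufu = Y.bd_U[OF f_bd[OF u]]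
    consider p where "X.has_position l p u" | "\<not> X.perp (X.up l) u" | "\<not> X.perp (X.dn l) u"
      using X.finite_position[OF l Uu] by blast
    then show "X.L l i \<in> u \<longleftrightarrow> Y.L l' i \<in> f u"
    proof cases
      case 1
      then obtain q where q: "Y.has_position l0 q (f u)" using image_pos u by blast
      have "q - q0 = p - p0" using shift[OF u 1 q] .
      then show ?thesis using 1 q unfolding X.has_position_def Y.has_position_def L' by auto
    next
      case 2
      then show ?thesis using X.not_perp_up[OF l Uu] Y.not_perp_up[OF l0(1) Ufu] perp[OF u] L' by simp
    next
      case 3
      then show ?thesis using X.not_perp_dn[OF l Uu] Y.not_perp_dn[OF l0(1) Ufu] perp[OF u] L' by simp
    qed
  next
    fix k assume "k \<in> f (X.up l)" "k \<notin> f (X.dn l)"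
    then obtain j where "k = Y.L l0 j" using Y.up_dn_L[OF l0(1)] l0 by metis
    then have "k = Y.L l' (j - (q0 - p0))" by (simp add: L')
    then show "k \<in> range (Y.L l')" by blast
  qed
qed

text \<open>Here the quadruple is chosen in \<open>X\<close>, so the finiteness needed for
  admissibility is part of its construction; the inequality is violated at the line in
  \<open>Y\<close>.\<close>

lemma preimage_no_branch:
  assumes l: "Y.line l" and x: "x \<in> X.bd" "f x = Y.dn l" and y: "y \<in> X.bd" "f y = Y.up l" and p: "X.perp x y"
    and v: "X.gp v x y = {}" "X.adj v a" "X.adj v b" "a \<noteq> b" and ab: "X.H a v \<in> y" "X.H b v \<in> y"
  shows False
proof -
  note U = X.bd_U[OF x(1)] X.bd_U[OF y(1)]
  obtain u w where uw: "u \<in> X.ray_ends" "w \<in> X.ray_ends" "X.perp x u" "X.perp y w" "X.perp u w"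
    "X.nosep x y u w" "\<not> X.nosep x w y u" "\<not> X.nosep x u y w"
    using X.branch_quadruple[OF U v ab] .
  have bd: "u \<in> X.bd" "w \<in> X.bd" using uw X.ray_ends_bd by blast+
  note Uu = X.bd_U[OF bd(1)] X.bd_U[OF bd(2)]
  have lt: "X.e x y + X.e u w < X.e x u + X.e y w"
    using X.sep_less[OF U(1) Uu(1) U(2) Uu(2) uw(6,8) p uw(5)] .
  have "X.nosep x y w u" using uw(6) by (auto simp: X.nosep_def)
  then have "X.e x y + X.e w u < X.e x w + X.e y u"
    using X.sep_less[OF U(1) Uu(2) U(2) Uu(1) _ uw(7) p] uw(5) X.perp_sym by blast
  then have lt2: "X.e x y + X.e u w < X.e x w + X.e y u" using X.e_sym Uu by simp
  have es: "X.e x u \<noteq> \<infinity>" "X.e y w \<noteq> \<infinity>" "X.e x y \<noteq> \<infinity>" "X.e u w \<noteq> \<infinity>"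
    using X.e_perp U Uu uw p by blast+
  have f': "f u \<in> Y.bd" "f w \<in> Y.bd" using f_bd bd by blast+
  note U' = Y.bd_U[OF f_bd[OF x(1)]] Y.bd_U[OF f_bd[OF y(1)]] Y.bd_U[OF f'(1)] Y.bd_U[OF f'(2)]
  have t1: "\<not> Y.e (f x) (f u) + Y.e (f y) (f w) \<le> Y.e (f x) (f y) + Y.e (f u) (f w)"
    using transfer(1)[OF x(1) y(1) bd] es lt by (auto simp: plus_eq_infty_iff_enat)
  have t2: "\<not> Y.e (f x) (f w) + Y.e (f y) (f u) \<le> Y.e (f x) (f y) + Y.e (f u) (f w)"
    using transfer(1)[OF x(1) y(1) bd(2,1)] es lt2 X.e_sym[OF Uu] Y.e_sym[OF U'(3,4)]
    by (auto simp: plus_eq_infty_iff_enat)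
  have sy: "Y.e (f y) (f x) = Y.e (f x) (f y)" "Y.e (f w) (f u) = Y.e (f u) (f w)" using Y.e_sym U' by simp_all
  show False using Y.line_nosep[OF l U'(3,4)]
  proof
    assume "Y.nosep (Y.up l) (f w) (Y.dn l) (f u)"
    then have "Y.e (f y) (f w) + Y.e (f x) (f u) \<le> Y.e (f y) (f x) + Y.e (f w) (f u)"
      using Y.nosep_le[OF U'(2,4,1,3)] x y by simp
    then show False using t1 by (simp add: sy add.commute)
  next
    assume "Y.nosep (Y.up l) (f u) (Y.dn l) (f w)"
    then have "Y.e (f y) (f u) + Y.e (f x) (f w) \<le> Y.e (f y) (f x) + Y.e (f u) (f w)"
      using Y.nosep_le[OF U'(2,3,1,4)] x y by simp
    then show False using t2 by (simp add: sy add.commute)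
  qed
qed

text \<open>If the preimages of the ends had an infinite product, \<open>not_perp_ray\<close> would
  give a ray end \<open>c\<close> for which \<open>f c\<close> has an infinite product with both
  ends of \<open>l'\<close>.\<close>

lemma preimage_line_ends:
  assumes l: "Y.line l'" obtains l where "X.line l" "f (X.dn l) = Y.dn l'" "f (X.up l) = Y.up l'"
proof -
  obtain x where x: "x \<in> X.bd" "f x = Y.dn l'" using f_surj Y.dn_bd l by metis
  obtain y where y: "y \<in> X.bd" "f y = Y.up l'" using f_surj Y.up_bd l by metis
  have p: "X.perp x y"
  proof (rule ccontr)
    assume "\<not> X.perp x y"
    then obtain c where c: "c \<in> X.ray_ends" "\<not> X.perp c x" "\<not> X.perp c y"
      using not_perp_ray[OF x(1) y(1)] Y.line_ends_perp[OF l] x y by metis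
    then have "\<not> Y.perp (f c) (Y.dn l')" "\<not> Y.perp (f c) (Y.up l')"
      using perp_iff_ray[OF c(1)] x y by metis+
    then show False
      using Y.not_both_ends[OF l, of "f c"] Y.bd_U f_bd X.ray_ends_bd c(1) Y.perp_sym by blast
  qed
  show ?thesis using x(1) y(1) p
  proof (cases rule: X.line_or_branch)
    case (line l)
    then show ?thesis using that x y by blast
  next
    case (branch v a b)
    have rev: "Y.line (\<lambda>i. l' (- i))" "Y.dn (\<lambda>i. l' (- i)) = Y.up l'" "Y.up (\<lambda>i. l' (- i)) = Y.dn l'"
      using Y.line_rev[OF l] Y.dn_rev Y.up_rev by metis+
    have "X.gp v y x = {}" "X.perp y x" using branch(2) X.gp_sym p X.perp_sym by metis+
    then show ?thesis
      using preimage_no_branch[OF l x y p branch(2-5)] preimage_no_branch[OF rev(1) y(1) _ x(1), of v a b] rev branch x y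
      by auto
  qed
qed

end

section \<open>Isomorphisms of the 1-skeleton\<close>

context cat0
begin

lemma same_halfspaces_eq:
  assumes "u \<in> V" "v \<in> V" "\<And>h. h \<in> HS \<Longrightarrow> u \<in> h \<longleftrightarrow> v \<in> h" shows "u = v"
proof (rule ccontr)
  assume "u \<noteq> v"
  then obtain a where a: "adj v a" "u \<in> H a v" using separated assms(1,2) by blast
  then show False using assms(3)[OF HS_I[OF adj_sym[OF a(1)]]] H_self(2)[OF adj_sym[OF a(1)]] by blast
qed

text \<open>If only one halfspace contains \<open>u\<close> but not \<open>v\<close>, the neighbour
  \<open>a\<close> of \<open>v\<close> behind which \<open>u\<close> lies is \<open>u\<close>
  itself: a halfspace separating \<open>u\<close> from \<open>a\<close> would lead to a second one
  or to a contradiction.\<close>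

lemma adj_iff:
  assumes "u \<in> V" "v \<in> V"
  shows "adj u v \<longleftrightarrow> u \<noteq> v \<and> (\<forall>h\<in>HS. \<forall>k\<in>HS. u \<in> h \<and> v \<notin> h \<and> u \<in> k \<and> v \<notin> k \<longrightarrow> h = k)"
proof
  assume a: "adj u v"
  have "h = H u v" if "h \<in> HS" "u \<in> h" "v \<notin> h" for h using crossed[OF a that] .
  then show "u \<noteq> v \<and> (\<forall>h\<in>HS. \<forall>k\<in>HS. u \<in> h \<and> v \<notin> h \<and> u \<in> k \<and> v \<notin> k \<longrightarrow> h = k)"
    using adj_neq[OF a] by metis
next
  assume R: "u \<noteq> v \<and> (\<forall>h\<in>HS. \<forall>k\<in>HS. u \<in> h \<and> v \<notin> h \<and> u \<in> k \<and> v \<notin> k \<longrightarrow> h = k)"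
  then have "u \<noteq> v" by blast
  then obtain a where a: "adj v a" "u \<in> H a v" using separated[OF assms] by blast
  have "u = a"
  proof (rule same_halfspaces_eq[OF assms(1) adj_V(2)[OF a(1)]])
    fix k assume k: "k \<in> HS"
    have av: "adj a v" using adj_sym a(1) .
    have aa: "a \<in> H a v" "v \<notin> H a v" using H_self[OF av] .
    have key: False if kk: "k \<in> HS" "u \<in> k" "a \<notin> k" for k
    proof (cases "v \<in> k")
      case True
      then have "k = H v a" using crossed[OF a(1) kk(1)] kk(3) by blast
      then show False using kk(2) a(2) H_compl[OF av] by blast
    next
      case False
      then have "k = H a v" using R kk a(2) HS_I[OF av] aa(2) by blast
      then show False using kk(3) aa by blast
    qed
    show "u \<in> k \<longleftrightarrow> a \<in> k"
      using key[OF k] key[OF HS_compl[OF k]] assms(1) adj_V(2)[OF a(1)] by blast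
  qed
  then show "adj u v" using a adj_sym by blast
qed

lemma cube_halfspaces:
  assumes ch: "cube_chart X n \<phi> Q"
  obtains hs where "\<And>i. i < n \<Longrightarrow> hs i \<in> HS" "\<And>A i. A \<subseteq> {..<n} \<Longrightarrow> i < n \<Longrightarrow> \<phi> A \<in> hs i \<longleftrightarrow> i \<in> A"
    "\<And>A i. A \<subseteq> {..<n} \<Longrightarrow> i < n \<Longrightarrow> i \<notin> A \<Longrightarrow> H (\<phi> (insert i A)) (\<phi> A) = hs i"
proof -
  define hs where "hs i = H (\<phi> {i}) (\<phi> {})" for i
  have ins: "adj (\<phi> A) (\<phi> (insert i A))" if "insert i A \<subseteq> {..<n}" "i \<notin> A" for A i
    using adj_chart_flip[OF ch, of A i] that by (simp add: flip_def)
  have par: "H (\<phi> (insert i A)) (\<phi> A) = hs i" if "insert i A \<subseteq> {..<n}" "i \<notin> A" for A i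
  proof -
    have "finite A" by (rule finite_subset[of A "{..<n}"]) (use that in auto)
    then show ?thesis using that
    proof (induction A rule: finite_induct)
      case (insert j A)
      have "sq (\<phi> A) (\<phi> (flip i A)) (\<phi> (flip j (flip i A))) (\<phi> (flip j A))"
        using insert.prems by (intro sq_chart_flip[OF ch]) auto
      then have s: "sq (\<phi> A) (\<phi> (insert i A)) (\<phi> (insert i (insert j A))) (\<phi> (insert j A))"
        using insert by (simp add: flip_def insert_commute)
      have "H (\<phi> (insert i (insert j A))) (\<phi> (insert j A)) = H (\<phi> (insert i A)) (\<phi> A)"
        using sq_H'[OF s] by simp
      then show ?case using insert by simp
    qed (simp add: hs_def)
  qed
  have hH: "hs i \<in> HS" if "i < n" for i using HS_I[OF adj_sym[OF ins[of i "{}"]]] that by (simp add: hs_def)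
  have mem: "\<phi> A \<in> hs i \<longleftrightarrow> i \<in> A" if A: "A \<subseteq> {..<n}" and i: "i < n" for A i
  proof (cases "i \<in> A")
    case True
    define B where "B = A - {i}"
    have B: "insert i B = A" "i \<notin> B" using True by (auto simp: B_def)
    then show ?thesis using par[of i B] H_self(1)[OF adj_sym[OF ins[of i B]]] A True by simp
  next
    case False
    then show ?thesis using par[of i A] H_self(2)[OF adj_sym[OF ins[of i A]]] A i by simp
  qed
  show ?thesis by (rule that[of hs]) (use hH mem par in auto)
qed

text \<open>For \<open>N\<close> the neighbours of \<open>v\<close> in a cube this is the cube, as
  the set of vertices separated from \<open>v\<close> only by hyperplanes dual to its edges at
  \<open>v\<close>. It describes cubes by halfspaces, hence by the 1-skeleton.\<close>

definition spanned :: "'a \<Rightarrow> 'a set \<Rightarrow> 'a set" where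
  "spanned v N = {w \<in> V. \<forall>h\<in>HS. w \<in> h \<and> v \<notin> h \<longrightarrow> (\<exists>a\<in>N. h = H a v)}"

lemma cube_spanned:
  assumes Q: "Q \<in> X" "v \<in> Q" shows "Q = spanned v {a \<in> Q. adj v a}"
proof -
  obtain n \<phi> where ch: "cube_chart X n \<phi> Q" using Q(1) by (rule cube_cases)
  obtain hs where hs: "\<And>i. i < n \<Longrightarrow> hs i \<in> HS" "\<And>A i. A \<subseteq> {..<n} \<Longrightarrow> i < n \<Longrightarrow> \<phi> A \<in> hs i \<longleftrightarrow> i \<in> A"
    "\<And>A i. A \<subseteq> {..<n} \<Longrightarrow> i < n \<Longrightarrow> i \<notin> A \<Longrightarrow> H (\<phi> (insert i A)) (\<phi> A) = hs i"
    using cube_halfspaces[OF ch] by blast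
  obtain B where B: "B \<subseteq> {..<n}" "v = \<phi> B" using chart_ex[OF ch Q(2)] .
  have VQ: "Q \<subseteq> V" using cube_subset_V Q by blast
  have vV: "v \<in> V" using VQ Q by blast
  have edge: "H (\<phi> (flip i A)) (\<phi> A) = (if i \<in> A then V - hs i else hs i)" if A: "A \<subseteq> {..<n}" and i: "i < n" for A i
  proof (cases "i \<in> A")
    case True
    have C: "A - {i} \<subseteq> {..<n}" "insert i (A - {i}) = A" using A True by auto
    have "H (\<phi> A) (\<phi> (A - {i})) = hs i" using hs(3)[OF C(1) i] C(2) by simp
    moreover have a: "adj (\<phi> A) (\<phi> (A - {i}))" using adj_chart_flip[OF ch A i] True by (simp add: flip_def)
    ultimately show ?thesis using H_compl[OF a] True by (simp add: flip_def)
  next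
    case False
    then show ?thesis using hs(3)[OF A i] by (simp add: flip_def)
  qed
  have nb: "{a \<in> Q. adj v a} = (\<lambda>i. \<phi> (flip i B)) ` {..<n}"
  proof (intro equalityI subsetI)
    fix a assume "a \<in> {a \<in> Q. adj v a}"
    then obtain A where "A \<subseteq> {..<n}" "a = \<phi> A" "adj v a" using chart_ex[OF ch] by blast
    then show "a \<in> (\<lambda>i. \<phi> (flip i B)) ` {..<n}" using chart_adj_flip[OF ch B(1)] B(2) by blast
  next
    fix a assume "a \<in> (\<lambda>i. \<phi> (flip i B)) ` {..<n}"
    then show "a \<in> {a \<in> Q. adj v a}"
      using adj_chart_flip[OF ch B(1)] chart_mem[OF ch flip_subset[OF B(1)]] B(2) by auto
  qed
  have cross: "\<exists>i<n. k = (if i \<in> B then V - hs i else hs i)" if k: "k \<in> HS" "\<phi> A \<in> k" "v \<notin> k" "A \<subseteq> {..<n}" for k A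
  proof -
    have "\<exists>i<n. k = hs i \<or> k = V - hs i"
    proof (rule ccontr)
      assume n: "\<not> ?thesis"
      have "\<phi> C \<in> k \<longleftrightarrow> \<phi> {} \<in> k" if C: "C \<subseteq> {..<n}" for C
      proof -
        have "finite C" using C finite_subset by blast
        then show ?thesis using C
        proof (induction C rule: finite_induct)
          case (insert i C)
          have C: "C \<subseteq> {..<n}" "i < n" using insert.prems by auto
          have a: "adj (\<phi> C) (\<phi> (insert i C))" using adj_chart_flip[OF ch C] insert by (simp add: flip_def)
          have h: "H (\<phi> (insert i C)) (\<phi> C) = hs i" using hs(3)[OF C insert.hyps(2)] .
          have "\<phi> (insert i C) \<in> k \<longleftrightarrow> \<phi> C \<in> k"
            using crossed[OF a k(1)] crossed[OF adj_sym[OF a] k(1)] h H_compl[OF adj_sym[OF a]] n C by metis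
          then show ?case using insert by simp
        qed simp
      qed
      then show False using k B by blast
    qed
    then obtain i where i: "i < n" "k = hs i \<or> k = V - hs i" by blast
    have "v \<in> hs i \<longleftrightarrow> i \<in> B" using hs(2)[OF B(1) i(1)] B(2) by simp
    then have "k = (if i \<in> B then V - hs i else hs i)" using i k(3) vV by auto
    then show ?thesis using i by blast
  qed
  show ?thesis
  proof (intro equalityI subsetI)
    fix w assume w: "w \<in> Q"
    then obtain A where A: "A \<subseteq> {..<n}" "w = \<phi> A" using chart_ex[OF ch] by blast
    have "\<exists>a\<in>{a \<in> Q. adj v a}. k = H a v" if k: "k \<in> HS" "w \<in> k" "v \<notin> k" for k
    proof -
      obtain i where i: "i < n" "k = (if i \<in> B then V - hs i else hs i)"
        using cross[OF k(1) _ k(3) A(1)] k(2) A(2) by blast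
      then have "k = H (\<phi> (flip i B)) v" using edge[OF B(1) i(1)] B(2) by simp
      then show ?thesis unfolding nb using i(1) by blast
    qed
    then show "w \<in> spanned v {a \<in> Q. adj v a}" unfolding spanned_def using w VQ by blast
  next
    fix w assume w: "w \<in> spanned v {a \<in> Q. adj v a}"
    have wV: "w \<in> V" using w by (simp add: spanned_def)
    have sep: "\<exists>i<n. k = (if i \<in> B then V - hs i else hs i)" if "k \<in> HS" "w \<in> k" "v \<notin> k" for k
    proof -
      have "\<exists>a\<in>(\<lambda>i. \<phi> (flip i B)) ` {..<n}. k = H a v" using w that unfolding spanned_def nb by simp
      then obtain i where i: "i < n" "k = H (\<phi> (flip i B)) v" by auto
      then have "k = (if i \<in> B then V - hs i else hs i)" using edge[OF B(1) i(1)] B(2) by simp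
      then show ?thesis using i(1) by (intro exI[of _ i] conjI)
    qed
    \<comment> \<open>The candidate for \<open>w\<close> is the corner lying on the same side as
      \<open>w\<close> of every hyperplane of the cube.\<close>
    define A where "A = {i. i < n \<and> w \<in> hs i}"
    have A: "A \<subseteq> {..<n}" by (auto simp: A_def)
    have pV: "\<phi> A \<in> V" using chart_mem[OF ch A] VQ by blast
    have key: False if k: "k \<in> HS" "w \<in> k" "\<phi> A \<notin> k" for k
    proof -
      have "\<exists>i<n. k = hs i \<or> k = V - hs i"
      proof (cases "v \<in> k")
        case False then show ?thesis using sep[OF k(1,2)] by metis
      next
        case True
        then have "\<exists>i<n. V - k = (if i \<in> B then V - hs i else hs i)"
          using cross[OF HS_compl[OF k(1)] _ _ A] k pV by blast
        then show ?thesis using HS_double_compl k(1) hs(1) by metis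
      qed
      then obtain i where i: "i < n" "k = hs i \<or> k = V - hs i" by blast
      have "\<phi> A \<in> hs i \<longleftrightarrow> w \<in> hs i" using hs(2)[OF A i(1)] i(1) by (simp add: A_def)
      then show False using k i wV pV by blast
    qed
    have "w = \<phi> A"
    proof (rule same_halfspaces_eq[OF wV pV])
      fix k assume k: "k \<in> HS"
      show "w \<in> k \<longleftrightarrow> \<phi> A \<in> k" using key[OF k] key[OF HS_compl[OF k]] wV pV by blast
    qed
    then show "w \<in> Q" using chart_mem[OF ch A] by simp
  qed
qed

lemma U_sigma_iff: "U x \<Longrightarrow> x \<notin> bd \<Longrightarrow> \<exists>v\<in>V. x = \<sigma> v"
  using bd_iff by blast

section \<open>Halfspaces containing the same boundary points\<close>

definition trace :: "'a set \<Rightarrow> 'a set set set" where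
  "trace h = {u \<in> bd. h \<in> u}"

lemma trace_line:
  assumes l: "line l" and h: "trace h = trace (L l i)" obtains j where "h = L l j"
proof -
  have "h \<in> up l" "h \<notin> dn l"
    using h L_up[OF l, of i] L_dn[OF l, of i] up_bd[OF l] dn_bd[OF l] unfolding trace_def by blast+
  then show ?thesis using up_dn_L[OF l] that by blast
qed

lemma trace_mono: "line l \<Longrightarrow> i \<le> j \<Longrightarrow> trace (L l j) \<subseteq> trace (L l i)"
  unfolding trace_def using U_up[OF bd_U _ L_HS L_mono] by blast

text \<open>By \<open>trace_line\<close>, a halfspace with the same trace as a member of a line lies
  on that line. So the successor on either line occurs on the other one, and neither can be
  skipped.\<close>

lemma trace_step:
  assumes l: "line l" and m: "line m" and e: "L l i = L m j" and t: "trace (L l (i + 1)) = trace (L l i)"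
  shows "L l (i + 1) = L m (j + 1)"
proof -
  obtain j' where j': "L l (i + 1) = L m j'" using trace_line[OF m, of "L l (i + 1)" j] e t by metis
  have "L m j' \<subseteq> L m j" "L m j' \<noteq> L m j" using j' e L_step[OF l, of i] L_inj[OF l, of "i + 1" i] by auto
  then have jj: "j < j'" using L_less[OF m] by (metis order_le_less)
  have "trace (L m (j + 1)) = trace (L m j)"
    using trace_mono[OF m, of j "j + 1"] trace_mono[OF m, of "j + 1" j'] jj j' e t by auto
  then obtain k where k: "L m (j + 1) = L l k" using trace_line[OF l, of "L m (j + 1)" i] e by metis
  have "L l k \<subseteq> L l i" "L l k \<noteq> L l i" using k e L_step[OF m, of j] L_inj[OF m, of "j + 1" j] by auto
  then have "i < k" using L_less[OF l] by (metis order_le_less)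
  moreover have "L l (i + 1) \<subseteq> L l k" unfolding j' k[symmetric] using L_mono[OF m, of "j + 1" j'] jj by simp
  then have "k \<le> i + 1" using L_less[OF l] by blast
  ultimately have "k = i + 1" by simp
  then show ?thesis using k by simp
qed

lemma trace_shift_up:
  assumes l: "line l" and m: "line m" and e: "L l i = L m j" and t: "trace (L l k) = trace (L l i)" "i \<le> k"
  shows "L l k = L m (k + (j - i))"
  using t(2,1)
proof (induction k rule: int_ge_induct)
  case (step k)
  have "trace (L l k) = trace (L l i)"
    using trace_mono[OF l, of i k] trace_mono[OF l, of k "k + 1"] step by auto
  then show ?case using trace_step[OF l m, of k "k + (j - i)"] step by (simp add: algebra_simps)
qed (use e in simp)

lemma trace_shift:
  assumes l: "line l" and m: "line m" and e: "L l i = L m j" and t: "trace (L l k) = trace (L l i)"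
  shows "L l k = L m (k + (j - i))"
proof (cases "i \<le> k")
  case False
  obtain j' where j': "L l k = L m j'" using trace_line[OF m, of "L l k" j] e t by metis
  have "L l i = L m (i + (j' - k))" using trace_shift_up[OF l m j', of i] t False by simp
  then have "j = i + (j' - k)" using e L_inj[OF m] by simp
  then show ?thesis using j' by simp
qed (use trace_shift_up assms in blast)

text \<open>A boundary point of position \<open>p\<close> lies in the trace exactly for indices
  below \<open>p\<close>, so indices of equal trace lie on one side of \<open>p\<close>.\<close>

lemma trace_bounded:
  assumes "u \<in> bd" "has_position l p u"
  shows "{t. trace (L l t) = trace (L l i)} \<subseteq> {..<p} \<or> {t. trace (L l t) = trace (L l i)} \<subseteq> {p..}"
proof -
  have "t < p \<longleftrightarrow> i < p" if "trace (L l t) = trace (L l i)" for t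
    using that assms unfolding trace_def has_position_def by blast
  then show ?thesis by (cases "i < p") (simp_all add: subset_iff not_less)
qed

end

lemma bounded_periodic_int:
  fixes T :: "int set"
  assumes "t \<in> T" "\<And>s. s \<in> T \<longleftrightarrow> s + c \<in> T" "T \<subseteq> {..<p} \<or> T \<subseteq> {p..}" shows "c = 0"
proof (rule ccontr)
  assume c: "c \<noteq> 0"
  have pos: "t + int n * c \<in> T" for n
  proof (induction n)
    case (Suc n)
    then show ?case using assms(2)[of "t + int n * c"] by (simp add: algebra_simps)
  qed (use assms(1) in simp)
  have neg: "t - int n * c \<in> T" for n
  proof (induction n)
    case (Suc n)
    then show ?case using assms(2)[of "t - int (Suc n) * c"] by (simp add: algebra_simps)
  qed (use assms(1) in simp)
  define n where "n = nat (\<bar>t\<bar> + \<bar>p\<bar> + 1)"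
  have n: "int n = \<bar>t\<bar> + \<bar>p\<bar> + 1" by (simp add: n_def)
  consider "c \<ge> 1" | "c \<le> - 1" using c by linarith
  then have "\<bar>t\<bar> + \<bar>p\<bar> + 1 \<le> int n * c \<or> int n * c \<le> - (\<bar>t\<bar> + \<bar>p\<bar> + 1)"
  proof cases
    case 1 then show ?thesis using mult_left_mono[OF 1, of "int n"] n by auto
  next
    case 2 then show ?thesis using mult_left_mono[OF 2, of "int n"] n by auto
  qed
  then show False using assms(3) pos[of n] neg[of n] by (auto simp: subset_iff)
qed

context nonextremal
begin

text \<open>A walk from a vertex in both halfspaces to \<open>w\<close>, outside both, has a first
  step leaving one of them, say \<open>h\<close>. A ray starting there by an edge disjoint from this
  step stays in \<open>h\<close>. Its end also contains \<open>k\<close>, since otherwise the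
  complement of \<open>k\<close>, and with it \<open>w\<close>, would lie behind its first
  edge.\<close>

lemma boundary_in_both:
  assumes h: "h \<in> HS" "k \<in> HS" "h \<inter> k \<noteq> {}" "(V - h) \<inter> (V - k) \<noteq> {}"
  obtains u where "u \<in> bd" "h \<in> u" "k \<in> u"
proof -
  obtain w where w: "w \<in> V" "w \<notin> h" "w \<notin> k" using h(4) by blast
  have main: "\<exists>u\<in>bd. h \<in> u \<and> k \<in> u"
    if hk: "h \<in> HS" "k \<in> HS" "w \<notin> h" "w \<notin> k" "v \<in> h" "v \<in> k" "adj v a" "a \<notin> h" for h k v a
  proof -
    have e: "h = H v a" using crossed hk by blast
    obtain b where b: "adj v b" "H a v \<inter> H b v = {}" using disjoint_edge[OF hk(7)] .
    obtain r where r: "ray r" "r 0 = v" "r 1 = b" using ray_ex[OF b(1)] .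
    have c: "V - h = H a v" using e H_compl hk(7) by simp
    have "h \<in> ray_end r"
    proof (rule ccontr)
      assume "h \<notin> ray_end r"
      then have "H a v \<in> ray_end r" using U_compl[OF en_U[OF r(1)] hk(1)] c by simp
      then have "a = b" using en_first_edge[OF r(1), of a] r hk by simp
      then show False using b H_self(1)[OF adj_sym[OF b(1)]] by blast
    qed
    moreover have "k \<in> ray_end r"
    proof (rule ccontr)
      assume "k \<notin> ray_end r"
      then have "V - k \<in> ray_end r" using U_compl[OF en_U[OF r(1)] hk(2)] by simp
      then have "V - k \<subseteq> H b v" using en_new_subset[OF r(1), of "V - k"] r hk by (simp add: K_def)
      then have "w \<in> H b v" "w \<in> H a v" using w hk c by blast+
      then show False using b by blast
    qed
    ultimately show ?thesis using en_bd[OF r(1)] by blast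
  qed
  obtain v where "v \<in> h \<inter> k" using h(3) by blast
  then have "\<exists>u\<in>bd. h \<in> u \<and> k \<in> u"
  proof (induction "d w v" arbitrary: v)
    case 0
    then have "w = v" using d_eq_0[OF w(1), of v] HS_subset h by auto
    then show ?case using 0 w by blast
  next
    case (Suc n v)
    have vV: "v \<in> V" using Suc.prems HS_subset h by blast
    obtain a where a: "adj v a" "d w a = n" using descend[OF w(1) vV Suc.hyps(2)[symmetric]] .
    show ?case
      using Suc.hyps(1)[of a] Suc.prems a main[of h k v a] main[of k h v a] h(1,2) w by blast
  qed
  then show ?thesis using that by blast
qed

end

section \<open>Isomorphisms of 1-skeleta are cubical\<close>

locale graph_iso = X: cat0 X + Y: cat0 Y
  for X :: "'a set set" and Y :: "'b set set" +
  fixes F :: "'a \<Rightarrow> 'b"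
  assumes F_bij: "bij_betw F X.V Y.V"
    and F_adj: "v \<in> X.V \<Longrightarrow> w \<in> X.V \<Longrightarrow> X.adj v w \<longleftrightarrow> Y.adj (F v) (F w)"
begin

lemma inverse: "graph_iso Y X (inv_into X.V F)"
proof
  show b: "bij_betw (inv_into X.V F) Y.V X.V" using F_bij by (rule bij_betw_inv_into)
  fix v w assume vw: "v \<in> Y.V" "w \<in> Y.V"
  have "F (inv_into X.V F x) = x" "inv_into X.V F x \<in> X.V" if "x \<in> Y.V" for x
    using that F_bij b by (auto simp: bij_betw_inv_into_right bij_betw_apply)
  then show "Y.adj v w \<longleftrightarrow> X.adj (inv_into X.V F v) (inv_into X.V F w)"
    using F_adj[of "inv_into X.V F v" "inv_into X.V F w"] vw by simp
qed

lemma F_V: "v \<in> X.V \<Longrightarrow> F v \<in> Y.V"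
  using F_bij by (rule bij_betw_apply)

lemma F_adj_I: "X.adj v w \<Longrightarrow> Y.adj (F v) (F w)"
  using F_adj X.adj_V by blast

lemma F_eq: "v \<in> X.V \<Longrightarrow> w \<in> X.V \<Longrightarrow> F v = F w \<longleftrightarrow> v = w"
  using F_bij by (metis bij_betw_imp_inj_on inj_on_eq_iff)

lemma d_image_le: assumes "b \<in> X.V" "v \<in> X.V" shows "Y.d (F b) (F v) \<le> X.d b v"
proof -
  obtain p where p: "X.walk b v p" "length p = Suc (X.d b v)" using X.geodesic assms by blast
  have "successively Y.adj (map F p)"
    using p(1) F_adj_I unfolding X.walk_def successively_map by (auto intro: successively_mono)
  then have "Y.walk (F b) (F v) (map F p)"
    using p(1) unfolding X.walk_def Y.walk_def by (auto simp: hd_map last_map)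
  then show ?thesis using Y.d_le p by fastforce
qed

lemma d_image: assumes "b \<in> X.V" "v \<in> X.V" shows "Y.d (F b) (F v) = X.d b v"
proof -
  interpret inv: graph_iso Y X "inv_into X.V F" by (rule inverse)
  have "inv_into X.V F (F x) = x" if "x \<in> X.V" for x
    using that F_bij by (simp add: bij_betw_inv_into_left)
  then show ?thesis
    using d_image_le[OF assms] inv.d_image_le[of "F b" "F v"] assms F_V by (simp add: antisym)
qed

lemma H_image: assumes "X.adj a b" shows "F ` X.H a b = Y.H (F a) (F b)"
proof -
  have V: "a \<in> X.V" "b \<in> X.V" using X.adj_V assms by blast+
  have "F x \<in> Y.H (F a) (F b) \<longleftrightarrow> x \<in> X.H a b" if "x \<in> X.V" for x
    using that V F_V by (simp add: X.H_def Y.H_def d_image)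
  moreover have "Y.V = F ` X.V" using F_bij by (simp add: bij_betw_def)
  then have ex: "\<exists>x\<in>X.V. x' = F x" if "x' \<in> Y.H (F a) (F b)" for x'
    using that Y.H_subset[of "F a" "F b"] by auto
  ultimately have 1: "F x \<in> Y.H (F a) (F b) \<longleftrightarrow> x \<in> X.H a b" if "x \<in> X.V" for x
    using that by blast
  show ?thesis
  proof (intro equalityI subsetI)
    fix x' assume "x' \<in> F ` X.H a b"
    then show "x' \<in> Y.H (F a) (F b)" using 1 X.H_subset[of a b] by auto
  next
    fix x' assume x': "x' \<in> Y.H (F a) (F b)"
    then obtain x where "x \<in> X.V" "x' = F x" using ex by blast
    then show "x' \<in> F ` X.H a b" using 1[of x] x' by blast
  qed
qed

lemma HS_image: "h \<in> X.HS \<Longrightarrow> F ` h \<in> Y.HS"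
  using H_image Y.HS_I F_adj_I by (metis X.HS_E)

lemma HS_preimage: assumes "k \<in> Y.HS" obtains h where "h \<in> X.HS" "k = F ` h"
proof -
  obtain a' b' where k: "Y.adj a' b'" "k = Y.H a' b'" using assms by (rule Y.HS_E)
  have "a' \<in> F ` X.V" "b' \<in> F ` X.V" using Y.adj_V[OF k(1)] F_bij by (auto simp: bij_betw_def)
  then obtain a b where ab: "a \<in> X.V" "b \<in> X.V" "a' = F a" "b' = F b" by blast
  then have "X.adj a b" using F_adj k by simp
  then show ?thesis using that H_image X.HS_I k ab by metis
qed

lemma mem_image: "h \<in> X.HS \<Longrightarrow> v \<in> X.V \<Longrightarrow> F v \<in> F ` h \<longleftrightarrow> v \<in> h"
  using F_eq X.HS_subset by blast

lemma image_eq: "h \<in> X.HS \<Longrightarrow> k \<in> X.HS \<Longrightarrow> F ` h = F ` k \<Longrightarrow> h = k"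
  using mem_image X.HS_subset by blast

lemma sq_image: "X.sq u a c b \<Longrightarrow> Y.sq (F u) (F a) (F c) (F b)"
  by (rule Y.four_cycle_sq) (use F_adj_I X.sq_adj X.sq_neq F_eq X.adj_V in metis)+

lemma spanned_image:
  assumes "v \<in> X.V" "\<And>a. a \<in> N \<Longrightarrow> X.adj v a"
  shows "F ` X.spanned v N = Y.spanned (F v) (F ` N)"
proof -
  have Ha: "Y.H (F a) (F v) = F ` X.H a v" if "a \<in> N" for a
    using H_image[of a v] assms(2)[OF that] X.adj_sym by simp
  have eq: "F ` h = Y.H (F a) (F v) \<longleftrightarrow> h = X.H a v" if "h \<in> X.HS" "a \<in> N" for h a
    using Ha[OF that(2)] image_eq[OF that(1) X.HS_I[OF X.adj_sym[OF assms(2)[OF that(2)]]]] by auto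
  have "F w \<in> Y.spanned (F v) (F ` N) \<longleftrightarrow> w \<in> X.spanned v N" if w: "w \<in> X.V" for w
  proof -
    have "F w \<in> Y.spanned (F v) (F ` N) \<longleftrightarrow>
      (\<forall>h\<in>X.HS. F w \<in> F ` h \<and> F v \<notin> F ` h \<longrightarrow> (\<exists>a\<in>N. F ` h = Y.H (F a) (F v)))"
      unfolding Y.spanned_def using F_V[OF w] HS_image HS_preimage by (auto; metis)
    also have "\<dots> \<longleftrightarrow> (\<forall>h\<in>X.HS. w \<in> h \<and> v \<notin> h \<longrightarrow> (\<exists>a\<in>N. h = X.H a v))"
      using mem_image w assms(1) eq by simp
    finally show ?thesis using w by (simp add: X.spanned_def)
  qed
  moreover have "Y.spanned (F v) (F ` N) \<subseteq> F ` X.V" "X.spanned v N \<subseteq> X.V"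
    using F_bij by (auto simp: bij_betw_def Y.spanned_def X.spanned_def)
  ultimately show ?thesis by blast
qed

text \<open>The images of the neighbours of \<open>v\<close> in \<open>Q\<close> pairwise span
  squares, so flagness of links in \<open>Y\<close> gives a cube, and \<open>spanned\<close>
  identifies it with the image of \<open>Q\<close>.\<close>

lemma cube_image: assumes Q: "Q \<in> X" shows "F ` Q \<in> Y"
proof -
  obtain v where v: "v \<in> Q" using X.cube_nonempty Q by blast
  have vV: "v \<in> X.V" using v X.cube_subset_V Q by blast
  define N where "N = {a \<in> Q. X.adj v a}"
  have QN: "Q = X.spanned v N" unfolding N_def by (rule X.cube_spanned[OF Q v])
  have nb: "X.adj v a" if "a \<in> N" for a using that by (simp add: N_def)
  have im: "F ` Q = Y.spanned (F v) (F ` N)"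
    using spanned_image[OF vV, of N, OF nb] by (simp only: QN[symmetric])
  show ?thesis
  proof (cases "N = {}")
    \<comment> \<open>A 0-cube contributes no simplex to the link and is treated apart.\<close>
    case True
    have e: "{F v} = Y.spanned (F v) {a \<in> {F v}. Y.adj (F v) a}"
      by (rule Y.cube_spanned[OF Y.vertex_cube[OF F_V[OF vV]]]) simp
    have e2: "{a \<in> {F v}. Y.adj (F v) a} = {}" using Y.adj_neq by blast
    have "{F v} = Y.spanned (F v) {}" using e unfolding e2 .
    then have "F ` Q = {F v}" using im True by (simp only: image_empty)
    then show ?thesis using Y.vertex_cube[OF F_V[OF vV]] by (simp only:)
  next
    case False
    obtain Q' where Q': "Q' \<in> Y" "F v \<in> Q'" "{w \<in> Q'. Y.adj (F v) w} = F ` N"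
    proof (rule Y.link_spanned[of "F v" "F ` N"])
      show "F v \<in> Y.V" using F_V vV .
      show "finite (F ` N)" using X.cube_finite[OF Q] by (simp add: N_def)
      show "F ` N \<noteq> {}" using False by simp
      show "Y.adj (F v) a" if "a \<in> F ` N" for a using that F_adj_I by (auto simp: N_def)
      show "\<exists>c. Y.sq (F v) a c b" if ab: "a \<in> F ` N" "b \<in> F ` N" "a \<noteq> b" for a b
      proof -
        obtain p q where pq: "a = F p" "b = F q" "p \<in> N" "q \<in> N" "p \<noteq> q" using ab by blast
        obtain n \<phi> where ch: "cube_chart X n \<phi> Q" using Q by (rule X.cube_cases)
        obtain A B C where A: "A \<subseteq> {..<n}" "v = \<phi> A" "B \<subseteq> {..<n}" "p = \<phi> B" "C \<subseteq> {..<n}" "q = \<phi> C"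
          using X.chart_ex[OF ch] v pq(3,4) unfolding N_def by (metis mem_Collect_eq)
        obtain i j where "i < n" "B = flip i A" "j < n" "C = flip j A"
          using X.chart_adj_flip[OF ch A(1)] A pq(3,4) unfolding N_def by (metis mem_Collect_eq)
        then have "X.sq v p (\<phi> (flip j (flip i A))) q"
          using X.sq_chart_flip[OF ch A(1), of i j] A pq(5) by auto
        then show ?thesis using sq_image pq by blast
      qed
    qed
    have "Q' = Y.spanned (F v) {w \<in> Q'. Y.adj (F v) w}" by (rule Y.cube_spanned[OF Q'(1,2)])
    also have "\<dots> = F ` Q" by (simp only: Q'(3) im)
    finally show ?thesis using Q'(1) by (simp only:)
  qed
qed

lemma cubical_iso: "cubical_iso X Y F"
proof -
  interpret inv: graph_iso Y X "inv_into X.V F" by (rule inverse)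
  have "Q' \<in> (\<lambda>Q. F ` Q) ` X" if Q': "Q' \<in> Y" for Q'
  proof -
    have "F ` (inv_into X.V F ` Q') = Q'"
      using Y.cube_subset_V[OF Q'] F_bij by (intro image_inv_into_cancel) (auto simp: bij_betw_def)
    then show ?thesis using inv.cube_image[OF Q'] by (metis image_eqI)
  qed
  then show ?thesis
    unfolding cubical_iso_def using F_bij cube_image by (auto simp: X.V_def Y.V_def)
qed

end

section \<open>From lines to the isomorphism\<close>

locale two_complexes = X: cat0 X + Y: cat0 Y for X :: "'a set set" and Y :: "'b set set"
begin

text \<open>Let \<open>i2\<close> be the index on \<open>l'\<close> of \<open>Y.L m' j\<close>. The
  indices of equal trace are carried from \<open>l\<close> to \<open>m\<close> by the translation
  \<open>j - i\<close> according to \<open>X\<close>, and by \<open>j - i2\<close> according to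
  \<open>Y\<close>, so they are invariant under \<open>i2 - i\<close>. Being bounded on one side,
  they force \<open>i2 = i\<close>.\<close>

lemma matching_lines:
  assumes l: "X.line l" "Y.line l'" "\<And>s t. X.trace (X.L l s) = X.trace (X.L l t) \<longleftrightarrow> Y.trace (Y.L l' s) = Y.trace (Y.L l' t)"
    and m: "X.line m" "Y.line m'" "\<And>s t. X.trace (X.L m s) = X.trace (X.L m t) \<longleftrightarrow> Y.trace (Y.L m' s) = Y.trace (Y.L m' t)"
    and eq: "X.L l i = X.L m j" "Y.trace (Y.L l' i) = Y.trace (Y.L m' j)"
    and fin: "u \<in> X.bd" "X.has_position l p u"
  shows "Y.L l' i = Y.L m' j"
proof -
  define T where "T = {t. X.trace (X.L l t) = X.trace (X.L l i)}"
  define J where "J = {t. X.trace (X.L m t) = X.trace (X.L m j)}"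
  obtain i2 where i2: "Y.L m' j = Y.L l' i2" using Y.trace_line[OF l(2), of "Y.L m' j" i] eq(2) by metis
  have T2: "T = {t. Y.trace (Y.L l' t) = Y.trace (Y.L l' i2)}"
    unfolding T_def l(3) eq(2) i2 by simp
  have J2: "J = {t. Y.trace (Y.L m' t) = Y.trace (Y.L m' j)}"
    unfolding J_def m(3) by simp
  have 1: "t \<in> T \<Longrightarrow> t + (j - i) \<in> J" for t
    using X.trace_shift[OF l(1) m(1) eq(1), of t] eq(1) by (auto simp: T_def J_def)
  have 2: "t \<in> J \<Longrightarrow> t - (j - i) \<in> T" for t
    using X.trace_shift[OF m(1) l(1) eq(1)[symmetric], of t] eq(1) by (auto simp: T_def J_def algebra_simps)
  have 3: "t \<in> T \<Longrightarrow> t + (j - i2) \<in> J" for t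
    using Y.trace_shift[OF l(2) m(2) i2[symmetric], of t] i2 by (auto simp: T2 J2)
  have 4: "t \<in> J \<Longrightarrow> t - (j - i2) \<in> T" for t
    using Y.trace_shift[OF m(2) l(2) i2, of t] i2 by (auto simp: T2 J2 algebra_simps)
  have per: "s \<in> T \<longleftrightarrow> s + (i2 - i) \<in> T" for s
  proof
    assume "s \<in> T"
    moreover have "s + (j - i) - (j - i2) = s + (i2 - i)" by simp
    ultimately show "s + (i2 - i) \<in> T" using 4[OF 1[of s]] by (simp only:)
  next
    assume "s + (i2 - i) \<in> T"
    moreover have "s + (i2 - i) + (j - i2) - (j - i) = s" by simp
    ultimately show "s \<in> T" using 2[OF 3[of "s + (i2 - i)"]] by (simp only:)
  qed
  have "i2 - i = 0"
    by (rule bounded_periodic_int[of i T _ p]) (use per X.trace_bounded[OF fin, of i] in \<open>auto simp: T_def\<close>)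
  then show ?thesis using i2 by simp
qed

end

locale boundary_match = X: nonextremal X + Y: nonextremal Y
  for X :: "'a set set" and Y :: "'b set set" +
  fixes f :: "'a set set \<Rightarrow> 'b set set"
  assumes bij: "bij_betw f X.bd Y.bd"
begin

sublocale two_complexes X Y by unfold_locales

definition star :: "(int \<Rightarrow> 'a) \<Rightarrow> (int \<Rightarrow> 'b) \<Rightarrow> bool" where
  "star l l' \<longleftrightarrow> X.line l \<and> Y.line l' \<and> (\<forall>u\<in>X.bd. \<forall>i. X.L l i \<in> u \<longleftrightarrow> Y.L l' i \<in> f u)"

text \<open>Halfspaces at the same index on matched lines correspond to each other.\<close>

definition Psi :: "'a set \<Rightarrow> 'b set \<Rightarrow> bool" where
  "Psi h k \<longleftrightarrow> (\<exists>l l' i. star l l' \<and> h = X.L l i \<and> k = Y.L l' i)"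

lemma Psi_HS: "Psi h k \<Longrightarrow> h \<in> X.HS \<and> k \<in> Y.HS"
  unfolding Psi_def star_def using X.L_HS Y.L_HS by blast

lemma Psi_mem: "Psi h k \<Longrightarrow> u \<in> X.bd \<Longrightarrow> h \<in> u \<longleftrightarrow> k \<in> f u"
  unfolding Psi_def star_def by blast

lemma trace_image: assumes "Psi h k" shows "Y.trace k = f ` X.trace h"
proof -
  have "Y.bd = f ` X.bd" using bij by (simp add: bij_betw_def)
  then show ?thesis using Psi_mem[OF assms] unfolding X.trace_def Y.trace_def by auto
qed

lemma trace_image_eq: "f ` X.trace h = f ` X.trace h' \<longleftrightarrow> X.trace h = X.trace h'"
proof -
  have "inj_on f X.bd" using bij by (simp add: bij_betw_def)
  moreover have "X.trace h \<subseteq> X.bd" "X.trace h' \<subseteq> X.bd" by (auto simp: X.trace_def)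
  ultimately show ?thesis by (rule inj_on_image_eq_iff)
qed

lemma star_Psi: "star l l' \<Longrightarrow> Psi (X.L l i) (Y.L l' i)"
  unfolding Psi_def by blast

lemma star_trace: "star l l' \<Longrightarrow> X.trace (X.L l s) = X.trace (X.L l t) \<longleftrightarrow> Y.trace (Y.L l' s) = Y.trace (Y.L l' t)"
  by (simp add: trace_image[OF star_Psi] trace_image_eq)

lemma star_rev: assumes "star l l'" shows "star (\<lambda>i. l (- i)) (\<lambda>i. l' (- i))"
proof -
  have l: "X.line l" "Y.line l'" using assms by (simp_all add: star_def)
  have "X.L (\<lambda>i. l (- i)) i \<in> u \<longleftrightarrow> Y.L (\<lambda>i. l' (- i)) i \<in> f u" if u: "u \<in> X.bd" for u i
  proof -
    have fu: "f u \<in> Y.bd" using bij u by (rule bij_betw_apply)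
    have "X.L l (- i - 1) \<in> u \<longleftrightarrow> Y.L l' (- i - 1) \<in> f u" using assms u by (simp add: star_def)
    then show ?thesis
      using X.L_rev[OF l(1), of i] Y.L_rev[OF l(2), of i] X.U_compl[OF X.bd_U[OF u] X.L_HS[OF l(1)]]
        Y.U_compl[OF Y.bd_U[OF fu] Y.L_HS[OF l(2)]] by simp
  qed
  then show ?thesis using X.line_rev[OF l(1)] Y.line_rev[OF l(2)] by (simp add: star_def)
qed

lemma Psi_compl: assumes "Psi h k" shows "Psi (X.V - h) (Y.V - k)"
proof -
  obtain l l' i where l: "star l l'" "h = X.L l i" "k = Y.L l' i" using assms unfolding Psi_def by blast
  have "X.line l" "Y.line l'" using l by (simp_all add: star_def)
  then have "X.V - h = X.L (\<lambda>i. l (- i)) (- i - 1)" "Y.V - k = Y.L (\<lambda>i. l' (- i)) (- i - 1)"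
    using X.L_rev[of l "- i - 1"] Y.L_rev[of l' "- i - 1"] l by simp_all
  then show ?thesis using star_Psi[OF star_rev[OF l(1)], of "- i - 1"] by simp
qed

end

context boundary_match
begin

text \<open>The setting is symmetric, so statements proved for \<open>f\<close> become available for
  its inverse.\<close>

lemma inverse_boundary_match: "boundary_match Y X (inv_into X.bd f)"
  by unfold_locales (rule bij_betw_inv_into[OF bij])

lemma inverse_star: "boundary_match.star Y X (inv_into X.bd f) l' l \<longleftrightarrow> star l l'"
proof -
  interpret inv: boundary_match Y X "inv_into X.bd f" by (rule inverse_boundary_match)
  have "inv_into X.bd f (f u) = u" if "u \<in> X.bd" for u
    using bij that by (simp add: bij_betw_inv_into_left)
  moreover have "Y.bd = f ` X.bd" using bij by (simp add: bij_betw_def)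
  ultimately show ?thesis by (auto simp: inv.star_def star_def)
qed

lemma inverse_Psi: "boundary_match.Psi Y X (inv_into X.bd f) k h \<longleftrightarrow> Psi h k"
proof -
  interpret inv: boundary_match Y X "inv_into X.bd f" by (rule inverse_boundary_match)
  show ?thesis unfolding inv.Psi_def Psi_def inverse_star by blast
qed

end

locale line_match = boundary_match +
  assumes total: "h \<in> X.HS \<Longrightarrow> \<exists>k. Psi h k"
    and surjective: "k \<in> Y.HS \<Longrightarrow> \<exists>h. Psi h k"
    and position: "star l l' \<Longrightarrow> \<exists>u\<in>X.bd. \<exists>p. X.has_position l p u"
begin

lemma functional: assumes "Psi h k" "Psi h k'" shows "k = k'"
proof -
  obtain l l' i where l: "star l l'" "h = X.L l i" "k = Y.L l' i" using assms(1) unfolding Psi_def by blast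
  obtain m m' j where m: "star m m'" "h = X.L m j" "k' = Y.L m' j" using assms(2) unfolding Psi_def by blast
  obtain u p where u: "u \<in> X.bd" "X.has_position l p u" using position[OF l(1)] by blast
  have "Y.trace k = Y.trace k'" using trace_image assms by simp
  then show ?thesis
    using matching_lines[of l l' m m' i j, OF _ _ star_trace[OF l(1)] _ _ star_trace[OF m(1)] _ _ u] l m
    by (simp add: star_def)
qed

lemma inverse: "line_match Y X (inv_into X.bd f)"
proof -
  interpret inv: boundary_match Y X "inv_into X.bd f" by (rule inverse_boundary_match)
  show ?thesis
  proof
    show "\<exists>h. inv.Psi k h" if "k \<in> Y.HS" for k using surjective[OF that] inverse_Psi by simp
    show "\<exists>k. inv.Psi k h" if "h \<in> X.HS" for h using total[OF that] inverse_Psi by simp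
    fix l' l assume "inv.star l' l"
    then have s: "star l l'" using inverse_star by simp
    then obtain u p where u: "u \<in> X.bd" "X.has_position l p u" using position by blast
    have "f u \<in> Y.bd" using bij u(1) by (rule bij_betw_apply)
    moreover have "Y.has_position l' p (f u)" using s u unfolding star_def X.has_position_def Y.has_position_def by blast
    ultimately show "\<exists>u\<in>Y.bd. \<exists>p. Y.has_position l' p u" by blast
  qed
qed

text \<open>If the complements of \<open>k\<close> and \<open>k'\<close> meet, a boundary point in
  both \<open>k\<close> and \<open>k'\<close> comes from one in \<open>h\<close> and
  \<open>h'\<close>. Otherwise \<open>h'\<close> has the same trace as the complement of
  \<open>h\<close>, so both lie on one line, where disjointness is a comparison of indices and is
  preserved.\<close>

lemma disjoint_image:
  assumes hk: "Psi h k" "Psi h' k'" and disj: "h \<inter> h' = {}" shows "k \<inter> k' = {}"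
proof (rule ccontr)
  assume ne: "k \<inter> k' \<noteq> {}"
  have HS: "h \<in> X.HS" "h' \<in> X.HS" "k \<in> Y.HS" "k' \<in> Y.HS" using Psi_HS hk by blast+
  show False
  proof (cases "(Y.V - k) \<inter> (Y.V - k') = {}")
    case False
    obtain u' where u': "u' \<in> Y.bd" "k \<in> u'" "k' \<in> u'" by (rule Y.boundary_in_both[OF HS(3,4) ne False])
    have "u' \<in> f ` X.bd" using u'(1) bij by (simp add: bij_betw_def)
    then obtain u where u: "u \<in> X.bd" "f u = u'" by blast
    have "h \<in> u" "h' \<in> u" using Psi_mem[OF hk(1) u(1)] Psi_mem[OF hk(2) u(1)] u' u by simp_all
    then show False using X.U_meet[OF X.bd_U[OF u(1)]] disj by blast
  next
    case True
    then have sub: "Y.V - k \<subseteq> k'" by blast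
    have c: "Psi (X.V - h) (Y.V - k)" using Psi_compl hk(1) .
    have "h' \<in> u \<longleftrightarrow> X.V - h \<in> u" if u: "u \<in> X.bd" for u
    proof
      assume "h' \<in> u"
      then show "X.V - h \<in> u"
        using X.U_meet[OF X.bd_U[OF u], of h h'] disj X.U_compl[OF X.bd_U[OF u] HS(1)] by blast
    next
      assume "X.V - h \<in> u"
      then have "Y.V - k \<in> f u" using Psi_mem[OF c u] by blast
      moreover have "f u \<in> Y.bd" using bij u by (rule bij_betw_apply)
      ultimately have "k' \<in> f u" using Y.U_up[OF Y.bd_U _ HS(4) sub] by blast
      then show "h' \<in> u" using Psi_mem[OF hk(2) u] by blast
    qed
    then have tr: "X.trace h' = X.trace (X.V - h)" by (auto simp: X.trace_def)
    obtain l l' i where l: "star l l'" "X.V - h = X.L l i" "Y.V - k = Y.L l' i" using c unfolding Psi_def by blast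
    have ll: "X.line l" "Y.line l'" using l by (simp_all add: star_def)
    obtain j where j: "h' = X.L l j" using X.trace_line[OF ll(1), of h' i] tr l by metis
    have "X.L l j \<subseteq> X.L l i" using disj j l(2) X.HS_subset[OF HS(2)] by blast
    then have "i \<le> j" using X.L_less[OF ll(1)] by simp
    moreover have "k' = Y.L l' j" using functional[OF hk(2)] star_Psi[OF l(1), of j] j by simp
    ultimately have "k' \<subseteq> Y.V - k" using Y.L_mono[OF ll(2)] l(3) by simp
    then show False using ne by blast
  qed
qed

lemma disjoint_iff: assumes "Psi h k" "Psi h' k'" shows "h \<inter> h' = {} \<longleftrightarrow> k \<inter> k' = {}"
proof -
  interpret inv: line_match Y X "inv_into X.bd f" by (rule inverse)
  show ?thesis using disjoint_image[OF assms] inv.disjoint_image[of k h k' h'] assms inverse_Psi by blast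
qed

lemma injective: assumes "Psi h k" "Psi h' k" shows "h = h'"
proof -
  interpret inv: line_match Y X "inv_into X.bd f" by (rule inverse)
  show ?thesis using inv.functional[of k h h'] assms inverse_Psi by blast
qed

section \<open>The induced map on vertices\<close>

definition image :: "'a set set \<Rightarrow> 'b set set" where
  "image x = {k. \<exists>h\<in>x. Psi h k}"

lemma image_bd: assumes "x \<in> X.bd" shows "image x = f x"
proof (intro equalityI subsetI)
  fix k assume "k \<in> image x" then show "k \<in> f x" using Psi_mem[OF _ assms] by (auto simp: image_def)
next
  fix k assume k: "k \<in> f x"
  have "f x \<in> Y.bd" using bij assms by (rule bij_betw_apply)
  then have "k \<in> Y.HS" using Y.U_HS[OF Y.bd_U] k by blast
  then obtain h where h: "Psi h k" using surjective by blast
  then show "k \<in> image x" using Psi_mem[OF h assms] k by (auto simp: image_def)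
qed

lemma image_U: assumes x: "X.U x" shows "Y.U (image x)"
  unfolding Y.U_def
proof (intro conjI ballI)
  show "image x \<subseteq> Y.HS" using Psi_HS by (auto simp: image_def)
  fix k assume k: "k \<in> image x"
  fix k' assume k': "k' \<in> image x"
  obtain h h' where "h \<in> x" "Psi h k" "h' \<in> x" "Psi h' k'" using k k' by (auto simp: image_def)
  then show "k \<inter> k' \<noteq> {}" using X.U_meet[OF x, of h h'] disjoint_iff by blast
next
  fix k assume "k \<in> Y.HS"
  then obtain h where h: "Psi h k" using surjective by blast
  have "h \<in> x \<or> X.V - h \<in> x" using x Psi_HS[OF h] by (auto simp: X.U_def)
  then show "k \<in> image x \<or> Y.V - k \<in> image x" using h Psi_compl[OF h] by (auto simp: image_def)
qed

text \<open>Were the image a boundary point, it would be \<open>f x\<close> for a boundary point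
  \<open>x\<close>, and \<open>\<sigma> v\<close> would be contained in \<open>x\<close>, hence
  equal to it.\<close>

lemma image_vertex: assumes "v \<in> X.V" obtains w where "w \<in> Y.V" "Y.\<sigma> w = image (X.\<sigma> v)"
proof -
  have "image (X.\<sigma> v) \<notin> Y.bd"
  proof
    assume b: "image (X.\<sigma> v) \<in> Y.bd"
    then have "image (X.\<sigma> v) \<in> f ` X.bd" using bij by (simp add: bij_betw_def)
    then obtain x where x: "x \<in> X.bd" "f x = image (X.\<sigma> v)" by (metis imageE)
    have "h \<in> x" if h: "h \<in> X.\<sigma> v" for h
    proof -
      have "h \<in> X.HS" using h by (simp add: X.sigma_eq)
      then obtain k where k: "Psi h k" using total by blast
      then have "k \<in> f x" using h x(2) by (auto simp: image_def)
      then show ?thesis using Psi_mem[OF k x(1)] by simp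
    qed
    then have "X.\<sigma> v = x" using X.U_ext[OF X.U_sigma[OF assms] X.bd_U[OF x(1)]] by blast
    then show False using x(1) assms X.bd_iff by blast
  qed
  then show ?thesis using Y.U_sigma_iff[OF image_U[OF X.U_sigma[OF assms]]] that by metis
qed

definition vmap :: "'a \<Rightarrow> 'b" where
  "vmap v = (SOME w. w \<in> Y.V \<and> Y.\<sigma> w = image (X.\<sigma> v))"

lemma vmap: assumes "v \<in> X.V" shows "vmap v \<in> Y.V" "Y.\<sigma> (vmap v) = image (X.\<sigma> v)"
proof -
  have "\<exists>w. w \<in> Y.V \<and> Y.\<sigma> w = image (X.\<sigma> v)" using image_vertex[OF assms] by metis
  then have "vmap v \<in> Y.V \<and> Y.\<sigma> (vmap v) = image (X.\<sigma> v)" unfolding vmap_def by (rule someI_ex)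
  then show "vmap v \<in> Y.V" "Y.\<sigma> (vmap v) = image (X.\<sigma> v)" by blast+
qed

lemma vmap_mem: assumes "v \<in> X.V" "Psi h k" shows "vmap v \<in> k \<longleftrightarrow> v \<in> h"
proof -
  have HS: "h \<in> X.HS" "k \<in> Y.HS" using Psi_HS assms by blast+
  have "vmap v \<in> k \<longleftrightarrow> k \<in> image (X.\<sigma> v)" using vmap(2)[OF assms(1)] HS Y.sigma_eq by blast
  also have "\<dots> \<longleftrightarrow> h \<in> X.\<sigma> v" using assms(2) injective by (auto simp: image_def)
  finally show ?thesis using HS by (simp add: X.sigma_eq)
qed

lemma vmap_inverse: assumes "v \<in> X.V" shows "line_match.vmap Y X (inv_into X.bd f) (vmap v) = v"
proof -
  interpret inv: line_match Y X "inv_into X.bd f" by (rule inverse)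
  show ?thesis
  proof (rule X.same_halfspaces_eq[OF inv.vmap(1)[OF vmap(1)[OF assms]] assms])
    fix h assume "h \<in> X.HS"
    then obtain k where k: "Psi h k" using total by blast
    then show "inv.vmap (vmap v) \<in> h \<longleftrightarrow> v \<in> h"
      using inv.vmap_mem[OF vmap(1)[OF assms], of k h] vmap_mem[OF assms k] inverse_Psi by simp
  qed
qed

lemma vmap_bij: "bij_betw vmap X.V Y.V"
proof -
  interpret inv: line_match Y X "inv_into X.bd f" by (rule inverse)
  show ?thesis
  proof (rule bij_betw_byWitness[where f' = inv.vmap])
    show "\<forall>v\<in>X.V. inv.vmap (vmap v) = v" using vmap_inverse by blast
    show "\<forall>w\<in>Y.V. vmap (inv.vmap w) = w"
    proof
      fix w assume w: "w \<in> Y.V"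
      show "vmap (inv.vmap w) = w"
      proof (rule Y.same_halfspaces_eq[OF vmap(1)[OF inv.vmap(1)[OF w]] w])
        fix k assume "k \<in> Y.HS"
        then obtain h where h: "Psi h k" using surjective by blast
        then show "vmap (inv.vmap w) \<in> k \<longleftrightarrow> w \<in> k"
          using inv.vmap_mem[OF w, of k h] vmap_mem[OF inv.vmap(1)[OF w] h] inverse_Psi by simp
      qed
    qed
    show "vmap ` X.V \<subseteq> Y.V" using vmap(1) by blast
    show "inv.vmap ` Y.V \<subseteq> X.V" using inv.vmap(1) by blast
  qed
qed

lemma vmap_adj: assumes "v \<in> X.V" "w \<in> X.V" shows "X.adj v w \<longleftrightarrow> Y.adj (vmap v) (vmap w)"
proof -
  have ne: "(v \<noteq> w) = (vmap v \<noteq> vmap w)" using vmap_bij assms by (metis bij_betw_imp_inj_on inj_on_eq_iff)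
  have sep: "(\<forall>h\<in>X.HS. \<forall>k\<in>X.HS. v \<in> h \<and> w \<notin> h \<and> v \<in> k \<and> w \<notin> k \<longrightarrow> h = k) \<longleftrightarrow>
    (\<forall>h\<in>Y.HS. \<forall>k\<in>Y.HS. vmap v \<in> h \<and> vmap w \<notin> h \<and> vmap v \<in> k \<and> vmap w \<notin> k \<longrightarrow> h = k)" (is "?l \<longleftrightarrow> ?r")
  proof
    assume l: ?l
    show ?r
    proof (intro ballI impI)
      fix h' k' assume *: "h' \<in> Y.HS" "k' \<in> Y.HS" "vmap v \<in> h' \<and> vmap w \<notin> h' \<and> vmap v \<in> k' \<and> vmap w \<notin> k'"
      obtain h k where hk: "Psi h h'" "Psi k k'" using surjective * by metis
      then have "h = k" using l * Psi_HS vmap_mem assms by metis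
      then show "h' = k'" using functional hk by blast
    qed
  next
    assume r: ?r
    show ?l
    proof (intro ballI impI)
      fix h k assume *: "h \<in> X.HS" "k \<in> X.HS" "v \<in> h \<and> w \<notin> h \<and> v \<in> k \<and> w \<notin> k"
      obtain h' k' where hk: "Psi h h'" "Psi k k'" using total * by metis
      then have "h' = k'" using r * Psi_HS vmap_mem assms by metis
      then show "h = k" using injective hk by blast
    qed
  qed
  show ?thesis
    unfolding X.adj_iff[OF assms] Y.adj_iff[OF vmap(1)[OF assms(1)] vmap(1)[OF assms(2)]]
    by (rule conj_cong[OF ne sep])
qed

lemma vmap_graph_iso: "graph_iso X Y vmap"
  by unfold_locales (use vmap_bij vmap_adj in auto)

lemma vmap_halfspace: assumes "Psi h k" shows "vmap ` h = k"
proof -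
  have Y: "Y.V = vmap ` X.V" using vmap_bij by (simp add: bij_betw_def)
  have sub: "h \<subseteq> X.V" "k \<subseteq> Y.V" using Psi_HS[OF assms] X.HS_subset Y.HS_subset by blast+
  show ?thesis
  proof (intro equalityI subsetI)
    fix w assume "w \<in> vmap ` h"
    then show "w \<in> k" using vmap_mem[OF _ assms] sub(1) by auto
  next
    fix w assume w: "w \<in> k"
    then obtain v where "v \<in> X.V" "w = vmap v" using Y sub(2) by blast
    then show "w \<in> vmap ` h" using vmap_mem[OF _ assms] w by blast
  qed
qed

section \<open>Existence and uniqueness of the extension\<close>

lemma extension_exists:
  "\<exists>F. F \<in> extensional (verts X) \<and> cubical_iso X Y F \<and> (\<forall>x\<in>X.bd. induced_map F x = f x)"
proof -
  \<comment> \<open>The restriction fixes the values off the vertex set, so that uniqueness concerns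
    only the values on vertices.\<close>
  define F where "F = restrict vmap (verts X)"
  have F: "F v = vmap v" if "v \<in> X.V" for v using that by (simp add: F_def X.V_def)
  have Fh: "F ` h = vmap ` h" if "h \<subseteq> X.V" for h using F that by (intro image_cong) auto
  interpret graph_iso X Y vmap by (rule vmap_graph_iso)
  have "(\<lambda>Q. F ` Q) ` X = (\<lambda>Q. vmap ` Q) ` X" by (rule image_cong[OF refl]) (use Fh X.cube_subset_V in blast)
  moreover have "bij_betw F (verts X) (verts Y)"
    using vmap_bij unfolding F_def X.V_def[symmetric] Y.V_def[symmetric] by (simp add: bij_betw_restrict_eq)
  ultimately have "cubical_iso X Y F" using cubical_iso by (simp add: cubical_iso_def)
  moreover have "induced_map F x = f x" if x: "x \<in> X.bd" for x
  proof -
    have "F ` h \<in> f x" if h: "h \<in> x" for h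
    proof -
      have hH: "h \<in> X.HS" using X.U_HS[OF X.bd_U[OF x] h] .
      obtain k where k: "Psi h k" using total[OF hH] by blast
      then show ?thesis using vmap_halfspace[OF k] Fh[OF X.HS_subset[OF hH]] Psi_mem[OF k x] h by simp
    qed
    moreover have "k \<in> induced_map F x" if k: "k \<in> f x" for k
    proof -
      obtain h where h: "h \<in> x" "Psi h k" using k image_bd[OF x] by (auto simp: image_def)
      have "F ` h = k" using vmap_halfspace[OF h(2)] Fh[OF X.HS_subset] Psi_HS[OF h(2)] by simp
      then show ?thesis using h(1) by (auto simp: induced_map_def)
    qed
    ultimately show ?thesis by (auto simp: induced_map_def)
  qed
  moreover have "F \<in> extensional (verts X)" by (simp add: F_def)
  ultimately show ?thesis by blast
qed

lemma cubical_iso_graph_iso: assumes "cubical_iso X Y F" shows "graph_iso X Y F"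
proof
  have b: "bij_betw F X.V Y.V" and im: "(\<lambda>Q. F ` Q) ` X = Y"
    using assms by (simp_all add: cubical_iso_def X.V_def Y.V_def)
  show "bij_betw F X.V Y.V" by (rule b)
  have inj: "inj_on F X.V" using b by (simp add: bij_betw_def)
  fix v w assume vw: "v \<in> X.V" "w \<in> X.V"
  have "{v, w} \<in> X \<longleftrightarrow> {F v, F w} \<in> Y"
  proof
    assume "{v, w} \<in> X"
    then have "F ` {v, w} \<in> Y" using im by blast
    then show "{F v, F w} \<in> Y" by simp
  next
    assume "{F v, F w} \<in> Y"
    then obtain Q where Q: "Q \<in> X" "F ` Q = F ` {v, w}" using im by auto
    then have "Q = {v, w}" using inj_on_image_eq_iff[OF inj X.cube_subset_V[OF Q(1)], of "{v, w}"] vw by simp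
    then show "{v, w} \<in> X" using Q by simp
  qed
  moreover have "card {v, w} = 2 \<longleftrightarrow> card {F v, F w} = 2"
    using inj_on_eq_iff[OF inj vw] by (cases "v = w") auto
  ultimately show "X.adj v w \<longleftrightarrow> Y.adj (F v) (F w)" by (simp add: X.adj_def Y.adj_def edges_def)
qed

text \<open>An extension carries a line through \<open>h\<close> to a line matched with it by
  \<open>f\<close>, so it induces the correspondence \<open>Psi\<close>; as this is functional, two
  extensions agree on halfspaces.\<close>

lemma extension_Psi:
  assumes iso: "cubical_iso X Y F" and ind: "\<And>x. x \<in> X.bd \<Longrightarrow> induced_map F x = f x" and h: "h \<in> X.HS"
  shows "Psi h (F ` h)"
proof -
  interpret graph_iso X Y F by (rule cubical_iso_graph_iso[OF iso])
  obtain a b where ab: "X.adj a b" "h = X.H a b" using h by (rule X.HS_E)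
  obtain l where l: "X.line l" "l 0 = b" "l 1 = a" using X.line_ex[OF X.adj_sym[OF ab(1)]] .
  have h0: "h = X.L l 0" using l ab by (simp add: X.L_def)
  have L: "Y.L (\<lambda>i. F (l i)) i = F ` X.L l i" for i
    using H_image[OF X.adj_sym[OF X.line_adj[OF l(1), of i]]] by (simp add: X.L_def Y.L_def)
  have l': "Y.line (\<lambda>i. F (l i))"
    unfolding Y.line_def
  proof (intro allI conjI)
    fix i
    show "Y.adj (F (l i)) (F (l (i + 1)))" using F_adj_I X.line_adj[OF l(1)] by blast
    have e: "i + 1 + 1 = i + 2" by simp
    have "Y.H (F (l (i + 2))) (F (l (i + 1))) = F ` X.L l (i + 1)" using L[of "i + 1"] by (simp only: Y.L_def e)
    moreover have "Y.H (F (l (i + 1))) (F (l i)) = F ` X.L l i" using L[of i] by (simp only: Y.L_def)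
    ultimately show "Y.H (F (l (i + 2))) (F (l (i + 1))) \<subseteq> Y.H (F (l (i + 1))) (F (l i))"
      using image_mono[OF X.L_step[OF l(1), of i], of F] by (simp only:)
  qed
  have "X.L l i \<in> u \<longleftrightarrow> Y.L (\<lambda>i. F (l i)) i \<in> f u" if u: "u \<in> X.bd" for u i
  proof -
    have "F ` X.L l i \<in> (\<lambda>h. F ` h) ` u \<longleftrightarrow> X.L l i \<in> u"
      using image_eq[OF X.L_HS[OF l(1)] X.U_HS[OF X.bd_U[OF u]]] by blast
    then show ?thesis using L ind[OF u] by (simp add: induced_map_def)
  qed
  then have "star l (\<lambda>i. F (l i))" using l l' by (simp add: star_def)
  then show ?thesis unfolding h0 L[symmetric] by (rule star_Psi)
qed

lemma extension_unique:
  assumes "F \<in> extensional (verts X)" "cubical_iso X Y F" "\<And>x. x \<in> X.bd \<Longrightarrow> induced_map F x = f x"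
    and "G \<in> extensional (verts X)" "cubical_iso X Y G" "\<And>x. x \<in> X.bd \<Longrightarrow> induced_map G x = f x"
  shows "F = G"
proof (rule extensionalityI[OF assms(1,4)])
  interpret F: graph_iso X Y F by (rule cubical_iso_graph_iso[OF assms(2)])
  interpret G: graph_iso X Y G by (rule cubical_iso_graph_iso[OF assms(5)])
  fix v assume "v \<in> verts X"
  then have v: "v \<in> X.V" by (simp add: X.V_def)
  show "F v = G v"
  proof (rule Y.same_halfspaces_eq[OF F.F_V[OF v] G.F_V[OF v]])
    fix k assume "k \<in> Y.HS"
    then obtain h where h: "h \<in> X.HS" "k = F ` h" by (rule F.HS_preimage)
    have "k = G ` h" using functional extension_Psi[OF assms(2,3) h(1)] extension_Psi[OF assms(5,6) h(1)] h by blast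
    then show "F v \<in> k \<longleftrightarrow> G v \<in> k" using F.mem_image[OF h(1) v] G.mem_image[OF h(1) v] h(2) by simp
  qed
qed

end

context moebius
begin

lemma line_match: "line_match X Y f"
proof -
  interpret M: boundary_match X Y f by unfold_locales (rule bij)
  show ?thesis
  proof
    fix h assume "h \<in> X.HS"
    then obtain a b where ab: "X.adj a b" "h = X.H a b" by (rule X.HS_E)
    obtain l where l: "X.line l" "l 0 = b" "l 1 = a" using X.line_ex[OF X.adj_sym[OF ab(1)]] .
    have h0: "h = X.L l 0" using l ab by (simp add: X.L_def)
    obtain l' where "Y.line l'" "\<And>u i. u \<in> X.bd \<Longrightarrow> X.L l i \<in> u \<longleftrightarrow> Y.L l' i \<in> f u"
      using image_line[OF l(1)] by metis
    then have "M.star l l'" using l(1) by (simp add: M.star_def)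
    then show "\<exists>k. M.Psi h k" using M.star_Psi h0 by blast
  next
    fix k assume "k \<in> Y.HS"
    then obtain a b where ab: "Y.adj a b" "k = Y.H a b" by (rule Y.HS_E)
    obtain m where m: "Y.line m" "m 0 = b" "m 1 = a" using Y.line_ex[OF Y.adj_sym[OF ab(1)]] .
    have k0: "k = Y.L m 0" using m ab by (simp add: Y.L_def)
    obtain l where l: "X.line l" "f (X.dn l) = Y.dn m" "f (X.up l) = Y.up m" using preimage_line_ends[OF m(1)] .
    obtain l' where l': "Y.line l'" "\<And>u i. u \<in> X.bd \<Longrightarrow> X.L l i \<in> u \<longleftrightarrow> Y.L l' i \<in> f u"
      "\<And>k. k \<in> f (X.up l) \<Longrightarrow> k \<notin> f (X.dn l) \<Longrightarrow> k \<in> range (Y.L l')"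
      using image_line[OF l(1)] by metis
    \<comment> \<open>\<open>k\<close> separates the ends of \<open>m\<close>, which are the images
      of the ends of \<open>l\<close>, so it occurs on the matched line \<open>l'\<close>.\<close>
    have "k \<in> range (Y.L l')" using l'(3)[of k] l k0 Y.L_up[OF m(1)] Y.L_dn[OF m(1)] by simp
    moreover have "M.star l l'" using l(1) l' by (simp add: M.star_def)
    ultimately show "\<exists>h. M.Psi h k" using M.star_Psi by blast
  next
    fix l l' assume "M.star l l'"
    then have "X.line l" by (simp add: M.star_def)
    then show "\<exists>u\<in>X.bd. \<exists>p. X.has_position l p u" using X.finite_position_ex[OF not_line] by metis
  qed
qed

end

theorem mainTheorem1:
  fixes X :: "'a set set" and Y :: "'b set set"
    and f :: "'a set set \<Rightarrow> 'b set set"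
  assumes "cat0_cube_complex X" and "cat0_cube_complex Y"
    and "\<not> (\<exists>v. extremal_vertex X v)" and "\<not> (\<exists>v. extremal_vertex Y v)"
    and "\<not> isomorphic_complexes X real_line_complex"
    and "\<not> isomorphic_complexes Y real_line_complex"
    and "bij_betw f (roller_boundary X) (roller_boundary Y)"
    and "moebius_map X Y f"
  shows "\<exists>!F. F \<in> extensional (verts X) \<and> cubical_iso X Y F \<and>
           (\<forall>x\<in>roller_boundary X. induced_map F x = f x)"
proof -
  interpret moebius X Y f
    by unfold_locales (use assms in auto)
  interpret line_match X Y f by (rule line_match)
  show ?thesis
    using extension_exists extension_unique by (intro ex_ex1I) blast+
qed

end
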